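(* Let $\mu$ be a $\sigma$-finite measure on $[0,T]$ and let $x_0\in\mathbb{R}^n$. Consider the coupled nonlinear FBSDE $$X_t = x_0 + \int_0^t b(s,X_s,Y_s,Z_s)\,ds + \int_0^t\sigma(s,X_s,Y_s,Z_s)\,dW_s,\qquad Y_t = g(X_T) + \int_t^T f(s,X_s,Y_s,Z_s)\,ds - \int_t^T Z_s\,dW_s .$$ Assume that $b\in L^2_{\mathcal{F}}(0,T;W^{1,\infty}(M;\mathbb{R}^n))$, $\sigma\in L^2_{\mathcal{F}}(0,T;W^{1,\infty}(M;\mathbb{R}^{n\times d}))$, $f\in L^2_{\mathcal{F}}(0,T;W^{1,\infty}(M;\mathbb{R}^m))$ with $M=\mathbb{R}^n\times\mathbb{R}^m\times\mathbb{R}^{m\times d}$, and $g\in L^2_{\mathcal{F}_T}(\Omega;W^{1,\infty}(\mathbb{R}^n;\mathbb{R}^m))$. For $(\tilde y,\tilde z)\in\mathcal{M}[0,T]$, let $(\widetilde X,\widetilde Y,\widetilde Z)$ be the solution of the decoupled system $$\widetilde X_t = x_0+\int_0^t b(s,\widetilde X_s,\tilde y_s,\tilde z_s)\,ds+\int_0^t\sigma(s,\widetilde X_s,\tilde y_s,\tilde z_s)\,dW_s,$$ $$\widetilde Y_t = g(\widetilde X_T)+\int_t^T f(s,\widetilde X_s,\tilde y_s,\tilde z_s)\,ds-\int_t^T\widetilde Z_s\,dW_s,\qquad t\in[0,T],$$ where $\widetilde X\in L^2_{\mathcal{F}}(\Omega;C[0,T];\mathbb{R}^n)$ and $(\widetilde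 Y,\widetilde Z)\in\mathcal{M}[0,T]$. Then for every $(\tilde y,\tilde z)\in\mathcal{M}[0,T]$, $$\operatorname{BML}(\tilde y,\tilde z;\mu)=\operatorname{dist}_\mu\bigl((\tilde y,\tilde z),(\widetilde Y,\widetilde Z)\bigr).$$
   Context: $T\in(0,\infty)$; $(\Omega,\mathcal{F},\mathbb{P})$ is a complete probability space carrying a $d$-dimensional standard Brownian motion $W$ with natural filtration $\mathbb{F}=\{\mathcal{F}_t\}_{0\le t\le T}$. Spaces. $L^2_{\mathcal{F}}(0,T;N)$: $\mathbb{F}$-adapted processes $X:\Omega\times[0,T]\to N$ with $\int_0^T\mathbb{E}|X(t)|^2dt<\infty$. $L^2_{\mathcal{F}}(\Omega;C[0,T];N)$: continuous $\mathbb{F}$-adapted processes with $\mathbb{E}\sup_{t\in[0,T]}|X(t)|^2<\infty$. $\mathcal{M}[0,T]=L^2_{\mathcal{F}}(\Omega;C[0,T];\mathbb{R}^m)\times L^2_{\mathcal{F}}(0,T;\mathbb{R}^{m\times d})$. $L^2_{\mathcal{F}_T}(\Omega;W^{1,\infty}(M;N))$: functions $g:\Omega\times M\to N$ that are Lipschitz in $\theta\in M$ with a deterministic constant $L_g$ (almost surely), $\mathcal{F}_T$-measurable for each fixed $\theta$, with $g(0)$ square integrable. $L^2_{\mathcal{F}}(0,T;W^{1,\infty}(M;N))$: functions $f:\Omega\times[0,T]\times M\to N$ that are Lipschitz in $\theta\in M$ with a deterministic constant $L_f$ uniform in $t$, $\mathbb{F}$-adapted for each fixed $\theta$, with $f(\cdot,0)\in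 L^2_{\mathcal{F}}(0,T;N)$. Backward measurability loss (BML) of a trial solution $(\tilde y,\tilde z)\in\mathcal{M}[0,T]$ with respect to the FBSDE: $$\operatorname{BML}(\tilde y,\tilde z;\mu)=\int_0^T\mathbb{E}\Bigl|\tilde y_t-\Bigl(g(\widetilde X_T)+\int_t^T f(s,\widetilde X_s,\tilde y_s,\tilde z_s)\,ds-\int_t^T\tilde z_s\,dW_s\Bigr)\Bigr|^2\mu(dt),$$ where $\widetilde X$ solves $\widetilde X_t=x_0+\int_0^t b(s,\widetilde X_s,\tilde y_s,\tilde z_s)\,ds+\int_0^t\sigma(s,\widetilde X_s,\tilde y_s,\tilde z_s)\,dW_s$. Distance on $\mathcal{M}[0,T]$: $$\operatorname{dist}_\mu((\hat y,\hat z),(\check y,\check z))=\int_0^T\mathbb{E}\Bigl\{|\hat y_t-\check y_t|^2+\int_t^T|\hat z_s-\check z_s|^2\,ds\Bigr\}\mu(dt).$$ Both quantities take values in $[0,\infty]$. *)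

theory Defs
  imports "HOL-Probability.Probability"
begin

section \<open>Brownian motion and its filtration\<close>

definition natural_filtration ::
  "'a measure \<Rightarrow> (real \<Rightarrow> 'a \<Rightarrow> real^'d) \<Rightarrow> real \<Rightarrow> 'a measure" where
  "natural_filtration P W t =
     sigma (space P) {W s -` A \<inter> space P | s A. s \<in> {0..t} \<and> A \<in> sets borel}"

text \<open>Increments are independent of the past and centred normal with covariance matrix
  \<open>(t - s) I\<close>, that is, with independent coordinates of variance \<open>t - s\<close>.\<close>

definition brownian_motion ::
  "'a measure \<Rightarrow> real \<Rightarrow> (real \<Rightarrow> 'a \<Rightarrow> real^'d) \<Rightarrow> bool" where
  "brownian_motion P T W \<longleftrightarrow>
     prob_space P \<and>
     (\<forall>t\<in>{0..T}. W t \<in> borel_measurable P) \<and>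
     (AE \<omega> in P. W 0 \<omega> = 0) \<and>
     (AE \<omega> in P. continuous_on {0..T} (\<lambda>t. W t \<omega>)) \<and>
     (\<forall>s t. 0 \<le> s \<and> s < t \<and> t \<le> T \<longrightarrow>
        prob_space.indep_set P (sets (natural_filtration P W s))
          (sets (vimage_algebra (space P) (\<lambda>\<omega>. W t \<omega> - W s \<omega>) borel)) \<and>
        prob_space.indep_vars P (\<lambda>_. borel) (\<lambda>j \<omega>. (W t \<omega> - W s \<omega>) $ j) UNIV \<and>
        (\<forall>j. distributed P lborel (\<lambda>\<omega>. (W t \<omega> - W s \<omega>) $ j)
           (\<lambda>x. ennreal (normal_density 0 (sqrt (t - s)) x))))"

text \<open>As usual on a complete probability space, the filtration generated by \<open>W\<close> is augmented by
  the null sets.  Without them, a random field that is Lipschitz only almost surely need not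
  preserve adaptedness.\<close>

definition brownian_filtration ::
  "'a measure \<Rightarrow> (real \<Rightarrow> 'a \<Rightarrow> real^'d) \<Rightarrow> real \<Rightarrow> 'a measure" where
  "brownian_filtration P W t =
     sigma (space P) (sets (natural_filtration P W t) \<union> null_sets P)"

section \<open>Spaces of processes and random fields\<close>

text \<open>Processes that are adapted are also required to be jointly measurable, so that their time
  integrals make sense.\<close>

definition adapted_process ::
  "'a measure \<Rightarrow> (real \<Rightarrow> 'a measure) \<Rightarrow> real \<Rightarrow> (real \<Rightarrow> 'a \<Rightarrow> 'b::euclidean_space) \<Rightarrow> bool" where
  "adapted_process P F T X \<longleftrightarrow>
     (\<forall>t\<in>{0..T}. X t \<in> borel_measurable (F t)) \<and>
     (\<lambda>(t, \<omega>). X t \<omega>) \<in> borel_measurable (restrict_space borel {0..T} \<Otimes>\<^sub>M P)"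

definition L2_adapted ::
  "'a measure \<Rightarrow> (real \<Rightarrow> 'a measure) \<Rightarrow> real \<Rightarrow> (real \<Rightarrow> 'a \<Rightarrow> 'b::euclidean_space) set" where
  "L2_adapted P F T = {X. adapted_process P F T X \<and>
     (\<integral>\<^sup>+t\<in>{0..T}. (\<integral>\<^sup>+\<omega>. ennreal ((norm (X t \<omega>))\<^sup>2) \<partial>P) \<partial>lborel) < \<infinity>}"

definition L2_continuous ::
  "'a measure \<Rightarrow> (real \<Rightarrow> 'a measure) \<Rightarrow> real \<Rightarrow> (real \<Rightarrow> 'a \<Rightarrow> 'b::euclidean_space) set" where
  "L2_continuous P F T = {X.
     (\<forall>t\<in>{0..T}. X t \<in> borel_measurable (F t)) \<and>
     (\<forall>\<omega>\<in>space P. continuous_on {0..T} (\<lambda>t. X t \<omega>)) \<and>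
     (\<integral>\<^sup>+\<omega>. (SUP t\<in>{0..T}. ennreal ((norm (X t \<omega>))\<^sup>2)) \<partial>P) < \<infinity>}"

definition trial_space ::
  "'a measure \<Rightarrow> (real \<Rightarrow> 'a measure) \<Rightarrow> real
    \<Rightarrow> ((real \<Rightarrow> 'a \<Rightarrow> real^'m) \<times> (real \<Rightarrow> 'a \<Rightarrow> real^'d^'m)) set" where
  "trial_space P F T = L2_continuous P F T \<times> L2_adapted P F T"

definition L2_terminal_Lipschitz ::
  "'a measure \<Rightarrow> 'a measure \<Rightarrow> ('a \<Rightarrow> 'c::euclidean_space \<Rightarrow> 'b::euclidean_space) set" where
  "L2_terminal_Lipschitz P G = {g.
     (\<exists>L. AE \<omega> in P. L-lipschitz_on UNIV (g \<omega>)) \<and>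
     (\<forall>\<theta>. (\<lambda>\<omega>. g \<omega> \<theta>) \<in> borel_measurable G) \<and>
     (\<integral>\<^sup>+\<omega>. ennreal ((norm (g \<omega> 0))\<^sup>2) \<partial>P) < \<infinity>}"

definition L2_adapted_Lipschitz ::
  "'a measure \<Rightarrow> (real \<Rightarrow> 'a measure) \<Rightarrow> real
    \<Rightarrow> (real \<Rightarrow> 'a \<Rightarrow> 'c::euclidean_space \<Rightarrow> 'b::euclidean_space) set" where
  "L2_adapted_Lipschitz P F T = {f.
     (\<exists>L. AE \<omega> in P. \<forall>t\<in>{0..T}. L-lipschitz_on UNIV (f t \<omega>)) \<and>
     (\<forall>\<theta>. adapted_process P F T (\<lambda>t \<omega>. f t \<omega> \<theta>)) \<and>
     (\<lambda>t \<omega>. f t \<omega> 0) \<in> L2_adapted P F T}"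

section \<open>The Ito integral\<close>

text \<open>The triple \<open>(k, \<tau>, \<xi>)\<close> encodes the simple process which is equal to \<open>\<xi> i\<close> on the time interval
  from \<open>\<tau> i\<close> (excluded) to \<open>\<tau> (i + 1)\<close> (included), for \<open>i < k\<close>.\<close>

definition simple_integrand ::
  "'a measure \<Rightarrow> (real \<Rightarrow> 'a measure) \<Rightarrow> real \<Rightarrow> real
    \<Rightarrow> nat \<Rightarrow> (nat \<Rightarrow> real) \<Rightarrow> (nat \<Rightarrow> 'a \<Rightarrow> real^'d^'m) \<Rightarrow> bool" where
  "simple_integrand P F a b k \<tau> \<xi> \<longleftrightarrow>
     \<tau> 0 = a \<and> \<tau> k = b \<and>
     (\<forall>i<k. \<tau> i \<le> \<tau> (Suc i) \<and> \<xi> i \<in> borel_measurable (F (\<tau> i)) \<and>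
        (\<exists>C. \<forall>\<omega>\<in>space P. norm (\<xi> i \<omega>) \<le> C))"

definition simple_process ::
  "nat \<Rightarrow> (nat \<Rightarrow> real) \<Rightarrow> (nat \<Rightarrow> 'a \<Rightarrow> real^'d^'m) \<Rightarrow> real \<Rightarrow> 'a \<Rightarrow> real^'d^'m" where
  "simple_process k \<tau> \<xi> s \<omega> = (\<Sum>i<k. indicator {\<tau> i<..\<tau> (Suc i)} s *\<^sub>R \<xi> i \<omega>)"

definition simple_integral ::
  "(real \<Rightarrow> 'a \<Rightarrow> real^'d) \<Rightarrow> nat \<Rightarrow> (nat \<Rightarrow> real) \<Rightarrow> (nat \<Rightarrow> 'a \<Rightarrow> real^'d^'m) \<Rightarrow> 'a \<Rightarrow> real^'m" where
  "simple_integral W k \<tau> \<xi> \<omega> = (\<Sum>i<k. \<xi> i \<omega> *v (W (\<tau> (Suc i)) \<omega> - W (\<tau> i) \<omega>))"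

text \<open>\<open>I\<close> is a version of the integral of \<open>Z\<close> over the interval from \<open>a\<close> to \<open>b\<close>: it is the
  mean-square limit of the integrals of simple processes that approximate \<open>Z\<close>.  The norm on
  matrices is the Frobenius norm.\<close>

definition has_ito_integral ::
  "'a measure \<Rightarrow> (real \<Rightarrow> 'a measure) \<Rightarrow> (real \<Rightarrow> 'a \<Rightarrow> real^'d) \<Rightarrow> real \<Rightarrow> real
    \<Rightarrow> (real \<Rightarrow> 'a \<Rightarrow> real^'d^'m) \<Rightarrow> ('a \<Rightarrow> real^'m) \<Rightarrow> bool" where
  "has_ito_integral P F W a b Z I \<longleftrightarrow>
     I \<in> borel_measurable P \<and>
     (\<exists>k \<tau> \<xi>. (\<forall>n::nat. simple_integrand P F a b (k n) (\<tau> n) (\<xi> n)) \<and>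
        (\<lambda>n. \<integral>\<^sup>+s\<in>{a..b}. (\<integral>\<^sup>+\<omega>.
           ennreal ((norm (Z s \<omega> - simple_process (k n) (\<tau> n) (\<xi> n) s \<omega>))\<^sup>2) \<partial>P) \<partial>lborel)
           \<longlonglongrightarrow> 0 \<and>
        (\<lambda>n. \<integral>\<^sup>+\<omega>.
           ennreal ((norm (I \<omega> - simple_integral W (k n) (\<tau> n) (\<xi> n) \<omega>))\<^sup>2) \<partial>P)
           \<longlonglongrightarrow> 0)"

text \<open>The integral is determined only up to almost sure equality, so a version is chosen.\<close>

definition ito_integral ::
  "'a measure \<Rightarrow> (real \<Rightarrow> 'a measure) \<Rightarrow> (real \<Rightarrow> 'a \<Rightarrow> real^'d) \<Rightarrow> real \<Rightarrow> real
    \<Rightarrow> (real \<Rightarrow> 'a \<Rightarrow> real^'d^'m) \<Rightarrow> 'a \<Rightarrow> real^'m" where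
  "ito_integral P F W a b Z = (SOME I. has_ito_integral P F W a b Z I)"

section \<open>The decoupled system\<close>

definition solves_forward ::
  "'a measure \<Rightarrow> (real \<Rightarrow> 'a measure) \<Rightarrow> (real \<Rightarrow> 'a \<Rightarrow> real^'d) \<Rightarrow> real \<Rightarrow> real^'n
    \<Rightarrow> (real \<Rightarrow> 'a \<Rightarrow> (real^'n) \<times> (real^'m) \<times> (real^'d^'m) \<Rightarrow> real^'n)
    \<Rightarrow> (real \<Rightarrow> 'a \<Rightarrow> (real^'n) \<times> (real^'m) \<times> (real^'d^'m) \<Rightarrow> real^'d^'n)
    \<Rightarrow> (real \<Rightarrow> 'a \<Rightarrow> real^'m) \<Rightarrow> (real \<Rightarrow> 'a \<Rightarrow> real^'d^'m)
    \<Rightarrow> (real \<Rightarrow> 'a \<Rightarrow> real^'n) \<Rightarrow> bool" where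
  "solves_forward P F W T x0 b \<sigma> y z X \<longleftrightarrow>
     X \<in> L2_continuous P F T \<and>
     (\<forall>t\<in>{0..T}. AE \<omega> in P.
        X t \<omega> = x0 + (LINT s:{0..t}|lborel. b s \<omega> (X s \<omega>, y s \<omega>, z s \<omega>))
          + ito_integral P F W 0 t (\<lambda>s \<omega>. \<sigma> s \<omega> (X s \<omega>, y s \<omega>, z s \<omega>)) \<omega>)"

text \<open>In the backward equation the driver \<open>f\<close> is evaluated at the trial pair \<open>(y, z)\<close> and not at the
  unknown \<open>(Y, Z)\<close>.\<close>

definition solves_backward ::
  "'a measure \<Rightarrow> (real \<Rightarrow> 'a measure) \<Rightarrow> (real \<Rightarrow> 'a \<Rightarrow> real^'d) \<Rightarrow> real
    \<Rightarrow> (real \<Rightarrow> 'a \<Rightarrow> (real^'n) \<times> (real^'m) \<times> (real^'d^'m) \<Rightarrow> real^'m)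
    \<Rightarrow> ('a \<Rightarrow> real^'n \<Rightarrow> real^'m)
    \<Rightarrow> (real \<Rightarrow> 'a \<Rightarrow> real^'m) \<Rightarrow> (real \<Rightarrow> 'a \<Rightarrow> real^'d^'m) \<Rightarrow> (real \<Rightarrow> 'a \<Rightarrow> real^'n)
    \<Rightarrow> (real \<Rightarrow> 'a \<Rightarrow> real^'m) \<Rightarrow> (real \<Rightarrow> 'a \<Rightarrow> real^'d^'m) \<Rightarrow> bool" where
  "solves_backward P F W T f g y z X Y Z \<longleftrightarrow>
     (Y, Z) \<in> trial_space P F T \<and>
     (\<forall>t\<in>{0..T}. AE \<omega> in P.
        Y t \<omega> = g \<omega> (X T \<omega>) + (LINT s:{t..T}|lborel. f s \<omega> (X s \<omega>, y s \<omega>, z s \<omega>))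
          - ito_integral P F W t T Z \<omega>)"

section \<open>Backward measurability loss and distance\<close>

text \<open>Under the Lipschitz conditions on \<open>b\<close> and \<open>\<sigma>\<close> the forward component is unique up to
  indistinguishability, so choosing a version does not
  affect the value of the loss.\<close>

definition BML ::
  "'a measure \<Rightarrow> (real \<Rightarrow> 'a measure) \<Rightarrow> (real \<Rightarrow> 'a \<Rightarrow> real^'d) \<Rightarrow> real \<Rightarrow> real^'n
    \<Rightarrow> (real \<Rightarrow> 'a \<Rightarrow> (real^'n) \<times> (real^'m) \<times> (real^'d^'m) \<Rightarrow> real^'n)
    \<Rightarrow> (real \<Rightarrow> 'a \<Rightarrow> (real^'n) \<times> (real^'m) \<times> (real^'d^'m) \<Rightarrow> real^'d^'n)
    \<Rightarrow> (real \<Rightarrow> 'a \<Rightarrow> (real^'n) \<times> (real^'m) \<times> (real^'d^'m) \<Rightarrow> real^'m)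
    \<Rightarrow> ('a \<Rightarrow> real^'n \<Rightarrow> real^'m)
    \<Rightarrow> (real \<Rightarrow> 'a \<Rightarrow> real^'m) \<Rightarrow> (real \<Rightarrow> 'a \<Rightarrow> real^'d^'m) \<Rightarrow> real measure \<Rightarrow> ennreal" where
  "BML P F W T x0 b \<sigma> f g y z \<mu> =
     (let X = (SOME X. solves_forward P F W T x0 b \<sigma> y z X) in
      \<integral>\<^sup>+t. (\<integral>\<^sup>+\<omega>. ennreal ((norm (y t \<omega> -
        (g \<omega> (X T \<omega>) + (LINT s:{t..T}|lborel. f s \<omega> (X s \<omega>, y s \<omega>, z s \<omega>))
          - ito_integral P F W t T z \<omega>)))\<^sup>2) \<partial>P) \<partial>\<mu>)"

definition trial_dist ::
  "'a measure \<Rightarrow> real \<Rightarrow> real measure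
    \<Rightarrow> (real \<Rightarrow> 'a \<Rightarrow> real^'m) \<times> (real \<Rightarrow> 'a \<Rightarrow> real^'d^'m)
    \<Rightarrow> (real \<Rightarrow> 'a \<Rightarrow> real^'m) \<times> (real \<Rightarrow> 'a \<Rightarrow> real^'d^'m) \<Rightarrow> ennreal" where
  "trial_dist P T \<mu> = (\<lambda>(y1, z1) (y2, z2).
     \<integral>\<^sup>+t. (\<integral>\<^sup>+\<omega>. (ennreal ((norm (y1 t \<omega> - y2 t \<omega>))\<^sup>2)
       + (\<integral>\<^sup>+s\<in>{t..T}. ennreal ((norm (z1 s \<omega> - z2 s \<omega>))\<^sup>2) \<partial>lborel)) \<partial>P) \<partial>\<mu>)"

end

theory Submission
  imports Defs
begin

text \<open>The forward equation has a unique solution up to indistinguishability (Ito isometry and Gronwall), so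
  the version chosen in the loss may be replaced by \<open>X\<close>.  Substituting the backward equation for \<open>Y\<close>, the
  residual at time \<open>t\<close> becomes \<open>(y t - Y t) + (I z - I Z)\<close>, where \<open>I\<close> is the Ito integral from \<open>t\<close> to \<open>T\<close>.
  The first summand is known at time \<open>t\<close>, hence orthogonal to the second, and the isometry evaluates the
  second; integrating over \<open>t\<close> gives the distance.

  Since the Ito integral is a chosen version, its existence must be proved: a bounded adapted process is
  sampled on a mesh with a random shift, and the mean-square error averaged over the shifts is at
  most the supremum of the mean-square translation errors over steps up to the mesh size, which tends
  to 0 by the continuity of translations in \<open>L\<^sup>1\<close>.\<close>

section \<open>Mean-square convergence\<close>

text \<open>Loss and distance may be infinite, so the estimates stay within nonnegative integrals in
  \<open>ennreal\<close>; the two integrands agree already at each fixed time. Orthogonality and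
  isometry are carried by a single identity: the second moment of \<eta> + (I - I'), with \<eta>
  known at the left endpoint, is that of \<eta> plus the time integral for the integrands. It holds
  for simple integrands and passes to mean-square limits, so no inner products have to converge.
  Three obstacles shape the rest. Joint measurability of a process refers to the whole space
  \<open>P\<close>, so its time averages are not visibly adapted; sampling asks for measurability at
  single times only, which is why the mesh is shifted instead of the process being smoothed.
  Independence of increments is stated for the raw filtration and has to be carried over to the
  augmented one. Random fields are Lipschitz only off a null set, so composed integrands are
  replaced by versions that vanish there; the predicate behind the Ito integral does not see this
  change, and \<open>SOME\<close> picks literally the same function for both.\<close>

lemma norm_sq_le_weighted:
  fixes a b :: "'b::real_normed_vector"
  assumes "0 < c"
  shows "(norm a)\<^sup>2 \<le> (1 + c) * (norm b)\<^sup>2 + (1 + 1 / c) * (norm (a - b))\<^sup>2"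
proof -
  let ?x = "norm b" and ?y = "norm (a - b)"
  have "norm a \<le> ?x + ?y"
    by (metis add.commute diff_add_cancel norm_triangle_ineq)
  then have "(norm a)\<^sup>2 \<le> (?x + ?y)\<^sup>2"
    by (intro power_mono) auto
  also have "2 * (?x * ?y) \<le> c * ?x\<^sup>2 + ?y\<^sup>2 / c"
  proof -
    have "0 \<le> (c * ?x - ?y)\<^sup>2 / c" using assms by simp
    also have "\<dots> = c * ?x\<^sup>2 + ?y\<^sup>2 / c - 2 * (?x * ?y)"
      using assms by (simp add: field_simps power2_eq_square)
    finally show ?thesis by simp
  qed
  then have "(?x + ?y)\<^sup>2 \<le> (1 + c) * ?x\<^sup>2 + (1 + 1 / c) * ?y\<^sup>2"
    by (simp add: power2_eq_square algebra_simps)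
  finally show ?thesis .
qed

text \<open>Young's inequality in place of the triangle inequality of the L2 norm: no roots are
  taken, and infinite values are allowed. Small \<open>c\<close> brings the factor of
  \<open>g\<close> close to 1, while \<open>c = 1\<close> gives crude bounds with factor 2.\<close>

lemma nn_integral_norm_sq_le_weighted:
  fixes f g :: "'a \<Rightarrow> 'b::{real_normed_vector, second_countable_topology}"
  assumes [measurable]: "f \<in> borel_measurable M" "g \<in> borel_measurable M" and "0 < c"
  shows "(\<integral>\<^sup>+x. ennreal ((norm (f x))\<^sup>2) \<partial>M) \<le>
    ennreal (1 + c) * (\<integral>\<^sup>+x. ennreal ((norm (g x))\<^sup>2) \<partial>M)
      + ennreal (1 + 1 / c) * (\<integral>\<^sup>+x. ennreal ((norm (f x - g x))\<^sup>2) \<partial>M)"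
proof -
  have "(\<integral>\<^sup>+x. ennreal ((norm (f x))\<^sup>2) \<partial>M) \<le>
    (\<integral>\<^sup>+x. ennreal (1 + c) * ennreal ((norm (g x))\<^sup>2) + ennreal (1 + 1 / c) * ennreal ((norm (f x - g x))\<^sup>2) \<partial>M)"
    using norm_sq_le_weighted[OF \<open>0 < c\<close>] \<open>0 < c\<close>
    by (intro nn_integral_mono) (simp add: ennreal_mult'[symmetric] ennreal_plus[symmetric] del: ennreal_plus)
  also have "\<dots> = ennreal (1 + c) * (\<integral>\<^sup>+x. ennreal ((norm (g x))\<^sup>2) \<partial>M)
      + ennreal (1 + 1 / c) * (\<integral>\<^sup>+x. ennreal ((norm (f x - g x))\<^sup>2) \<partial>M)"
    by (subst nn_integral_add) (auto simp: nn_integral_cmult)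
  finally show ?thesis .
qed

lemma nn_integral_norm_sq_diff_le:
  fixes f g :: "'a \<Rightarrow> 'b::{real_normed_vector, second_countable_topology}"
  assumes [measurable]: "f \<in> borel_measurable M" "g \<in> borel_measurable M"
  shows "(\<integral>\<^sup>+x. ennreal ((norm (f x - g x))\<^sup>2) \<partial>M) \<le>
    2 * (\<integral>\<^sup>+x. ennreal ((norm (f x))\<^sup>2) \<partial>M) + 2 * (\<integral>\<^sup>+x. ennreal ((norm (g x))\<^sup>2) \<partial>M)"
proof -
  have "(\<lambda>x. f x - g x) \<in> borel_measurable M" by measurable
  from nn_integral_norm_sq_le_weighted[OF this assms(1), of 1] show ?thesis
    by (simp add: norm_minus_commute)
qed

text \<open>A strict inequality leaves room for the factor \<open>1 + c\<close> of the weighted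
  inequality. Since \<open>a < v\<close> forces \<open>a\<close> to be finite, multiplication by
  \<open>a\<close> is continuous.\<close>

lemma ennreal_scale_lt:
  fixes a v :: ennreal
  assumes "a < v"
  obtains c :: real where "0 < c" "ennreal (1 + c) * a < v"
proof -
  have "a < top" using assms by (simp add: less_top order.strict_trans2)
  have "((\<lambda>c::real. ennreal (1 + c)) \<longlongrightarrow> ennreal (1 + 0)) (at_right 0)"
    by (intro tendsto_intros)
  from ennreal_tendsto_cmult[OF \<open>a < top\<close> this]
  have "((\<lambda>c::real. ennreal (1 + c) * a) \<longlongrightarrow> a) (at_right 0)"
    by (simp add: mult.commute)
  then have "\<forall>\<^sub>F c in at_right (0::real). ennreal (1 + c) * a < v"
    using assms by (intro order_tendstoD) auto
  then have "\<forall>\<^sub>F c in at_right (0::real). 0 < c \<and> ennreal (1 + c) * a < v"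
    using eventually_at_right_less[of "0::real"] by eventually_elim auto
  then show ?thesis
    using that eventually_happens by force
qed

text \<open>The limit may be infinite. Each half of the order characterization of convergence is one
  application of the weighted inequality, with the roles of \<open>f\<close> and \<open>F n\<close>
  exchanged.\<close>

lemma nn_integral_norm_sq_tendsto:
  fixes f :: "'a \<Rightarrow> 'b::{real_normed_vector, second_countable_topology}"
  assumes [measurable]: "f \<in> borel_measurable M" "\<And>n. F n \<in> borel_measurable M"
    and lim: "(\<lambda>n. \<integral>\<^sup>+x. ennreal ((norm (f x - F n x))\<^sup>2) \<partial>M) \<longlonglongrightarrow> 0"
  shows "(\<lambda>n. \<integral>\<^sup>+x. ennreal ((norm (F n x))\<^sup>2) \<partial>M) \<longlonglongrightarrow> (\<integral>\<^sup>+x. ennreal ((norm (f x))\<^sup>2) \<partial>M)"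
    (is "?u \<longlonglongrightarrow> ?v")
proof -
  let ?d = "\<lambda>n. \<integral>\<^sup>+x. ennreal ((norm (f x - F n x))\<^sup>2) \<partial>M"
  have d: "(\<lambda>n. e + ennreal k * ?d n) \<longlonglongrightarrow> e" for e k
  proof -
    have "(\<lambda>n. e + ennreal k * ?d n) \<longlonglongrightarrow> e + ennreal k * 0"
      by (intro tendsto_add tendsto_const ennreal_tendsto_cmult lim) auto
    then show ?thesis by simp
  qed
  show ?thesis
  proof (rule order_tendstoI)
    fix a assume "a < ?v"
    then obtain c where c: "0 < c" "ennreal (1 + c) * a < ?v" by (rule ennreal_scale_lt)
    have "\<forall>\<^sub>F n in sequentially. ennreal (1 + c) * a + ennreal (1 + 1 / c) * ?d n < ?v"
      using order_tendstoD(2)[OF d c(2)] .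
    then show "\<forall>\<^sub>F n in sequentially. a < ?u n"
    proof eventually_elim
      case (elim n)
      show ?case
      proof (rule ccontr)
        assume "\<not> a < ?u n"
        then have "ennreal (1 + c) * ?u n \<le> ennreal (1 + c) * a" by (intro mult_left_mono) auto
        then have "?v \<le> ennreal (1 + c) * a + ennreal (1 + 1 / c) * ?d n"
          using nn_integral_norm_sq_le_weighted[of f M "F n" c] c(1)
          by (auto intro: order.trans add_right_mono)
        with elim show False by simp
      qed
    qed
  next
    fix a assume "?v < a"
    then obtain c where c: "0 < c" "ennreal (1 + c) * ?v < a" by (rule ennreal_scale_lt)
    have "\<forall>\<^sub>F n in sequentially. ennreal (1 + c) * ?v + ennreal (1 + 1 / c) * ?d n < a"
      using order_tendstoD(2)[OF d c(2)] .
    then show "\<forall>\<^sub>F n in sequentially. ?u n < a"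
    proof eventually_elim
      case (elim n)
      then show ?case
        using nn_integral_norm_sq_le_weighted[of "F n" M f c] c(1)
        by (auto simp: norm_minus_commute)
    qed
  qed
qed

text \<open>Each weighted square is at most the finite sum \<open>B\<close>, so \<open>D n\<close>
  is dominated by a geometric sequence of ratio \<open>1 / sqrt 2\<close>.\<close>

lemma summable_weighted_squares:
  fixes D :: "nat \<Rightarrow> real"
  assumes fin: "(\<Sum>n. ennreal (2^n * (D n)\<^sup>2)) \<noteq> \<infinity>" and pos: "\<And>n. 0 \<le> D n"
  shows "summable D"
proof -
  have "(\<Sum>n. ennreal (2^n * (D n)\<^sup>2)) \<noteq> top"
    using fin by simp
  then obtain B where B: "0 \<le> B" "(\<Sum>n. ennreal (2^n * (D n)\<^sup>2)) = ennreal B"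
    using ennreal_cases[of "\<Sum>n. ennreal (2^n * (D n)\<^sup>2)"] by metis
  have le: "norm (D n) \<le> sqrt B * (1 / sqrt 2)^n" for n
  proof -
    have "(\<Sum>k\<in>{n}. ennreal (2^k * (D k)\<^sup>2)) \<le> (\<Sum>k. ennreal (2^k * (D k)\<^sup>2))"
      by (intro sum_le_suminf summableI finite.insertI finite.emptyI zero_le)
    then have "ennreal (2^n * (D n)\<^sup>2) \<le> ennreal B"
      unfolding B(2) by simp
    then have "2^n * (D n)\<^sup>2 \<le> B" using B(1) by simp
    moreover have "(sqrt 2 ^ n)\<^sup>2 = (2::real)^n"
      by (metis power_mult mult.commute real_sqrt_pow2 zero_le_numeral)
    ultimately have "sqrt 2 ^ n * D n \<le> sqrt B"
      by (intro real_le_rsqrt) (simp only: power_mult_distrib)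
    then have "D n \<le> sqrt B / sqrt 2 ^ n"
      by (subst pos_le_divide_eq) (simp_all only: zero_less_power real_sqrt_gt_0_iff zero_less_numeral mult.commute)
    then show ?thesis
      using pos[of n] by (simp only: power_one_over real_norm_def abs_of_nonneg divide_inverse mult_1 power_inverse)
  qed
  have "summable (\<lambda>n. sqrt B * (1 / sqrt 2)^n)"
    by (rule summable_mult[OF summable_geometric]) simp
  then show ?thesis
    by (rule summable_comparison_test[rotated]) (use le in blast)
qed

text \<open>Completeness of L2 for a sequence with a prescribed rate, which spares the passage to a
  subsequence: the sequence itself converges almost everywhere, and Fatou's lemma identifies the
  pointwise limit as the limit in mean square.\<close>

lemma L2_limit_exists:
  fixes J :: "nat \<Rightarrow> 'a \<Rightarrow> 'b::{banach, second_countable_topology}"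
  assumes [measurable]: "\<And>n. J n \<in> borel_measurable M"
    and cauchy: "\<And>m n. (\<integral>\<^sup>+x. ennreal ((norm (J m x - J n x))\<^sup>2) \<partial>M) \<le> ennreal (C * ((1/4)^m + (1/4)^n))"
    and "0 \<le> C"
  obtains I where "I \<in> borel_measurable M"
    "(\<lambda>n. \<integral>\<^sup>+x. ennreal ((norm (I x - J n x))\<^sup>2) \<partial>M) \<longlonglongrightarrow> 0"
proof -
  \<comment> \<open>The weight \<open>2^n\<close> is heavy enough to make the increments summable at
    almost every point, and light enough to be absorbed by the rate \<open>(1/4)^n\<close>.\<close>
  have "(\<integral>\<^sup>+x. (\<Sum>n. ennreal (2^n * (norm (J (Suc n) x - J n x))\<^sup>2)) \<partial>M) =
      (\<Sum>n. (\<integral>\<^sup>+x. ennreal (2^n * (norm (J (Suc n) x - J n x))\<^sup>2) \<partial>M))"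
    by (intro nn_integral_suminf) auto
  also have "\<dots> \<le> (\<Sum>n. ennreal (2 * C * (1/2)^n))"
  proof (intro suminf_le)
    fix n
    have "(\<integral>\<^sup>+x. ennreal (2^n * (norm (J (Suc n) x - J n x))\<^sup>2) \<partial>M)
       = ennreal (2^n) * (\<integral>\<^sup>+x. ennreal ((norm (J (Suc n) x - J n x))\<^sup>2) \<partial>M)"
      by (simp add: ennreal_mult nn_integral_cmult)
    also have "\<dots> \<le> ennreal (2^n) * ennreal (C * ((1/4)^Suc n + (1/4)^n))"
      by (intro mult_left_mono cauchy) auto
    also have "\<dots> = ennreal (2^n * (C * ((1/4)^Suc n + (1/4)^n)))"
      by (rule ennreal_mult''[symmetric]) (use \<open>0 \<le> C\<close> in auto)
    also have "\<dots> \<le> ennreal (2 * C * (1/2)^n)"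
    proof (rule ennreal_leI)
      have *: "(2::real)^n * (1/4)^n = (1/2)^n"
        by (simp add: power_mult_distrib[symmetric])
      have "2^n * (C * ((1/4)^Suc n + (1/4)^n)) = C * (5/4) * (2^n * (1/4)^n)"
        by (simp add: algebra_simps)
      also have "\<dots> \<le> C * 2 * (1/2)^n"
        unfolding * using \<open>0 \<le> C\<close> by (intro mult_right_mono mult_left_mono) auto
      finally show "2^n * (C * ((1/4)^Suc n + (1/4)^n)) \<le> 2 * C * (1/2)^n" by simp
    qed
    finally show "(\<integral>\<^sup>+x. ennreal (2^n * (norm (J (Suc n) x - J n x))\<^sup>2) \<partial>M) \<le> ennreal (2 * C * (1/2)^n)" .
  qed auto
  also have "\<dots> < \<infinity>"
  proof -
    have "(\<lambda>n. 2 * C * (1/2)^n) sums (2 * C * 2)"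
      using sums_mult[OF geometric_sums[of "1/2::real"], of "2 * C"] by simp
    then have "(\<Sum>n. ennreal (2 * C * (1/2)^n)) = ennreal (2 * C * 2)"
      using \<open>0 \<le> C\<close> by (intro suminf_ennreal_eq) auto
    then show ?thesis by simp
  qed
  finally have fin: "(\<integral>\<^sup>+x. (\<Sum>n. ennreal (2^n * (norm (J (Suc n) x - J n x))\<^sup>2)) \<partial>M) \<noteq> \<infinity>"
    by (rule less_imp_neq)
  have "AE x in M. (\<Sum>n. ennreal (2^n * (norm (J (Suc n) x - J n x))\<^sup>2)) \<noteq> \<infinity>"
  proof (rule nn_integral_PInf_AE[OF _ fin])
    show "(\<lambda>x. \<Sum>n. ennreal (2^n * (norm (J (Suc n) x - J n x))\<^sup>2)) \<in> borel_measurable M"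
      by (intro borel_measurable_suminf_order) measurable
  qed
  then have conv: "AE x in M. convergent (\<lambda>n. J n x)"
  proof (eventually_elim)
    case (elim x)
    then have "summable (\<lambda>n. norm (J (Suc n) x - J n x))"
      by (intro summable_weighted_squares) auto
    then have "summable (\<lambda>n. J (Suc n) x - J n x)"
      by (rule summable_norm_cancel)
    then have "convergent (\<lambda>n. \<Sum>i<n. J (Suc i) x - J i x)"
      by (simp add: summable_iff_convergent)
    then have "convergent (\<lambda>n. J n x - J 0 x)"
      unfolding sum_lessThan_telescope[of "\<lambda>n. J n x"] .
    from convergent_add[OF this convergent_const[of "J 0 x"]] show ?case by simp
  qed
  have quarter: "(\<lambda>n. (1/4::real)^n) \<longlonglongrightarrow> 0"
    by (intro LIMSEQ_realpow_zero) auto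
  \<comment> \<open>\<open>lim\<close> has some value also where the sequence diverges, so
    \<open>I\<close> is measurable everywhere and arbitrary only on a null set.\<close>
  define I where "I x = lim (\<lambda>n. J n x)" for x
  have [measurable]: "I \<in> borel_measurable M"
    unfolding I_def by (intro borel_measurable_lim_metric) auto
  have "(\<integral>\<^sup>+x. ennreal ((norm (I x - J n x))\<^sup>2) \<partial>M) \<le> ennreal (C * (1/4)^n)" for n
  proof -
    have "(\<integral>\<^sup>+x. ennreal ((norm (I x - J n x))\<^sup>2) \<partial>M) =
        (\<integral>\<^sup>+x. liminf (\<lambda>m. ennreal ((norm (J m x - J n x))\<^sup>2)) \<partial>M)"
    proof (rule nn_integral_cong_AE)
      show "AE x in M. ennreal ((norm (I x - J n x))\<^sup>2) = liminf (\<lambda>m. ennreal ((norm (J m x - J n x))\<^sup>2))"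
        using conv
      proof eventually_elim
        case (elim x)
        then have "(\<lambda>m. J m x) \<longlonglongrightarrow> I x" by (simp add: I_def convergent_LIMSEQ_iff)
        then have "(\<lambda>m. ennreal ((norm (J m x - J n x))\<^sup>2)) \<longlonglongrightarrow> ennreal ((norm (I x - J n x))\<^sup>2)"
          by (intro tendsto_intros)
        from lim_imp_Liminf[OF sequentially_bot this] show ?case by (rule sym)
      qed
    qed
    \<comment> \<open>Fatou's lemma in the index \<open>m\<close>, with \<open>n\<close>
      fixed.\<close>
    also have "\<dots> \<le> liminf (\<lambda>m. \<integral>\<^sup>+x. ennreal ((norm (J m x - J n x))\<^sup>2) \<partial>M)"
      by (intro nn_integral_liminf) auto
    also have "\<dots> \<le> liminf (\<lambda>m. ennreal (C * ((1/4)^m + (1/4)^n)))"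
      by (intro Liminf_mono always_eventually allI cauchy)
    also have "\<dots> = ennreal (C * (0 + (1/4)^n))"
      by (intro lim_imp_Liminf sequentially_bot tendsto_ennrealI tendsto_mult tendsto_add tendsto_const quarter)
    finally show ?thesis by simp
  qed
  note le = this
  have "(\<lambda>n. ennreal (C * (1/4)^n)) \<longlonglongrightarrow> ennreal (C * 0)"
    by (intro tendsto_ennrealI tendsto_mult tendsto_const quarter)
  then have lim: "(\<lambda>n. ennreal (C * (1/4)^n)) \<longlonglongrightarrow> 0"
    by simp
  have "(\<lambda>n. \<integral>\<^sup>+x. ennreal ((norm (I x - J n x))\<^sup>2) \<partial>M) \<longlonglongrightarrow> 0"
  proof (rule tendsto_sandwich[OF _ _ tendsto_const lim])
    show "\<forall>\<^sub>F n in sequentially. (\<integral>\<^sup>+x. ennreal ((norm (I x - J n x))\<^sup>2) \<partial>M) \<le> ennreal (C * (1/4)^n)"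
      by (intro always_eventually allI le)
  qed simp
  then show ?thesis using that[of I] by simp
qed

section \<open>Translations, random fields and a Gronwall lemma\<close>

lemma integral_translation:
  fixes f :: "real \<Rightarrow> 'b::{banach, second_countable_topology}"
  shows "integrable lborel (\<lambda>t. f (t + h)) \<longleftrightarrow> integrable lborel f"
    and "(\<integral>t. f (t + h) \<partial>lborel) = (\<integral>t. f t \<partial>lborel)"
  using lborel_integrable_real_affine_iff[of 1 f h] lborel_integral_real_affine[of 1 f h]
  by (auto simp: add.commute)

text \<open>The error \<open>f - g\<close> is counted twice, once translated and once not;
  translation invariance makes the two contributions equal.\<close>

lemma translation_L1_le:
  fixes f g :: "real \<Rightarrow> 'b::{banach, second_countable_topology}"
  assumes f: "integrable lborel f" and g: "integrable lborel g"
  shows "(\<integral>t. norm (f (t + h) - f t) \<partial>lborel) \<le>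
    (\<integral>t. norm (g (t + h) - g t) \<partial>lborel) + 2 * (\<integral>t. norm (f t - g t) \<partial>lborel)"
proof -
  note [simp] = integral_translation(1)[of f h] integral_translation(1)[of g h] f g
  have d: "integrable lborel (\<lambda>t. norm (f (t + h) - g (t + h)))"
    "(\<integral>t. norm (f (t + h) - g (t + h)) \<partial>lborel) = (\<integral>t. norm (f t - g t) \<partial>lborel)"
    using integral_translation[of "\<lambda>t. norm (f t - g t)" h] by auto
  have "(\<integral>t. norm (f (t + h) - f t) \<partial>lborel) \<le>
     (\<integral>t. norm (f (t + h) - g (t + h)) + norm (g (t + h) - g t) + norm (f t - g t) \<partial>lborel)"
  proof (intro integral_mono)
    fix t
    have "f (t + h) - f t = (f (t + h) - g (t + h)) + (g (t + h) - g t) - (f t - g t)" by simp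
    then have "norm (f (t + h) - f t) \<le>
        norm (f (t + h) - g (t + h) + (g (t + h) - g t)) + norm (f t - g t)"
      by (simp only: norm_triangle_ineq4)
    also have "\<dots> \<le> norm (f (t + h) - g (t + h)) + norm (g (t + h) - g t) + norm (f t - g t)"
      by (intro add_right_mono norm_triangle_ineq)
    finally show "norm (f (t + h) - f t) \<le>
        norm (f (t + h) - g (t + h)) + norm (g (t + h) - g t) + norm (f t - g t)" .
  qed auto
  also have "\<dots> = (\<integral>t. norm (g (t + h) - g t) \<partial>lborel) + 2 * (\<integral>t. norm (f t - g t) \<partial>lborel)"
    using d by simp
  finally show ?thesis .
qed

text \<open>Functions with continuous translations form a closed set in L1. This is the passage from
  a dense class to all integrable functions.\<close>

lemma translation_L1_tendsto_approx:
  fixes f :: "real \<Rightarrow> 'b::{banach, second_countable_topology}"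
  assumes f: "integrable lborel f"
    and approx: "\<And>e. 0 < e \<Longrightarrow> \<exists>g. integrable lborel g \<and> (\<integral>t. norm (f t - g t) \<partial>lborel) < e \<and>
        (\<lambda>n. \<integral>t. norm (g (t + h n) - g t) \<partial>lborel) \<longlonglongrightarrow> 0"
  shows "(\<lambda>n. \<integral>t. norm (f (t + h n) - f t) \<partial>lborel) \<longlonglongrightarrow> 0"
proof (rule LIMSEQ_I)
  fix e :: real assume "0 < e"
  then obtain g where g: "integrable lborel g" "(\<integral>t. norm (f t - g t) \<partial>lborel) < e / 4"
    "(\<lambda>n. \<integral>t. norm (g (t + h n) - g t) \<partial>lborel) \<longlonglongrightarrow> 0"
    using approx[of "e / 4"] by auto
  obtain N where "\<And>n. n \<ge> N \<Longrightarrow> norm (\<integral>t. norm (g (t + h n) - g t) \<partial>lborel) < e / 2"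
    using LIMSEQ_D[OF g(3), of "e / 2"] \<open>0 < e\<close> by auto
  then have N: "\<And>n. n \<ge> N \<Longrightarrow> (\<integral>t. norm (g (t + h n) - g t) \<partial>lborel) < e / 2"
    by (simp add: abs_of_nonneg)
  show "\<exists>no. \<forall>n\<ge>no. norm ((\<integral>t. norm (f (t + h n) - f t) \<partial>lborel) - 0) < e"
  proof (intro exI allI impI)
    fix n assume "N \<le> n"
    then have "(\<integral>t. norm (f (t + h n) - f t) \<partial>lborel) < e"
      using N[of n] g(2) translation_L1_le[OF f g(1), of "h n"] by simp
    then show "norm ((\<integral>t. norm (f (t + h n) - f t) \<partial>lborel) - 0) < e"
      by (simp add: abs_of_nonneg)
  qed
qed

text \<open>Translation preserves the measure, so the two halves of the symmetric difference of \<open>U\<close> and its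
  translate have equal measure, and openness makes one of them vanish by dominated convergence.\<close>

lemma translation_L1_tendsto_open:
  fixes U :: "real set"
  assumes U: "open U" "emeasure lborel U < \<infinity>" and h: "h \<longlonglongrightarrow> 0"
  shows "(\<lambda>n. \<integral>t. norm ((indicator U (t + h n) :: real) - indicator U t) \<partial>lborel) \<longlonglongrightarrow> 0"
proof -
  let ?i = "indicator U :: real \<Rightarrow> real"
  have i: "integrable lborel ?i" using U by auto
  then have ih: "integrable lborel (\<lambda>t. ?i (t + h n))" for n
    using integral_translation(1)[of ?i] by simp
  have "(\<lambda>n. \<integral>t. max 0 (?i t - ?i (t + h n)) \<partial>lborel) \<longlonglongrightarrow> (\<integral>t. 0 \<partial>(lborel :: real measure))"
  proof (intro integral_dominated_convergence[where w="indicat_real U"])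
    show "AE t in lborel. (\<lambda>n. max 0 (?i t - ?i (t + h n))) \<longlonglongrightarrow> 0"
    proof (intro AE_I2)
      fix t
      show "(\<lambda>n. max 0 (?i t - ?i (t + h n))) \<longlonglongrightarrow> 0"
      proof (cases "t \<in> U")
        case True
        have "(\<lambda>n. t + h n) \<longlonglongrightarrow> t + 0" by (intro tendsto_intros h)
        then have "\<forall>\<^sub>F n in sequentially. t + h n \<in> U"
          using True U(1) by (auto intro: topological_tendstoD)
        then have "\<forall>\<^sub>F n in sequentially. max 0 (?i t - ?i (t + h n)) = 0"
          by eventually_elim (auto simp: True)
        then show ?thesis by (rule tendsto_eventually)
      next
        case False
        then show ?thesis by (auto intro!: tendsto_eventually always_eventually split: split_indicator)
      qed
    qed
  qed (use i ih in \<open>auto split: split_indicator\<close>)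
  moreover have "(\<integral>t. norm (?i (t + h n) - ?i t) \<partial>lborel) = 2 * (\<integral>t. max 0 (?i t - ?i (t + h n)) \<partial>lborel)" for n
  proof -
    \<comment> \<open>For real \<open>x\<close>, \<open>norm x = 2 * max 0 (- x) + x\<close>; the
      last summand integrates to zero by translation invariance.\<close>
    have "(\<integral>t. norm (?i (t + h n) - ?i t) \<partial>lborel) =
        (\<integral>t. 2 * max 0 (?i t - ?i (t + h n)) + (?i (t + h n) - ?i t) \<partial>lborel)"
      by (intro Bochner_Integration.integral_cong) (auto simp: abs_if)
    also have "\<dots> = 2 * (\<integral>t. max 0 (?i t - ?i (t + h n)) \<partial>lborel)
        + ((\<integral>t. ?i (t + h n) \<partial>lborel) - (\<integral>t. ?i t \<partial>lborel))"
      using i ih by (subst Bochner_Integration.integral_add) (auto simp: Bochner_Integration.integral_diff simp del: integral_indicator)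
    also have "\<dots> = 2 * (\<integral>t. max 0 (?i t - ?i (t + h n)) \<partial>lborel)"
      by (simp add: integral_translation(2)[of ?i] del: integral_indicator)
    finally show ?thesis .
  qed
  ultimately show ?thesis by (auto intro: tendsto_mult_right_zero)
qed

text \<open>Outer regularity reduces indicators to open sets of finite measure, where a point stays
  inside under small translations. Sums are immediate, and limits follow from closedness in
  L1.\<close>

lemma translation_L1_tendsto:
  fixes f :: "real \<Rightarrow> 'b::{banach, second_countable_topology}"
  assumes "integrable lborel f" and h: "h \<longlonglongrightarrow> 0"
  shows "(\<lambda>n. \<integral>t. norm (f (t + h n) - f t) \<partial>lborel) \<longlonglongrightarrow> 0"
  using assms(1)
proof (induct f rule: integrable_induct)
  case (base A c)
  show ?case
  proof (rule translation_L1_tendsto_approx)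
    show "integrable lborel (\<lambda>t. indicator A t *\<^sub>R c)" using base by auto
    fix e :: real assume "0 < e"
    \<comment> \<open>The summand 1 allows for \<open>c = 0\<close>.\<close>
    define d where "d = e / (norm c + 1)"
    have d: "0 < d" "d * norm c < e"
      using \<open>0 < e\<close> by (auto simp: d_def field_simps add_pos_nonneg)
    obtain U where U: "open U" "A \<subseteq> U" "U - A \<in> lmeasurable" "emeasure lebesgue (U - A) < ennreal d"
      using sets_lebesgue_outer_open[of A d] base d(1) by auto
    have UA: "emeasure lborel (U - A) < ennreal d"
      using U base by (simp add: emeasure_completion)
    have "emeasure lborel U \<le> emeasure lborel A + emeasure lborel (U - A)"
      using U base by (intro order.trans[OF _ emeasure_subadditive] emeasure_mono) auto
    also have "\<dots> < \<infinity>"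
      using UA base order.strict_trans[OF UA ennreal_less_top] by auto
    finally have Ufin: "emeasure lborel U < \<infinity>" .
    let ?g = "\<lambda>t. indicator U t *\<^sub>R c"
    have "integrable lborel ?g" using U Ufin by auto
    moreover have "(\<integral>t. norm (indicator A t *\<^sub>R c - ?g t) \<partial>lborel) < e"
    proof -
      have "(\<integral>t. norm (indicator A t *\<^sub>R c - ?g t) \<partial>lborel) = (\<integral>t. indicator (U - A) t * norm c \<partial>lborel)"
        using U(2) by (intro Bochner_Integration.integral_cong) (auto split: split_indicator)
      also have "\<dots> = measure lborel (U - A) * norm c"
        by (simp only: integral_mult_left_zero integral_indicator) simp
      also have "\<dots> \<le> d * norm c"
        unfolding measure_def using UA d(1)
        by (intro mult_right_mono enn2real_leI order.strict_implies_order[OF UA]) auto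
      finally show ?thesis using d by simp
    qed
    moreover have "(\<lambda>n. \<integral>t. norm (?g (t + h n) - ?g t) \<partial>lborel) \<longlonglongrightarrow> 0"
    proof -
      have "norm (?g (t + h n) - ?g t) = norm (indicator U (t + h n) - indicator U t :: real) * norm c" for t n
        by (simp add: scaleR_diff_left[symmetric])
      then show ?thesis
        using tendsto_mult_left_zero[OF translation_L1_tendsto_open[OF U(1) Ufin h], of "norm c"]
        by (simp only: integral_mult_left_zero)
    qed
    ultimately show "\<exists>g. integrable lborel g \<and> (\<integral>t. norm (indicator A t *\<^sub>R c - g t) \<partial>lborel) < e \<and>
        (\<lambda>n. \<integral>t. norm (g (t + h n) - g t) \<partial>lborel) \<longlonglongrightarrow> 0" by blast
  qed
next
  case (add f g)
  have i: "integrable lborel (\<lambda>t. norm (f (t + k) - f t))" "integrable lborel (\<lambda>t. norm (g (t + k) - g t))" for k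
    using integral_translation(1)[of f k] integral_translation(1)[of g k] add by auto
  have le: "(\<integral>t. norm (f (t + h n) + g (t + h n) - (f t + g t)) \<partial>lborel) \<le>
     (\<integral>t. norm (f (t + h n) - f t) \<partial>lborel) + (\<integral>t. norm (g (t + h n) - g t) \<partial>lborel)" for n
    unfolding Bochner_Integration.integral_add[OF i, symmetric]
    using integral_translation(1)[of f "h n"] integral_translation(1)[of g "h n"] add(1,3)
    by (intro integral_mono) (auto simp: add_diff_add norm_triangle_ineq)
  show ?case
    by (rule tendsto_sandwich[OF _ _ tendsto_const tendsto_add_zero[OF add(2,4)]]) (auto intro!: always_eventually le)
next
  case (lim f s)
  show ?case
  proof (rule translation_L1_tendsto_approx)
    fix e :: real assume "0 < e"
    have "(\<lambda>i. \<integral>t. norm (f t - s i t) \<partial>lborel) \<longlonglongrightarrow> (\<integral>t. 0 \<partial>(lborel :: real measure))"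
    \<comment> \<open>The approximants satisfy \<open>norm (s i t) \<le> 2 * norm (f t)\<close>,
      hence the factor 3 in the majorant.\<close>
    proof (rule integral_dominated_convergence[where w="\<lambda>t. 3 * norm (f t)"])
      show "AE t in lborel. (\<lambda>i. norm (f t - s i t)) \<longlonglongrightarrow> 0"
      proof (intro AE_I2)
        fix t :: real
        have "(\<lambda>i. norm (f t - s i t)) \<longlonglongrightarrow> norm (f t - f t)"
          by (intro tendsto_norm tendsto_diff tendsto_const lim(3)) simp
        then show "(\<lambda>i. norm (f t - s i t)) \<longlonglongrightarrow> 0" by simp
      qed
      show "AE t in lborel. norm (norm (f t - s i t)) \<le> 3 * norm (f t)" for i
      proof (intro AE_I2)
        fix t show "norm (norm (f t - s i t)) \<le> 3 * norm (f t)"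
          using lim(4)[of t i] norm_triangle_ineq4[of "f t" "s i t"] by simp
      qed
    qed (use lim in auto)
    then have "\<forall>\<^sub>F i in sequentially. (\<integral>t. norm (f t - s i t) \<partial>lborel) < e"
      using \<open>0 < e\<close> by (intro order_tendstoD(2)[of _ 0]) auto
    then obtain i where "(\<integral>t. norm (f t - s i t) \<partial>lborel) < e"
      by (auto simp: eventually_sequentially)
    then show "\<exists>g. integrable lborel g \<and> (\<integral>t. norm (f t - g t) \<partial>lborel) < e \<and>
        (\<lambda>n. \<integral>t. norm (g (t + h n) - g t) \<partial>lborel) \<longlonglongrightarrow> 0"
      using lim(1,2) by blast
  qed (use lim in auto)
qed

section \<open>Measurability of random fields along processes and of continuous processes\<close>

text \<open>A Caratheodory function: along a simple function only finitely many arguments occur and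
  the pieces can be glued; continuity in the argument carries measurability to the limit.\<close>

lemma borel_measurable_random_field:
  fixes f :: "'a \<Rightarrow> 'c::{metric_space, second_countable_topology} \<Rightarrow> 'b::metric_space"
  assumes f: "\<And>\<theta>. (\<lambda>x. f x \<theta>) \<in> borel_measurable M"
    and cont: "\<And>x. x \<in> space M \<Longrightarrow> continuous_on UNIV (f x)"
    and U: "U \<in> borel_measurable M"
  shows "(\<lambda>x. f x (U x)) \<in> borel_measurable M"
proof -
  obtain u where u: "\<And>i. simple_function M (u i)" "\<And>x. x \<in> space M \<Longrightarrow> (\<lambda>i. u i x) \<longlonglongrightarrow> U x"
    using borel_measurable_implies_sequence_metric[OF U, of undefined] by blast
  show ?thesis
  proof (rule borel_measurable_LIMSEQ_metric)
    fix i
    show "(\<lambda>x. f x (u i x)) \<in> borel_measurable M"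
    proof (rule measurable_compose_countable'[where I="u i ` space M" and f="\<lambda>\<theta> x. f x \<theta>"])
      show "u i \<in> measurable M (count_space (u i ` space M))"
        using u(1)[of i] by (auto simp: simple_function_def intro!: measurable_count_space_eq2[THEN iffD2])
      show "countable (u i ` space M)"
        using u(1)[of i] by (intro countable_finite) (simp add: simple_function_def)
    qed (rule f)
  next
    fix x assume x: "x \<in> space M"
    show "(\<lambda>i. f x (u i x)) \<longlonglongrightarrow> f x (U x)"
      by (rule continuous_on_tendsto_compose[OF cont[OF x] u(2)[OF x]]) auto
  qed
qed

text \<open>For each \<open>n\<close> the rounded times take countably many values, so statements
  about fixed times transfer to all times by continuity. Clamping keeps the node of every integer
  index in \<open>{0..T}\<close>, where the processes are controlled.\<close>

lemma grid_tendsto: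
  fixes t T :: real
  assumes "t \<in> {0..T}"
  shows "(\<lambda>n. max 0 (min T (\<lfloor>real (Suc n) * t\<rfloor> / real (Suc n)))) \<longlonglongrightarrow> t"
proof -
  have "(\<lambda>n. \<lfloor>real (Suc n) * t\<rfloor> / real (Suc n)) \<longlonglongrightarrow> t"
  proof (rule tendsto_sandwich)
    show "\<forall>\<^sub>F n in sequentially. t - 1 / real (Suc n) \<le> \<lfloor>real (Suc n) * t\<rfloor> / real (Suc n)"
    proof (intro always_eventually allI)
      fix n
      have "real (Suc n) * t - 1 \<le> \<lfloor>real (Suc n) * t\<rfloor>" by linarith
      then have "(real (Suc n) * t - 1) / real (Suc n) \<le> \<lfloor>real (Suc n) * t\<rfloor> / real (Suc n)"
        by (intro divide_right_mono) auto
      then show "t - 1 / real (Suc n) \<le> \<lfloor>real (Suc n) * t\<rfloor> / real (Suc n)"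
        by (simp add: diff_divide_distrib)
    qed
    show "\<forall>\<^sub>F n in sequentially. \<lfloor>real (Suc n) * t\<rfloor> / real (Suc n) \<le> t"
      by (intro always_eventually allI) (simp add: divide_le_eq mult.commute)
    have "(\<lambda>n. t - 1 / real (Suc n)) \<longlonglongrightarrow> t - 0"
      by (intro tendsto_intros LIMSEQ_Suc lim_1_over_n)
    then show "(\<lambda>n. t - 1 / real (Suc n)) \<longlonglongrightarrow> t" by simp
  qed auto
  then have "(\<lambda>n. max 0 (min T (\<lfloor>real (Suc n) * t\<rfloor> / real (Suc n)))) \<longlonglongrightarrow> max 0 (min T t)"
    by (intro tendsto_intros)
  then show ?thesis using assms by simp
qed

text \<open>The process is frozen at rounded times. For each integer index it depends measurably on
  the outcome alone, and the countably many indices can be glued.\<close>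

lemma borel_measurable_continuous_process:
  fixes X :: "real \<Rightarrow> 'a \<Rightarrow> 'b::metric_space"
  assumes "0 \<le> T" and X: "\<And>t. t \<in> {0..T} \<Longrightarrow> X t \<in> borel_measurable M"
    and cont: "\<And>\<omega>. \<omega> \<in> space M \<Longrightarrow> continuous_on {0..T} (\<lambda>t. X t \<omega>)"
  shows "(\<lambda>(t, \<omega>). X t \<omega>) \<in> borel_measurable (restrict_space borel {0..T} \<Otimes>\<^sub>M M)"
proof -
  define r where "r n t = max 0 (min T (\<lfloor>real (Suc n) * t\<rfloor> / real (Suc n)))" for n t
  have r: "r n t \<in> {0..T}" for n t using \<open>0 \<le> T\<close> by (auto simp: r_def)
  have lim: "(\<lambda>n. r n t) \<longlonglongrightarrow> t" if "t \<in> {0..T}" for t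
    unfolding r_def by (rule grid_tendsto[OF that])
  show ?thesis
  proof (rule borel_measurable_LIMSEQ_metric[where f="\<lambda>n (t, \<omega>). X (r n t) \<omega>"])
    fix n
    have "(\<lambda>p. (\<lambda>i p. X (max 0 (min T (real_of_int i / real (Suc n)))) (snd p)) \<lfloor>real (Suc n) * fst p\<rfloor> p)
        \<in> borel_measurable (restrict_space borel {0..T} \<Otimes>\<^sub>M M)"
    proof (rule measurable_compose_countable[where g="\<lambda>p. \<lfloor>real (Suc n) * fst p\<rfloor>" and
        f="\<lambda>i p. X (max 0 (min T (real_of_int i / real (Suc n)))) (snd p)"])
      have [measurable]: "fst \<in> measurable (restrict_space borel {0..T} \<Otimes>\<^sub>M M) (borel :: real measure)"
        by (rule measurable_compose[OF measurable_fst measurable_restrict_space1[OF measurable_ident, simplified id_def]])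
      show "(\<lambda>p. \<lfloor>real (Suc n) * fst p\<rfloor>) \<in> measurable (restrict_space borel {0..T} \<Otimes>\<^sub>M M) (count_space UNIV)"
        by measurable
      fix i :: int
      show "(\<lambda>p. X (max 0 (min T (real_of_int i / real (Suc n)))) (snd p)) \<in> borel_measurable (restrict_space borel {0..T} \<Otimes>\<^sub>M M)"
        using \<open>0 \<le> T\<close> by (intro measurable_compose[OF measurable_snd X]) auto
    qed
    then show "(\<lambda>(t, \<omega>). X (r n t) \<omega>) \<in> borel_measurable (restrict_space borel {0..T} \<Otimes>\<^sub>M M)"
      by (simp add: r_def case_prod_beta)
  next
    fix p assume "p \<in> space (restrict_space borel {0..T} \<Otimes>\<^sub>M M)"
    then obtain t \<omega> where p: "p = (t, \<omega>)" "t \<in> {0..T}" "\<omega> \<in> space M"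
      by (auto simp: space_pair_measure space_restrict_space)
    have "(\<lambda>n. X (r n t) \<omega>) \<longlonglongrightarrow> X t \<omega>"
      using continuous_on_tendsto_compose[OF cont[OF p(3)] lim[OF p(2)] p(2)] r by (auto intro: always_eventually)
    then show "(\<lambda>n. (\<lambda>(t, \<omega>). X (r n t) \<omega>) p) \<longlonglongrightarrow> (\<lambda>(t, \<omega>). X t \<omega>) p"
      by (simp add: p)
  qed
qed

text \<open>The weight \<open>exp (- 2 C t)\<close> halves the bound in each application of the hypothesis.\<close>

lemma Gronwall_zero:
  fixes \<phi> :: "real \<Rightarrow> ennreal"
  assumes "0 < C" and "K < top" and bound: "\<And>t. t \<in> {0..T} \<Longrightarrow> \<phi> t \<le> K"
    and le: "\<And>t. t \<in> {0..T} \<Longrightarrow> \<phi> t \<le> ennreal C * (\<integral>\<^sup>+s\<in>{0..t}. \<phi> s \<partial>lborel)"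
    and t: "t \<in> {0..T}"
  shows "\<phi> t = 0"
proof -
  have e: "ennreal (exp (- 2 * C * s)) * ennreal (exp (2 * C * s)) = 1" for s
    by (simp add: ennreal_mult'[symmetric] exp_add[symmetric])
  define M where "M = (SUP t\<in>{0..T}. ennreal (exp (- 2 * C * t)) * \<phi> t)"
  have "M \<le> K"
    unfolding M_def
  proof (rule SUP_least)
    fix t assume t: "t \<in> {0..T}"
    have "ennreal (exp (- 2 * C * t)) * \<phi> t \<le> 1 * K"
      using t bound[OF t] \<open>0 < C\<close> by (intro mult_mono) auto
    then show "ennreal (exp (- 2 * C * t)) * \<phi> t \<le> K" by simp
  qed
  have weight: "\<phi> s \<le> M * ennreal (exp (2 * C * s))" if "s \<in> {0..T}" for s
  proof -
    have "\<phi> s = ennreal (exp (- 2 * C * s)) * \<phi> s * ennreal (exp (2 * C * s))"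
      using e[of s] by (metis mult.assoc mult.commute mult_1)
    also have "\<dots> \<le> M * ennreal (exp (2 * C * s))"
      unfolding M_def by (intro mult_right_mono SUP_upper that) auto
    finally show ?thesis .
  qed
  have "ennreal (exp (- 2 * C * t)) * \<phi> t \<le> ennreal (1/2) * M" if t: "t \<in> {0..T}" for t
  proof -
    have "\<phi> t \<le> ennreal C * (\<integral>\<^sup>+s\<in>{0..t}. \<phi> s \<partial>lborel)" by (rule le[OF t])
    also have "\<dots> \<le> ennreal C * (\<integral>\<^sup>+s. M * (ennreal (exp (2 * C * s)) * indicator {0..t} s) \<partial>lborel)"
      using t weight by (intro mult_left_mono nn_integral_mono) (auto split: split_indicator)
    also have "\<dots> = ennreal C * (M * ennreal (exp (2 * C * t) / (2 * C) - exp (2 * C * 0) / (2 * C)))"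
      using t \<open>0 < C\<close>
      by (subst nn_integral_cmult, measurable, subst nn_integral_FTC_Icc[where F="\<lambda>s. exp (2 * C * s) / (2 * C)"])
        (auto intro!: derivative_eq_intros simp del: exp_zero mult_zero_right)
    also have "\<dots> \<le> ennreal C * (M * ennreal (exp (2 * C * t) / (2 * C)))"
      using \<open>0 < C\<close> by (intro mult_left_mono ennreal_leI) auto
    also have "\<dots> = (ennreal C * ennreal (exp (2 * C * t) / (2 * C))) * M"
      by (simp only: mult_ac)
    also have "ennreal C * ennreal (exp (2 * C * t) / (2 * C)) = ennreal (1/2) * ennreal (exp (2 * C * t))"
      using \<open>0 < C\<close> by (subst (1 2) ennreal_mult'[symmetric]) auto
    also have "\<dots> * M = ennreal (1/2) * M * ennreal (exp (2 * C * t))"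
      by (simp only: mult_ac)
    finally have "ennreal (exp (- 2 * C * t)) * \<phi> t \<le>
        ennreal (exp (- 2 * C * t)) * (ennreal (1/2) * M * ennreal (exp (2 * C * t)))"
      by (intro mult_left_mono) auto
    also have "\<dots> = ennreal (1/2) * M"
      using e[of t] by (metis mult.assoc mult.commute mult_1)
    finally show ?thesis .
  qed
  then have "M \<le> ennreal (1/2) * M"
    unfolding M_def[of, symmetric] by (subst M_def) (rule SUP_least)
  \<comment> \<open>Finiteness is essential here: \<open>M = top\<close> would satisfy the preceding
    inequality too.\<close>
  moreover obtain m where m: "0 \<le> m" "M = ennreal m"
    using \<open>M \<le> K\<close> \<open>K < top\<close> by (cases M) (auto simp: top_unique)
  ultimately have "ennreal m \<le> ennreal (1/2 * m)"
    by (simp only: ennreal_mult' zero_le_divide_1_iff zero_le_numeral)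
  then have "M = 0" using m by simp
  then show ?thesis using weight[OF t] by simp
qed

section \<open>The augmented Brownian filtration\<close>

lemma continuous_on_matrix_vector:
  "continuous_on UNIV (\<lambda>p. (fst p :: real^'d^'m) *v snd p)"
  unfolding matrix_vector_mult_def by (intro continuous_intros)

lemma borel_measurable_matrix_vector [measurable]:
  fixes A :: "'a \<Rightarrow> real^'d^'m" and x :: "'a \<Rightarrow> real^'d"
  assumes "A \<in> borel_measurable M" "x \<in> borel_measurable M"
  shows "(\<lambda>\<omega>. A \<omega> *v x \<omega>) \<in> borel_measurable M"
  using measurable_compose[OF borel_measurable_Pair[OF assms]
      borel_measurable_continuous_onI[OF continuous_on_matrix_vector]]
  by simp

lemma borel_measurable_component [measurable]:
  fixes x :: "'a \<Rightarrow> 'b::euclidean_space^'d"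
  assumes "x \<in> borel_measurable M"
  shows "(\<lambda>\<omega>. x \<omega> $ i) \<in> borel_measurable M"
  by (rule measurable_compose[OF assms]) (intro borel_measurable_continuous_onI continuous_intros)

locale brownian = prob_space P for P :: "'a measure" +
  fixes W :: "real \<Rightarrow> 'a \<Rightarrow> real^'d" and T :: real
  assumes brownian: "brownian_motion P T W"
begin

abbreviation "F \<equiv> brownian_filtration P W"

lemma W_measurable [measurable]: "t \<in> {0..T} \<Longrightarrow> W t \<in> borel_measurable P"
  using brownian by (auto simp: brownian_motion_def)

lemma sets_natural_filtration:
  "sets (natural_filtration P W t) =
    sigma_sets (space P) {W s -` A \<inter> space P | s A. s \<in> {0..t} \<and> A \<in> sets borel}"
  unfolding natural_filtration_def by (rule sets_measure_of) auto

lemma space_natural_filtration: "space (natural_filtration P W t) = space P"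
  unfolding natural_filtration_def by (rule space_measure_of) auto

lemma sets_natural_filtration_le:
  assumes "t \<le> T" shows "sets (natural_filtration P W t) \<subseteq> sets P"
proof -
  have "{W s -` A \<inter> space P | s A. s \<in> {0..t} \<and> A \<in> sets borel} \<subseteq> sets P"
    using assms by (auto intro!: measurable_sets[OF W_measurable])
  then show ?thesis
    unfolding sets_natural_filtration by (rule sets.sigma_sets_subset)
qed

lemma sets_natural_subset_Pow: "sets (natural_filtration P W t) \<subseteq> Pow (space P)"
  using sets.sets_into_space[of _ "natural_filtration P W t"] by (auto simp: space_natural_filtration)

lemma filtration_generator_Pow: "sets (natural_filtration P W t) \<union> null_sets P \<subseteq> Pow (space P)"
  using sets_natural_subset_Pow[of t] sets.sets_into_space[of _ P] by (auto simp: null_sets_def)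

lemma space_F [simp]: "space (F t) = space P"
  unfolding brownian_filtration_def by (rule space_measure_of[OF filtration_generator_Pow])

lemma sets_F: "sets (F t) = sigma_sets (space P) (sets (natural_filtration P W t) \<union> null_sets P)"
  unfolding brownian_filtration_def by (rule sets_measure_of[OF filtration_generator_Pow])

lemma sets_F_le: "t \<le> T \<Longrightarrow> sets (F t) \<subseteq> sets P"
  unfolding sets_F using sets_natural_filtration_le[of t]
  by (intro sets.sigma_sets_subset) (auto simp: null_sets_def)

lemma measurable_F_P: "t \<le> T \<Longrightarrow> X \<in> borel_measurable (F t) \<Longrightarrow> X \<in> borel_measurable P"
  by (rule measurable_mono[OF _ _ sets_F_le, THEN subsetD]) auto

lemma null_sets_in_F: "N \<in> null_sets P \<Longrightarrow> N \<in> sets (F t)"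
  unfolding sets_F by (rule sigma_sets.Basic) auto

lemma F_mono:
  assumes "s \<le> t" shows "sets (F s) \<subseteq> sets (F t)"
proof -
  have "sets (natural_filtration P W s) \<subseteq> sets (natural_filtration P W t)"
    unfolding sets_natural_filtration using assms by (intro sigma_sets_mono') fastforce
  then show ?thesis
    unfolding sets_F by (intro sigma_sets_mono') auto
qed

lemma measurable_F_mono: "s \<le> t \<Longrightarrow> X \<in> borel_measurable (F s) \<Longrightarrow> X \<in> borel_measurable (F t)"
  by (rule measurable_mono[OF _ _ F_mono, THEN subsetD]) auto

lemma W_measurable_F:
  assumes "s \<in> {0..t}" shows "W s \<in> borel_measurable (F t)"
proof (rule measurableI)
  fix A :: "(real^'d) set" assume "A \<in> sets borel"
  then have "W s -` A \<inter> space P \<in> sets (natural_filtration P W t)"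
    using assms unfolding sets_natural_filtration by (intro sigma_sets.Basic) auto
  then show "W s -` A \<inter> space (F t) \<in> sets (F t)"
    unfolding sets_F by (auto intro: sigma_sets.Basic)
qed auto

text \<open>Augmentation changes events by null sets only: the sets with such a raw version contain
  the generators and are closed under complements and countable unions. This links the filtration in
  use to the one for which independence is assumed.\<close>

lemma sets_F_AE_natural:
  assumes "t \<le> T" "A \<in> sets (F t)"
  shows "\<exists>B\<in>sets (natural_filtration P W t). AE \<omega> in P. \<omega> \<in> A \<longleftrightarrow> \<omega> \<in> B"
  using assms(2) unfolding sets_F
proof (induct rule: sigma_sets.induct)
  case (Basic A)
  then show ?case
  proof
    assume "A \<in> null_sets P"
    then show ?thesis
      using AE_not_in[of A P] by (intro bexI[of _ "{}"]) auto
  qed auto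
next
  case Empty
  then show ?case by (intro bexI[of _ "{}"]) auto
next
  case (Compl A)
  then obtain B where B: "B \<in> sets (natural_filtration P W t)" "AE \<omega> in P. \<omega> \<in> A \<longleftrightarrow> \<omega> \<in> B" by auto
  have "space P - B \<in> sets (natural_filtration P W t)"
    using sets.compl_sets[OF B(1)] by (simp add: space_natural_filtration)
  then show ?case
    using B(2) by (intro bexI[of _ "space P - B"]) auto
next
  case (Union A)
  then obtain B where B: "\<And>i. B i \<in> sets (natural_filtration P W t)"
      "\<And>i. AE \<omega> in P. \<omega> \<in> A i \<longleftrightarrow> \<omega> \<in> B i" by metis
  have "AE \<omega> in P. \<forall>i. \<omega> \<in> A i \<longleftrightarrow> \<omega> \<in> B i"
    using B(2) by (simp add: AE_all_countable)
  then show ?case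
    using B(1) by (intro bexI[of _ "\<Union>i. B i"]) auto
qed

text \<open>Replacing an event of the augmented past by its raw version changes neither its
  probability nor that of its intersection with an event of the increment. Scalar functions suffice,
  because matrices and vectors are handled through products of entries.\<close>

lemma indep_increment:
  fixes X :: "'a \<Rightarrow> real" and h :: "real^'d \<Rightarrow> real"
  assumes st: "0 \<le> s" "s < t" "t \<le> T"
    and X: "X \<in> borel_measurable (F s)" and h: "h \<in> borel_measurable borel"
  shows "indep_var borel X borel (\<lambda>\<omega>. h (W t \<omega> - W s \<omega>))"
  unfolding indep_var_eq
proof (intro conjI indep_setI)
  have [measurable]: "W t \<in> borel_measurable P" "W s \<in> borel_measurable P"
    using st by auto
  have X_P [measurable]: "X \<in> borel_measurable P"
    using st X by (intro measurable_F_P[of s]) auto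
  note h[measurable]
  have indep: "indep_set (sets (natural_filtration P W s))
      (sets (vimage_algebra (space P) (\<lambda>\<omega>. W t \<omega> - W s \<omega>) borel))"
    using brownian st by (auto simp: brownian_motion_def)
  have sub: "sigma_sets (space P) {X -` A \<inter> space P |A. A \<in> sets borel} \<subseteq> sets (F s)"
    using sets.sigma_sets_subset[of "{X -` A \<inter> space P |A. A \<in> sets borel}" "F s"] measurable_sets[OF X]
    by auto
  have "(\<lambda>\<omega>. W t \<omega> - W s \<omega>) \<in> measurable (vimage_algebra (space P) (\<lambda>\<omega>. W t \<omega> - W s \<omega>) borel) borel"
    by (intro measurable_vimage_algebra1) auto
  from measurable_compose[OF this h]
  have hm: "(\<lambda>\<omega>. h (W t \<omega> - W s \<omega>)) \<in> borel_measurable (vimage_algebra (space P) (\<lambda>\<omega>. W t \<omega> - W s \<omega>) borel)" .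
  have sub2: "sigma_sets (space P) {(\<lambda>\<omega>. h (W t \<omega> - W s \<omega>)) -` A \<inter> space P |A. A \<in> sets borel}
      \<subseteq> sets (vimage_algebra (space P) (\<lambda>\<omega>. W t \<omega> - W s \<omega>) borel)"
    using sets.sigma_sets_subset[of "{(\<lambda>\<omega>. h (W t \<omega> - W s \<omega>)) -` A \<inter> space P |A. A \<in> sets borel}"
        "vimage_algebra (space P) (\<lambda>\<omega>. W t \<omega> - W s \<omega>) borel"] measurable_sets[OF hm]
    by auto
  show "random_variable borel X" "random_variable borel (\<lambda>\<omega>. h (W t \<omega> - W s \<omega>))"
    by measurable
  show "sigma_sets (space P) {X -` A \<inter> space P |A. A \<in> sets borel} \<subseteq> events"
    using sub sets_F_le[of s] st by auto
  show "sigma_sets (space P) {(\<lambda>\<omega>. h (W t \<omega> - W s \<omega>)) -` A \<inter> space P |A. A \<in> sets borel} \<subseteq> events"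
    using sub2 indep_setD_ev2[OF indep] by auto
  fix a b assume a: "a \<in> sigma_sets (space P) {X -` A \<inter> space P |A. A \<in> sets borel}"
    and b: "b \<in> sigma_sets (space P) {(\<lambda>\<omega>. h (W t \<omega> - W s \<omega>)) -` A \<inter> space P |A. A \<in> sets borel}"
  obtain a' where a': "a' \<in> sets (natural_filtration P W s)" "AE \<omega> in P. \<omega> \<in> a \<longleftrightarrow> \<omega> \<in> a'"
    using sets_F_AE_natural[of s a] a sub st by auto
  have b': "b \<in> sets (vimage_algebra (space P) (\<lambda>\<omega>. W t \<omega> - W s \<omega>) borel)"
    using b sub2 by auto
  have ev: "a \<in> events" "b \<in> events" "a' \<in> events"
    using a b' a'(1) sub sets_F_le[of s] st indep_setD_ev1[OF indep] indep_setD_ev2[OF indep] by auto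
  have "prob (a \<inter> b) = prob (a' \<inter> b)"
    using a'(2) ev by (intro finite_measure_eq_AE) auto
  also have "\<dots> = prob a' * prob b"
    by (rule indep_setD[OF indep a'(1) b'])
  also have "prob a' = prob a"
    using a'(2) ev by (intro finite_measure_eq_AE) auto
  finally show "prob (a \<inter> b) = prob a * prob b" .
qed

text \<open>The coordinates are centred and independent, so mixed moments vanish. The resulting
  covariance \<open>(t - s) I\<close> is what later produces the Frobenius inner product.\<close>

lemma increment_moments:
  assumes st: "0 \<le> s" "s < t" "t \<le> T"
  shows "integrable P (\<lambda>\<omega>. (W t \<omega> - W s \<omega>) $ j)"
    and "integrable P (\<lambda>\<omega>. (W t \<omega> - W s \<omega>) $ j * (W t \<omega> - W s \<omega>) $ k)"
    and "expectation (\<lambda>\<omega>. (W t \<omega> - W s \<omega>) $ j) = 0"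
    and "expectation (\<lambda>\<omega>. (W t \<omega> - W s \<omega>) $ j * (W t \<omega> - W s \<omega>) $ k) = (if j = k then t - s else 0)"
proof -
  let ?D = "\<lambda>j \<omega>. (W t \<omega> - W s \<omega>) $ j"
  have distr: "distributed P lborel (?D j) (\<lambda>x. ennreal (normal_density 0 (sqrt (t - s)) x))" for j
    using brownian st by (auto simp: brownian_motion_def)
  have pos: "0 < sqrt (t - s)" using st by simp
  have int: "integrable P (\<lambda>\<omega>. ?D j \<omega> ^ n)" for j n
    using distributed_integrable[OF distr, of "\<lambda>x. x ^ n" j] integrable_normal_moment[OF pos, of 0 n] by simp
  show int1: "integrable P (?D j)" for j using int[of j 1] by simp
  show exp0: "expectation (?D j) = 0" for j
    by (rule normal_distributed_expectation[OF pos distr])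
  have var: "expectation (\<lambda>\<omega>. ?D j \<omega> * ?D j \<omega>) = t - s" for j
    using normal_distributed_variance[OF pos distr, of j] exp0[of j] st by (simp add: power2_eq_square)
  have indep: "indep_vars (\<lambda>_. borel) ?D UNIV"
    using brownian st by (auto simp: brownian_motion_def)
  have ind: "integrable P (\<lambda>\<omega>. ?D j \<omega> * ?D k \<omega>)"
    "expectation (\<lambda>\<omega>. ?D j \<omega> * ?D k \<omega>) = 0" if "j \<noteq> k" for j k
    using indep_vars_lebesgue_integral[OF _ indep_vars_subset[OF indep], of "{j, k}"]
      indep_vars_integrable[OF _ indep_vars_subset[OF indep], of "{j, k}"] int1 exp0 that by auto
  show "integrable P (\<lambda>\<omega>. ?D j \<omega> * ?D k \<omega>)"
    using int[of j 2] ind(1)[of j k] by (cases "j = k") (auto simp: power2_eq_square)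
  show "expectation (\<lambda>\<omega>. ?D j \<omega> * ?D k \<omega>) = (if j = k then t - s else 0)"
    using var[of j] ind(2)[of j k] by auto
qed

end

section \<open>The isometry for simple integrands\<close>

lemma norm_entry_le: "\<bar>A $ i $ j\<bar> \<le> norm (A :: real^'d^'m)"
  using Finite_Cartesian_Product.norm_nth_le[of A i] Finite_Cartesian_Product.norm_nth_le[of "A $ i" j] by simp

context brownian
begin

text \<open>One block of a simple integrand. Treating blocks individually allows families with
  overlapping intervals, so two simple processes on different partitions can be compared without a
  common refinement.\<close>

definition elementary :: "real \<Rightarrow> real \<Rightarrow> ('a \<Rightarrow> real^'d^'m) \<Rightarrow> bool" where
  "elementary u v \<xi> \<longleftrightarrow> 0 \<le> u \<and> u \<le> v \<and> v \<le> T \<and> \<xi> \<in> borel_measurable (F u) \<and>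
     (\<exists>C. \<forall>\<omega>\<in>space P. norm (\<xi> \<omega>) \<le> C)"

definition elementary_integral :: "real \<Rightarrow> real \<Rightarrow> ('a \<Rightarrow> real^'d^'m) \<Rightarrow> 'a \<Rightarrow> real^'m" where
  "elementary_integral u v \<xi> \<omega> = \<xi> \<omega> *v (W v \<omega> - W u \<omega>)"

text \<open>A coordinate of \<open>\<eta>\<close> times an entry of \<open>\<xi>\<close> is known at
  time \<open>s\<close>, hence independent of the increment, whose mean is zero.\<close>

lemma increment_orthogonal:
  fixes \<eta> :: "'a \<Rightarrow> real^'m"
  assumes \<eta>: "\<eta> \<in> borel_measurable (F s)" "integrable P (\<lambda>\<omega>. (norm (\<eta> \<omega>))\<^sup>2)"
    and \<xi>: "elementary s t \<xi>"
  shows "integrable P (\<lambda>\<omega>. \<eta> \<omega> \<bullet> elementary_integral s t \<xi> \<omega>)"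
    and "expectation (\<lambda>\<omega>. \<eta> \<omega> \<bullet> elementary_integral s t \<xi> \<omega>) = 0"
proof -
  have "integrable P (\<lambda>\<omega>. \<eta> \<omega> \<bullet> elementary_integral s t \<xi> \<omega>) \<and>
    expectation (\<lambda>\<omega>. \<eta> \<omega> \<bullet> elementary_integral s t \<xi> \<omega>) = 0"
  \<comment> \<open>The law of the increments is given for \<open>s < t\<close> only.\<close>
  proof (cases "s = t")
    case True
    then show ?thesis by (simp add: elementary_integral_def)
  next
    case False
    then have st: "0 \<le> s" "s < t" "t \<le> T" using \<xi> by (auto simp: elementary_def)
    obtain C where C: "\<And>\<omega>. \<omega> \<in> space P \<Longrightarrow> norm (\<xi> \<omega>) \<le> C" and [measurable]: "\<xi> \<in> borel_measurable (F s)"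
      using \<xi> by (auto simp: elementary_def)
    note \<eta>(1)[measurable]
    let ?D = "\<lambda>j \<omega>. (W t \<omega> - W s \<omega>) $ j"
    let ?X = "\<lambda>i j \<omega>. \<eta> \<omega> $ i * \<xi> \<omega> $ i $ j"
    have XF: "?X i j \<in> borel_measurable (F s)" for i j by measurable
    have int: "integrable P (?X i j)" for i j
    proof (rule Bochner_Integration.integrable_bound)
      \<comment> \<open>On a probability space \<open>1 + (norm (\<eta> \<omega>))\<^sup>2\<close>
        is an integrable majorant of the coordinates of \<open>\<eta>\<close>, and the entries of
        \<open>\<xi>\<close> are bounded by \<open>C\<close>.\<close>
      show "integrable P (\<lambda>\<omega>. (1 + (norm (\<eta> \<omega>))\<^sup>2) * \<bar>C\<bar>)" using \<eta>(2) by auto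
      show "?X i j \<in> borel_measurable P" using measurable_F_P[OF _ XF] st by auto
      show "AE \<omega> in P. norm (?X i j \<omega>) \<le> norm ((1 + (norm (\<eta> \<omega>))\<^sup>2) * \<bar>C\<bar>)"
      proof (intro AE_I2)
        fix \<omega> assume \<omega>: "\<omega> \<in> space P"
        have "\<bar>\<eta> \<omega> $ i\<bar> \<le> norm (\<eta> \<omega>)" by (rule component_le_norm_cart)
        also have "\<dots> \<le> 1 + (norm (\<eta> \<omega>))\<^sup>2"
          using sum_squares_bound[of 1 "norm (\<eta> \<omega>)"] norm_ge_zero[of "\<eta> \<omega>"]
          unfolding mult_1_right power_one by linarith
        finally have 1: "\<bar>\<eta> \<omega> $ i\<bar> \<le> 1 + (norm (\<eta> \<omega>))\<^sup>2" .
        have 2: "\<bar>\<xi> \<omega> $ i $ j\<bar> \<le> \<bar>C\<bar>"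
          using norm_entry_le[of "\<xi> \<omega>" i j] C[OF \<omega>] by linarith
        show "norm (?X i j \<omega>) \<le> norm ((1 + (norm (\<eta> \<omega>))\<^sup>2) * \<bar>C\<bar>)"
          using mult_mono[OF 1 2] by (simp add: abs_mult)
      qed
    qed
    have prod: "integrable P (\<lambda>\<omega>. ?X i j \<omega> * ?D j \<omega>)" "expectation (\<lambda>\<omega>. ?X i j \<omega> * ?D j \<omega>) = 0" for i j
    proof -
      have ind: "indep_var borel (?X i j) borel (?D j)"
        by (rule indep_increment[OF st XF, of "\<lambda>x. x $ j"]) auto
      show "integrable P (\<lambda>\<omega>. ?X i j \<omega> * ?D j \<omega>)" "expectation (\<lambda>\<omega>. ?X i j \<omega> * ?D j \<omega>) = 0"
        using indep_var_integrable[OF ind int increment_moments(1)[OF st]]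
          indep_var_lebesgue_integral[OF ind int increment_moments(1)[OF st]]
          increment_moments(3)[OF st] by auto
    qed
    have eq: "\<eta> \<omega> \<bullet> elementary_integral s t \<xi> \<omega> = (\<Sum>i\<in>UNIV. \<Sum>j\<in>UNIV. ?X i j \<omega> * ?D j \<omega>)" for \<omega>
      by (simp add: elementary_integral_def inner_vec_def matrix_vector_mult_def sum_distrib_left mult.assoc)
    show ?thesis unfolding eq
      using prod by (auto intro!: Bochner_Integration.integrable_sum simp: Bochner_Integration.integral_sum)
  qed
  then show "integrable P (\<lambda>\<omega>. \<eta> \<omega> \<bullet> elementary_integral s t \<xi> \<omega>)"
    "expectation (\<lambda>\<omega>. \<eta> \<omega> \<bullet> elementary_integral s t \<xi> \<omega>) = 0" by auto
qed

lemma integrable_bounded_product: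
  assumes "s \<le> T" and \<xi>: "\<xi> \<in> borel_measurable (F s)" "\<And>\<omega>. \<omega> \<in> space P \<Longrightarrow> norm (\<xi> \<omega> :: real^'d^'m) \<le> C"
    and \<xi>': "\<xi>' \<in> borel_measurable (F s)" "\<And>\<omega>. \<omega> \<in> space P \<Longrightarrow> norm (\<xi>' \<omega> :: real^'d^'m) \<le> C'"
  shows "integrable P (\<lambda>\<omega>. \<xi> \<omega> $ i $ j * \<xi>' \<omega> $ i $ k)"
proof (rule Bochner_Integration.integrable_bound[OF integrable_const])
  have [measurable]: "\<xi> \<in> borel_measurable P" "\<xi>' \<in> borel_measurable P"
    using \<xi>(1) \<xi>'(1) measurable_F_P[OF \<open>s \<le> T\<close>] by auto
  show "(\<lambda>\<omega>. \<xi> \<omega> $ i $ j * \<xi>' \<omega> $ i $ k) \<in> borel_measurable P" by measurable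
  show "AE \<omega> in P. norm (\<xi> \<omega> $ i $ j * \<xi>' \<omega> $ i $ k) \<le> norm (\<bar>C\<bar> * \<bar>C'\<bar>)"
  proof (intro AE_I2)
    fix \<omega> assume \<omega>: "\<omega> \<in> space P"
    have 1: "\<bar>\<xi> \<omega> $ i $ j\<bar> \<le> \<bar>C\<bar>" "\<bar>\<xi>' \<omega> $ i $ k\<bar> \<le> \<bar>C'\<bar>"
      using norm_entry_le[of "\<xi> \<omega>" i j] norm_entry_le[of "\<xi>' \<omega>" i k] \<xi>(2)[OF \<omega>] \<xi>'(2)[OF \<omega>] by linarith+
    show "norm (\<xi> \<omega> $ i $ j * \<xi>' \<omega> $ i $ k) \<le> norm (\<bar>C\<bar> * \<bar>C'\<bar>)"
      using mult_mono[OF 1] by (simp add: abs_mult)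
  qed
qed

text \<open>The entries are known at time \<open>s\<close> and factor out of the second moments of
  the increment. Only the terms with \<open>j = k\<close> survive, and they add up to the Frobenius
  inner product.\<close>

lemma increment_product:
  assumes \<xi>: "elementary s t \<xi>" and \<xi>': "elementary s t \<xi>'"
  shows "integrable P (\<lambda>\<omega>. elementary_integral s t \<xi> \<omega> \<bullet> elementary_integral s t \<xi>' \<omega>)"
    and "expectation (\<lambda>\<omega>. elementary_integral s t \<xi> \<omega> \<bullet> elementary_integral s t \<xi>' \<omega>)
      = expectation (\<lambda>\<omega>. \<xi> \<omega> \<bullet> \<xi>' \<omega>) * (t - s)"
proof -
  have "integrable P (\<lambda>\<omega>. elementary_integral s t \<xi> \<omega> \<bullet> elementary_integral s t \<xi>' \<omega>) \<and>
    expectation (\<lambda>\<omega>. elementary_integral s t \<xi> \<omega> \<bullet> elementary_integral s t \<xi>' \<omega>)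
      = expectation (\<lambda>\<omega>. \<xi> \<omega> \<bullet> \<xi>' \<omega>) * (t - s)"
  proof (cases "s = t")
    case True
    then show ?thesis by (simp add: elementary_integral_def)
  next
    case False
    then have st: "0 \<le> s" "s < t" "t \<le> T" using \<xi> by (auto simp: elementary_def)
    then have "s \<le> T" by simp
    obtain C where C: "\<And>\<omega>. \<omega> \<in> space P \<Longrightarrow> norm (\<xi> \<omega>) \<le> C" and m[measurable]: "\<xi> \<in> borel_measurable (F s)"
      using \<xi> by (auto simp: elementary_def)
    obtain C' where C': "\<And>\<omega>. \<omega> \<in> space P \<Longrightarrow> norm (\<xi>' \<omega>) \<le> C'" and m'[measurable]: "\<xi>' \<in> borel_measurable (F s)"
      using \<xi>' by (auto simp: elementary_def)
    let ?D = "\<lambda>j \<omega>. (W t \<omega> - W s \<omega>) $ j"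
    let ?X = "\<lambda>i j k \<omega>. \<xi> \<omega> $ i $ j * \<xi>' \<omega> $ i $ k"
    have XF: "?X i j k \<in> borel_measurable (F s)" for i j k by measurable
    have int: "integrable P (?X i j k)" for i j k
      by (rule integrable_bounded_product[OF \<open>s \<le> T\<close> m C m' C'])
    have prod: "integrable P (\<lambda>\<omega>. ?X i j k \<omega> * (?D j \<omega> * ?D k \<omega>))"
      "expectation (\<lambda>\<omega>. ?X i j k \<omega> * (?D j \<omega> * ?D k \<omega>)) = expectation (?X i j k) * (if j = k then t - s else 0)" for i j k
    proof -
      have ind: "indep_var borel (?X i j k) borel (\<lambda>\<omega>. ?D j \<omega> * ?D k \<omega>)"
        by (rule indep_increment[OF st XF, of "\<lambda>x. x $ j * x $ k"]) auto
      show "integrable P (\<lambda>\<omega>. ?X i j k \<omega> * (?D j \<omega> * ?D k \<omega>))"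
        "expectation (\<lambda>\<omega>. ?X i j k \<omega> * (?D j \<omega> * ?D k \<omega>)) = expectation (?X i j k) * (if j = k then t - s else 0)"
        using indep_var_integrable[OF ind int increment_moments(2)[OF st]]
          indep_var_lebesgue_integral[OF ind int increment_moments(2)[OF st]]
        unfolding increment_moments(4)[OF st] by auto
    qed
    have eq: "elementary_integral s t \<xi> \<omega> \<bullet> elementary_integral s t \<xi>' \<omega>
        = (\<Sum>i\<in>UNIV. \<Sum>j\<in>UNIV. \<Sum>k\<in>UNIV. ?X i j k \<omega> * (?D j \<omega> * ?D k \<omega>))" for \<omega>
      by (simp add: elementary_integral_def inner_vec_def matrix_vector_mult_def sum_product mult_ac)
    have "expectation (\<lambda>\<omega>. elementary_integral s t \<xi> \<omega> \<bullet> elementary_integral s t \<xi>' \<omega>)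
        = (\<Sum>i\<in>UNIV. \<Sum>j\<in>UNIV. \<Sum>k\<in>UNIV. expectation (?X i j k) * (if j = k then t - s else 0))"
      unfolding eq using prod by (simp add: Bochner_Integration.integral_sum Bochner_Integration.integrable_sum)
    also have "\<dots> = (\<Sum>i\<in>UNIV. \<Sum>j\<in>UNIV. expectation (?X i j j)) * (t - s)"
      by (simp add: sum_distrib_right if_distrib cong: if_cong)
    also have "(\<Sum>i\<in>UNIV. \<Sum>j\<in>UNIV. expectation (?X i j j)) = expectation (\<lambda>\<omega>. \<xi> \<omega> \<bullet> \<xi>' \<omega>)"
      unfolding inner_vec_def using int by (simp add: Bochner_Integration.integral_sum Bochner_Integration.integrable_sum)
    finally show ?thesis
      unfolding eq using prod by (auto intro!: Bochner_Integration.integrable_sum)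
  qed
  then show "integrable P (\<lambda>\<omega>. elementary_integral s t \<xi> \<omega> \<bullet> elementary_integral s t \<xi>' \<omega>)"
    "expectation (\<lambda>\<omega>. elementary_integral s t \<xi> \<omega> \<bullet> elementary_integral s t \<xi>' \<omega>)
      = expectation (\<lambda>\<omega>. \<xi> \<omega> \<bullet> \<xi>' \<omega>) * (t - s)" by auto
qed

lemma elementary_integral_measurable:
  assumes "elementary u v \<xi>" "v \<le> t"
  shows "elementary_integral u v \<xi> \<in> borel_measurable (F t)"
proof -
  have [measurable]: "\<xi> \<in> borel_measurable (F t)" "W u \<in> borel_measurable (F t)" "W v \<in> borel_measurable (F t)"
    using assms by (auto simp: elementary_def intro: measurable_F_mono[of u t] W_measurable_F)
  show ?thesis unfolding elementary_integral_def by measurable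
qed

lemma elementary_integral_measurable_P:
  "elementary u v \<xi> \<Longrightarrow> elementary_integral u v \<xi> \<in> borel_measurable P"
  by (rule measurable_F_P[OF _ elementary_integral_measurable[of u v \<xi> v]]) (auto simp: elementary_def)

lemma elementary_integral_square_integrable:
  "elementary u v \<xi> \<Longrightarrow> integrable P (\<lambda>\<omega>. (norm (elementary_integral u v \<xi> \<omega>))\<^sup>2)"
  using increment_product(1)[of u v \<xi> \<xi>] by (simp add: power2_norm_eq_inner)

text \<open>Both halves keep the same \<open>\<xi>\<close>, which is still known at the later
  starting time \<open>w\<close>.\<close>

lemma elementary_split:
  assumes "elementary u v \<xi>" "u \<le> w" "w \<le> v"
  shows "elementary u w \<xi>" "elementary w v \<xi>"
    "elementary_integral u v \<xi> \<omega> = elementary_integral u w \<xi> \<omega> + elementary_integral w v \<xi> \<omega>"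
proof -
  show "elementary u w \<xi>"
    using assms unfolding elementary_def by - (elim conjE, intro conjI; (assumption | linarith))
  show "elementary w v \<xi>"
    using assms measurable_F_mono[OF assms(2), of \<xi>] unfolding elementary_def
    by - (elim conjE, intro conjI; (assumption | linarith | blast))
  show "elementary_integral u v \<xi> \<omega> = elementary_integral u w \<xi> \<omega> + elementary_integral w v \<xi> \<omega>"
    unfolding elementary_integral_def matrix_vector_right_distrib[symmetric] by simp
qed

text \<open>The earlier integral is square integrable and known when the later interval begins, so
  it can play the part of \<open>\<eta>\<close> in the orthogonality lemma.\<close>

lemma elementary_disjoint:
  assumes "elementary u v \<xi>" "elementary u' v' \<xi>'" "v \<le> u'"
  shows "integrable P (\<lambda>\<omega>. elementary_integral u v \<xi> \<omega> \<bullet> elementary_integral u' v' \<xi>' \<omega>)"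
    and "expectation (\<lambda>\<omega>. elementary_integral u v \<xi> \<omega> \<bullet> elementary_integral u' v' \<xi>' \<omega>) = 0"
  using increment_orthogonal[OF elementary_integral_measurable[OF assms(1,3)]
      elementary_integral_square_integrable[OF assms(1)] assms(2)] by auto

text \<open>The intervals are cut at the endpoints of each other, which reduces the claim to equal and to
  disjoint intervals.\<close>

lemma elementary_same_start:
  assumes "elementary u v \<xi>" "elementary u v' \<xi>'" "v \<le> v'"
  shows "integrable P (\<lambda>\<omega>. elementary_integral u v \<xi> \<omega> \<bullet> elementary_integral u v' \<xi>' \<omega>)"
    and "expectation (\<lambda>\<omega>. elementary_integral u v \<xi> \<omega> \<bullet> elementary_integral u v' \<xi>' \<omega>)
      = expectation (\<lambda>\<omega>. \<xi> \<omega> \<bullet> \<xi>' \<omega>) * (v - u)"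
proof -
  have "u \<le> v" using assms by (auto simp: elementary_def)
  note split = elementary_split[OF assms(2) this assms(3)]
  note same = increment_product[OF assms(1) split(1)] and disj = elementary_disjoint[OF assms(1) split(2) order_refl]
  show "integrable P (\<lambda>\<omega>. elementary_integral u v \<xi> \<omega> \<bullet> elementary_integral u v' \<xi>' \<omega>)"
    "expectation (\<lambda>\<omega>. elementary_integral u v \<xi> \<omega> \<bullet> elementary_integral u v' \<xi>' \<omega>)
      = expectation (\<lambda>\<omega>. \<xi> \<omega> \<bullet> \<xi>' \<omega>) * (v - u)"
    unfolding split(3) inner_add_right using same disj by auto
qed

lemma elementary_same_start':
  assumes "elementary u v \<xi>" "elementary u v' \<xi>'"
  shows "integrable P (\<lambda>\<omega>. elementary_integral u v \<xi> \<omega> \<bullet> elementary_integral u v' \<xi>' \<omega>)"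
    and "expectation (\<lambda>\<omega>. elementary_integral u v \<xi> \<omega> \<bullet> elementary_integral u v' \<xi>' \<omega>)
      = expectation (\<lambda>\<omega>. \<xi> \<omega> \<bullet> \<xi>' \<omega>) * (min v v' - u)"
  using elementary_same_start[OF assms] elementary_same_start[OF assms(2,1)]
  by (cases "v \<le> v'"; simp add: inner_commute min_def)+

lemma elementary_ordered_start:
  assumes "elementary u v \<xi>" "elementary u' v' \<xi>'" "u \<le> u'"
  shows "integrable P (\<lambda>\<omega>. elementary_integral u v \<xi> \<omega> \<bullet> elementary_integral u' v' \<xi>' \<omega>)"
    and "expectation (\<lambda>\<omega>. elementary_integral u v \<xi> \<omega> \<bullet> elementary_integral u' v' \<xi>' \<omega>)
      = expectation (\<lambda>\<omega>. \<xi> \<omega> \<bullet> \<xi>' \<omega>) * max 0 (min v v' - u')"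
proof -
  have "u' \<le> v'" using assms(2) by (simp add: elementary_def)
  have "integrable P (\<lambda>\<omega>. elementary_integral u v \<xi> \<omega> \<bullet> elementary_integral u' v' \<xi>' \<omega>) \<and>
    expectation (\<lambda>\<omega>. elementary_integral u v \<xi> \<omega> \<bullet> elementary_integral u' v' \<xi>' \<omega>)
      = expectation (\<lambda>\<omega>. \<xi> \<omega> \<bullet> \<xi>' \<omega>) * max 0 (min v v' - u')"
  proof (cases "v \<le> u'")
    case True
    then have "max 0 (min v v' - u') = 0" by auto
    then show ?thesis using elementary_disjoint[OF assms(1,2) True] by simp
  next
    case False
    then have "u' \<le> v" by simp
    note split = elementary_split[OF assms(1,3) this]
    note same = elementary_same_start'[OF split(2) assms(2)]
      and disj = elementary_disjoint[OF split(1) assms(2) order_refl]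
    show ?thesis
      unfolding split(3) inner_add_left using same disj \<open>u' \<le> v\<close> \<open>u' \<le> v'\<close> by auto
  qed
  then show "integrable P (\<lambda>\<omega>. elementary_integral u v \<xi> \<omega> \<bullet> elementary_integral u' v' \<xi>' \<omega>)"
    and "expectation (\<lambda>\<omega>. elementary_integral u v \<xi> \<omega> \<bullet> elementary_integral u' v' \<xi>' \<omega>)
      = expectation (\<lambda>\<omega>. \<xi> \<omega> \<bullet> \<xi>' \<omega>) * max 0 (min v v' - u')"
    by auto
qed

text \<open>Written with the measure of the overlap, the formula is symmetric in the two blocks and
  matches the time integral of the product of their indicators.\<close>

lemma elementary_inner:
  assumes "elementary u v \<xi>" "elementary u' v' \<xi>'"
  shows "integrable P (\<lambda>\<omega>. elementary_integral u v \<xi> \<omega> \<bullet> elementary_integral u' v' \<xi>' \<omega>)"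
    and "expectation (\<lambda>\<omega>. elementary_integral u v \<xi> \<omega> \<bullet> elementary_integral u' v' \<xi>' \<omega>)
      = expectation (\<lambda>\<omega>. \<xi> \<omega> \<bullet> \<xi>' \<omega>) * measure lborel ({u<..v} \<inter> {u'<..v'})"
proof -
  have "measure lborel ({u<..v} \<inter> {u'<..v'}) = max 0 (min v v' - max u u')"
    by (auto simp: Int_greaterThanAtMost max_def min_def)
  then show "integrable P (\<lambda>\<omega>. elementary_integral u v \<xi> \<omega> \<bullet> elementary_integral u' v' \<xi>' \<omega>)"
    and "expectation (\<lambda>\<omega>. elementary_integral u v \<xi> \<omega> \<bullet> elementary_integral u' v' \<xi>' \<omega>)
      = expectation (\<lambda>\<omega>. \<xi> \<omega> \<bullet> \<xi>' \<omega>) * measure lborel ({u<..v} \<inter> {u'<..v'})"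
    using elementary_ordered_start[OF assms] elementary_ordered_start[OF assms(2,1)]
    by (cases "u \<le> u'"; simp add: inner_commute min.commute max_def)+
qed

end

lemma inner_sum_sum:
  "(\<Sum>i\<in>I. x i) \<bullet> (\<Sum>j\<in>J. y j) = (\<Sum>i\<in>I. \<Sum>j\<in>J. x i \<bullet> y j)"
  by (subst inner_sum_left) (simp only: inner_sum_right)

context brownian
begin

text \<open>The mixed terms with \<open>\<eta>\<close> vanish, as every interval begins at or after
  \<open>a\<close>. The double sum is the Gram form that the processes themselves produce as
  well.\<close>

lemma elementary_family_norm:
  fixes \<xi> :: "'i \<Rightarrow> 'a \<Rightarrow> real^'d^'m" and \<eta> :: "'a \<Rightarrow> real^'m"
  assumes fin: "finite I" and el: "\<And>i. i \<in> I \<Longrightarrow> elementary (u i) (v i) (\<xi> i)"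
    and a: "\<And>i. i \<in> I \<Longrightarrow> a \<le> u i"
    and \<eta>: "\<eta> \<in> borel_measurable (F a)" "integrable P (\<lambda>\<omega>. (norm (\<eta> \<omega>))\<^sup>2)"
  shows "integrable P (\<lambda>\<omega>. (norm (\<eta> \<omega> + (\<Sum>i\<in>I. elementary_integral (u i) (v i) (\<xi> i) \<omega>)))\<^sup>2)" (is ?int)
    and "expectation (\<lambda>\<omega>. (norm (\<eta> \<omega> + (\<Sum>i\<in>I. elementary_integral (u i) (v i) (\<xi> i) \<omega>)))\<^sup>2) =
      expectation (\<lambda>\<omega>. (norm (\<eta> \<omega>))\<^sup>2) +
      (\<Sum>i\<in>I. \<Sum>j\<in>I. expectation (\<lambda>\<omega>. \<xi> i \<omega> \<bullet> \<xi> j \<omega>) * measure lborel ({u i<..v i} \<inter> {u j<..v j}))" (is ?eq)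
proof -
  let ?J = "\<lambda>i. elementary_integral (u i) (v i) (\<xi> i)"
  have orth: "integrable P (\<lambda>\<omega>. \<eta> \<omega> \<bullet> ?J i \<omega>)" "expectation (\<lambda>\<omega>. \<eta> \<omega> \<bullet> ?J i \<omega>) = 0" if "i \<in> I" for i
    using increment_orthogonal[OF measurable_F_mono[OF a[OF that] \<eta>(1)] \<eta>(2) el[OF that]] by auto
  have inner: "integrable P (\<lambda>\<omega>. ?J i \<omega> \<bullet> ?J j \<omega>)"
      "expectation (\<lambda>\<omega>. ?J i \<omega> \<bullet> ?J j \<omega>) =
        expectation (\<lambda>\<omega>. \<xi> i \<omega> \<bullet> \<xi> j \<omega>) * measure lborel ({u i<..v i} \<inter> {u j<..v j})"
    if "i \<in> I" "j \<in> I" for i j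
    using elementary_inner[OF el[OF that(1)] el[OF that(2)]] by auto
  have expand: "(norm (\<eta> \<omega> + (\<Sum>i\<in>I. ?J i \<omega>)))\<^sup>2 =
      (norm (\<eta> \<omega>))\<^sup>2 + 2 * (\<Sum>i\<in>I. \<eta> \<omega> \<bullet> ?J i \<omega>) + (\<Sum>i\<in>I. \<Sum>j\<in>I. ?J i \<omega> \<bullet> ?J j \<omega>)" for \<omega>
  proof -
    have "(norm (x + y))\<^sup>2 = (norm x)\<^sup>2 + 2 * (x \<bullet> y) + y \<bullet> y" for x y :: "real^'m"
      by (simp add: power2_norm_eq_inner inner_add_left inner_add_right inner_commute)
    then show ?thesis
      unfolding inner_sum_sum[symmetric] inner_sum_right[of "\<eta> \<omega>", symmetric] .
  qed
  have i1: "integrable P (\<lambda>\<omega>. 2 * (\<Sum>i\<in>I. \<eta> \<omega> \<bullet> ?J i \<omega>))"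
    by (intro integrable_mult_right Bochner_Integration.integrable_sum orth(1))
  have i2: "integrable P (\<lambda>\<omega>. \<Sum>i\<in>I. \<Sum>j\<in>I. ?J i \<omega> \<bullet> ?J j \<omega>)"
    by (intro Bochner_Integration.integrable_sum inner(1))
  show ?int unfolding expand using \<eta>(2) i1 i2 by (intro Bochner_Integration.integrable_add)
  have "expectation (\<lambda>\<omega>. 2 * (\<Sum>i\<in>I. \<eta> \<omega> \<bullet> ?J i \<omega>)) = 0"
    using orth by (simp add: Bochner_Integration.integral_sum)
  moreover have "expectation (\<lambda>\<omega>. \<Sum>i\<in>I. \<Sum>j\<in>I. ?J i \<omega> \<bullet> ?J j \<omega>) =
      (\<Sum>i\<in>I. \<Sum>j\<in>I. expectation (\<lambda>\<omega>. ?J i \<omega> \<bullet> ?J j \<omega>))"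
    using inner(1) by (simp add: Bochner_Integration.integral_sum Bochner_Integration.integrable_sum)
  ultimately show ?eq
    unfolding expand using \<eta>(2) i1 i2 inner(2) by (simp add: Bochner_Integration.integral_add)
qed

lemma elementary_integrable_inner:
  assumes "elementary u v \<xi>" "elementary u' v' \<xi>'"
  shows "integrable P (\<lambda>\<omega>. \<xi> \<omega> \<bullet> \<xi>' \<omega>)"
proof -
  obtain C where C: "\<And>\<omega>. \<omega> \<in> space P \<Longrightarrow> norm (\<xi> \<omega>) \<le> C"
    using assms(1) by (auto simp: elementary_def)
  obtain C' where C': "\<And>\<omega>. \<omega> \<in> space P \<Longrightarrow> norm (\<xi>' \<omega>) \<le> C'"
    using assms(2) by (auto simp: elementary_def)
  have "\<xi> \<in> borel_measurable (F u)" "\<xi>' \<in> borel_measurable (F u')" "u \<le> T" "u' \<le> T"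
    using assms unfolding elementary_def by auto
  then have [measurable]: "\<xi> \<in> borel_measurable P" "\<xi>' \<in> borel_measurable P"
    using measurable_F_P by auto
  show ?thesis
  proof (rule Bochner_Integration.integrable_bound[OF integrable_const])
    show "(\<lambda>\<omega>. \<xi> \<omega> \<bullet> \<xi>' \<omega>) \<in> borel_measurable P" by measurable
    show "AE \<omega> in P. norm (\<xi> \<omega> \<bullet> \<xi>' \<omega>) \<le> norm (C * C')"
    proof (intro AE_I2)
      fix \<omega> assume \<omega>: "\<omega> \<in> space P"
      have "norm (\<xi> \<omega> \<bullet> \<xi>' \<omega>) \<le> norm (\<xi> \<omega>) * norm (\<xi>' \<omega>)"
        using Cauchy_Schwarz_ineq2 by auto
      also have "\<dots> \<le> C * C'"
        using C[OF \<omega>] C'[OF \<omega>] by (intro mult_mono order.trans[OF norm_ge_zero C[OF \<omega>]]) auto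
      finally show "norm (\<xi> \<omega> \<bullet> \<xi>' \<omega>) \<le> norm (C * C')" by simp
    qed
  qed
qed

text \<open>A product of indicators is the indicator of the intersection, so the time integral
  reproduces the double sum of the stochastic side.\<close>

lemma elementary_family_process_norm:
  fixes \<xi> :: "'i \<Rightarrow> 'a \<Rightarrow> real^'d^'m"
  assumes fin: "finite I" and el: "\<And>i. i \<in> I \<Longrightarrow> elementary (u i) (v i) (\<xi> i)"
  shows "(\<integral>\<^sup>+s. (\<integral>\<^sup>+\<omega>. ennreal ((norm (\<Sum>i\<in>I. indicat_real {u i<..v i} s *\<^sub>R \<xi> i \<omega>))\<^sup>2) \<partial>P) \<partial>lborel) =
    ennreal (\<Sum>i\<in>I. \<Sum>j\<in>I. expectation (\<lambda>\<omega>. \<xi> i \<omega> \<bullet> \<xi> j \<omega>) * measure lborel ({u i<..v i} \<inter> {u j<..v j}))"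
proof -
  let ?A = "\<lambda>i. {u i<..v i}" and ?e = "\<lambda>i j. expectation (\<lambda>\<omega>. \<xi> i \<omega> \<bullet> \<xi> j \<omega>)"
  have int: "integrable P (\<lambda>\<omega>. \<xi> i \<omega> \<bullet> \<xi> j \<omega>)" if "i \<in> I" "j \<in> I" for i j
    using elementary_integrable_inner[OF el[OF that(1)] el[OF that(2)]] .
  have expand: "(norm (\<Sum>i\<in>I. indicat_real (?A i) s *\<^sub>R \<xi> i \<omega>))\<^sup>2 =
      (\<Sum>i\<in>I. \<Sum>j\<in>I. indicat_real (?A i \<inter> ?A j) s * (\<xi> i \<omega> \<bullet> \<xi> j \<omega>))" for s \<omega>
    unfolding power2_norm_eq_inner
    by (simp add: inner_sum_sum indicator_inter_arith mult_ac del: Int_greaterThanAtMost)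
  \<comment> \<open>Single terms may be negative and would be cut off by \<open>ennreal\<close>. The
    whole sum is nonnegative because it is a second moment.\<close>
  have inner: "(\<integral>\<^sup>+\<omega>. ennreal ((norm (\<Sum>i\<in>I. indicat_real (?A i) s *\<^sub>R \<xi> i \<omega>))\<^sup>2) \<partial>P) =
      ennreal (\<Sum>i\<in>I. \<Sum>j\<in>I. indicat_real (?A i \<inter> ?A j) s * ?e i j)"
    and nonneg: "0 \<le> (\<Sum>i\<in>I. \<Sum>j\<in>I. indicat_real (?A i \<inter> ?A j) s * ?e i j)" for s
  proof -
    have i: "integrable P (\<lambda>\<omega>. (norm (\<Sum>i\<in>I. indicat_real (?A i) s *\<^sub>R \<xi> i \<omega>))\<^sup>2)"
      unfolding expand by (intro Bochner_Integration.integrable_sum integrable_mult_right int)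
    have e: "expectation (\<lambda>\<omega>. (norm (\<Sum>i\<in>I. indicat_real (?A i) s *\<^sub>R \<xi> i \<omega>))\<^sup>2) =
        (\<Sum>i\<in>I. \<Sum>j\<in>I. indicat_real (?A i \<inter> ?A j) s * ?e i j)"
      unfolding expand using int
      by (simp add: Bochner_Integration.integral_sum Bochner_Integration.integrable_sum)
    show "(\<integral>\<^sup>+\<omega>. ennreal ((norm (\<Sum>i\<in>I. indicat_real (?A i) s *\<^sub>R \<xi> i \<omega>))\<^sup>2) \<partial>P) =
      ennreal (\<Sum>i\<in>I. \<Sum>j\<in>I. indicat_real (?A i \<inter> ?A j) s * ?e i j)"
      unfolding e[symmetric] by (rule nn_integral_eq_integral[OF i]) simp
    show "0 \<le> (\<Sum>i\<in>I. \<Sum>j\<in>I. indicat_real (?A i \<inter> ?A j) s * ?e i j)"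
      unfolding e[symmetric] by (rule Bochner_Integration.integral_nonneg) simp
  qed
  have ind: "integrable lborel (indicat_real (?A i \<inter> ?A j))" for i j
  proof (rule integrable_real_indicator)
    have "emeasure lborel (?A i \<inter> ?A j) \<le> emeasure lborel {u i..v i}"
      by (intro emeasure_mono) auto
    also have "\<dots> < \<infinity>"
      using emeasure_compact_finite[of "{u i..v i}"] by simp
    finally show "emeasure lborel (?A i \<inter> ?A j) < \<infinity>" .
  qed auto
  have "(\<integral>\<^sup>+s. (\<integral>\<^sup>+\<omega>. ennreal ((norm (\<Sum>i\<in>I. indicat_real (?A i) s *\<^sub>R \<xi> i \<omega>))\<^sup>2) \<partial>P) \<partial>lborel) =
      ennreal (\<integral>s. (\<Sum>i\<in>I. \<Sum>j\<in>I. indicat_real (?A i \<inter> ?A j) s * ?e i j) \<partial>lborel)"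
    unfolding inner using nonneg
    by (intro nn_integral_eq_integral Bochner_Integration.integrable_sum integrable_mult_left ind) auto
  also have "(\<integral>s. (\<Sum>i\<in>I. \<Sum>j\<in>I. indicat_real (?A i \<inter> ?A j) s * ?e i j) \<partial>lborel) =
      (\<Sum>i\<in>I. \<Sum>j\<in>I. (\<integral>s. indicat_real (?A i \<inter> ?A j) s \<partial>lborel) * ?e i j)"
    using ind by (simp add: Bochner_Integration.integral_sum Bochner_Integration.integrable_sum del: integral_indicator)
  also have "\<dots> = (\<Sum>i\<in>I. \<Sum>j\<in>I. ?e i j * measure lborel (?A i \<inter> ?A j))"
    by (simp add: mult.commute)
  finally show ?thesis .
qed

text \<open>Both second moments are expressed by the same Gram sum. The intervals may overlap in any
  way, as long as they lie within \<open>a\<close> and \<open>b\<close>.\<close>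

lemma elementary_family_isometry:
  fixes \<xi> :: "'i \<Rightarrow> 'a \<Rightarrow> real^'d^'m" and \<eta> :: "'a \<Rightarrow> real^'m"
  assumes fin: "finite I" and el: "\<And>i. i \<in> I \<Longrightarrow> elementary (u i) (v i) (\<xi> i)"
    and ab: "\<And>i. i \<in> I \<Longrightarrow> a \<le> u i" "\<And>i. i \<in> I \<Longrightarrow> v i \<le> b" and "a \<le> T"
    and \<eta>: "\<eta> \<in> borel_measurable (F a)" "(\<integral>\<^sup>+\<omega>. ennreal ((norm (\<eta> \<omega>))\<^sup>2) \<partial>P) < \<infinity>"
  shows "(\<integral>\<^sup>+\<omega>. ennreal ((norm (\<eta> \<omega> + (\<Sum>i\<in>I. elementary_integral (u i) (v i) (\<xi> i) \<omega>)))\<^sup>2) \<partial>P) =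
    (\<integral>\<^sup>+\<omega>. ennreal ((norm (\<eta> \<omega>))\<^sup>2) \<partial>P) +
    (\<integral>\<^sup>+s\<in>{a..b}. (\<integral>\<^sup>+\<omega>. ennreal ((norm (\<Sum>i\<in>I. indicat_real {u i<..v i} s *\<^sub>R \<xi> i \<omega>))\<^sup>2) \<partial>P) \<partial>lborel)"
proof -
  let ?S = "\<Sum>i\<in>I. \<Sum>j\<in>I. expectation (\<lambda>\<omega>. \<xi> i \<omega> \<bullet> \<xi> j \<omega>) * measure lborel ({u i<..v i} \<inter> {u j<..v j})"
  have [measurable]: "\<eta> \<in> borel_measurable P" using \<eta>(1) \<open>a \<le> T\<close> measurable_F_P by blast
  have int: "integrable P (\<lambda>\<omega>. (norm (\<eta> \<omega>))\<^sup>2)"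
    using \<eta>(2) by (intro integrableI_bounded) auto
  note fam = elementary_family_norm[OF fin el ab(1) \<eta>(1) int]
  have "0 \<le> ?S"
  proof -
    \<comment> \<open>With \<open>\<eta> = 0\<close> the Gram sum is itself a second moment, hence
      nonnegative.\<close>
    have "?S = expectation (\<lambda>\<omega>. (norm (0 + (\<Sum>i\<in>I. elementary_integral (u i) (v i) (\<xi> i) \<omega>)))\<^sup>2)"
      using elementary_family_norm(2)[of I u v \<xi> a "\<lambda>_. 0", OF fin el ab(1)] by simp
    then show ?thesis by (simp only:) (rule Bochner_Integration.integral_nonneg, simp)
  qed
  have "(\<integral>\<^sup>+s\<in>{a..b}. (\<integral>\<^sup>+\<omega>. ennreal ((norm (\<Sum>i\<in>I. indicat_real {u i<..v i} s *\<^sub>R \<xi> i \<omega>))\<^sup>2) \<partial>P) \<partial>lborel) =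
    (\<integral>\<^sup>+s. (\<integral>\<^sup>+\<omega>. ennreal ((norm (\<Sum>i\<in>I. indicat_real {u i<..v i} s *\<^sub>R \<xi> i \<omega>))\<^sup>2) \<partial>P) \<partial>lborel)"
  proof (intro nn_integral_cong)
    fix s
    have "s \<notin> {u i<..v i}" if "s \<notin> {a..b}" "i \<in> I" for i
      using that ab[of i] by auto
    then have "(\<Sum>i\<in>I. indicat_real {u i<..v i} s *\<^sub>R \<xi> i \<omega>) = 0" if "s \<notin> {a..b}" for \<omega>
      using that by (intro sum.neutral) simp
    then show "(\<integral>\<^sup>+\<omega>. ennreal ((norm (\<Sum>i\<in>I. indicat_real {u i<..v i} s *\<^sub>R \<xi> i \<omega>))\<^sup>2) \<partial>P) * indicator {a..b} s =
        (\<integral>\<^sup>+\<omega>. ennreal ((norm (\<Sum>i\<in>I. indicat_real {u i<..v i} s *\<^sub>R \<xi> i \<omega>))\<^sup>2) \<partial>P)"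
      by (cases "s \<in> {a..b}") auto
  qed
  also have "\<dots> = ennreal ?S"
    by (rule elementary_family_process_norm[OF fin el])
  finally have "(\<integral>\<^sup>+\<omega>. ennreal ((norm (\<eta> \<omega>))\<^sup>2) \<partial>P) +
    (\<integral>\<^sup>+s\<in>{a..b}. (\<integral>\<^sup>+\<omega>. ennreal ((norm (\<Sum>i\<in>I. indicat_real {u i<..v i} s *\<^sub>R \<xi> i \<omega>))\<^sup>2) \<partial>P) \<partial>lborel) =
    ennreal (expectation (\<lambda>\<omega>. (norm (\<eta> \<omega>))\<^sup>2)) + ennreal ?S"
    using nn_integral_eq_integral[OF int] by simp
  also have "\<dots> = ennreal (expectation (\<lambda>\<omega>. (norm (\<eta> \<omega>))\<^sup>2) + ?S)"
    using \<open>0 \<le> ?S\<close> by (intro ennreal_plus[symmetric] Bochner_Integration.integral_nonneg) auto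
  also have "\<dots> = (\<integral>\<^sup>+\<omega>. ennreal ((norm (\<eta> \<omega> + (\<Sum>i\<in>I. elementary_integral (u i) (v i) (\<xi> i) \<omega>)))\<^sup>2) \<partial>P)"
    using nn_integral_eq_integral[OF fam(1)] fam(2) by simp
  finally show ?thesis by (rule sym)
qed

lemma simple_integrand_elementary:
  assumes S: "simple_integrand P F a b k \<tau> \<xi>" and ab: "0 \<le> a" "b \<le> T" and i: "i < k"
  shows "elementary (\<tau> i) (\<tau> (Suc i)) (\<xi> i)" "a \<le> \<tau> i" "\<tau> (Suc i) \<le> b"
proof -
  have step: "\<tau> i \<le> \<tau> (Suc i)" if "i < k" for i
    using S that by (simp add: simple_integrand_def)
  have mono: "\<tau> i \<le> \<tau> j" if "i \<le> j" "j \<le> k" for i j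
    using that by (induct j rule: dec_induct) (auto intro: order.trans[OF _ step])
  show a: "a \<le> \<tau> i" using mono[of 0 i] i S by (simp add: simple_integrand_def)
  show b: "\<tau> (Suc i) \<le> b" using mono[of "Suc i" k] i S by (simp add: simple_integrand_def)
  show "elementary (\<tau> i) (\<tau> (Suc i)) (\<xi> i)"
    unfolding elementary_def using a b ab step[OF i] S i
    by (auto simp: simple_integrand_def)
qed

lemma simple_isometry:
  fixes \<xi> \<xi>' :: "nat \<Rightarrow> 'a \<Rightarrow> real^'d^'m" and \<eta> :: "'a \<Rightarrow> real^'m"
  assumes S: "simple_integrand P F a b k \<tau> \<xi>" and S': "simple_integrand P F a b k' \<tau>' \<xi>'"
    and ab: "0 \<le> a" "a \<le> T" "b \<le> T"
    and \<eta>: "\<eta> \<in> borel_measurable (F a)" "(\<integral>\<^sup>+\<omega>. ennreal ((norm (\<eta> \<omega>))\<^sup>2) \<partial>P) < \<infinity>"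
  shows "(\<integral>\<^sup>+\<omega>. ennreal ((norm (\<eta> \<omega> + (simple_integral W k \<tau> \<xi> \<omega> - simple_integral W k' \<tau>' \<xi>' \<omega>)))\<^sup>2) \<partial>P) =
    (\<integral>\<^sup>+\<omega>. ennreal ((norm (\<eta> \<omega>))\<^sup>2) \<partial>P) +
    (\<integral>\<^sup>+s\<in>{a..b}. (\<integral>\<^sup>+\<omega>. ennreal ((norm (simple_process k \<tau> \<xi> s \<omega> - simple_process k' \<tau>' \<xi>' s \<omega>))\<^sup>2) \<partial>P) \<partial>lborel)"
proof -
  have minus: "(- A) *v x = - (A *v x)" for A :: "real^'d^'m" and x
    by (simp add: vec_eq_iff matrix_vector_mult_def sum_negf)
  \<comment> \<open>The difference of two simple processes is one family over the disjoint sum of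
    the index sets, the second integrand entering with the opposite sign.\<close>
  let ?I = "{..<k} <+> {..<k'}"
  let ?u = "case_sum \<tau> \<tau>'" and ?v = "case_sum (\<lambda>i. \<tau> (Suc i)) (\<lambda>i. \<tau>' (Suc i))"
    and ?x = "case_sum \<xi> (\<lambda>i \<omega>. - \<xi>' i \<omega>)"
  note e = simple_integrand_elementary[OF S ab(1,3)] and e' = simple_integrand_elementary[OF S' ab(1,3)]
  have "elementary (?u i) (?v i) (?x i)" if "i \<in> ?I" for i
    using that e(1) e'(1) by (auto simp: elementary_def)
  moreover have "a \<le> ?u i" "?v i \<le> b" if "i \<in> ?I" for i
    using that e(2,3) e'(2,3) by auto
  ultimately have "(\<integral>\<^sup>+\<omega>. ennreal ((norm (\<eta> \<omega> + (\<Sum>i\<in>?I. elementary_integral (?u i) (?v i) (?x i) \<omega>)))\<^sup>2) \<partial>P) =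
    (\<integral>\<^sup>+\<omega>. ennreal ((norm (\<eta> \<omega>))\<^sup>2) \<partial>P) +
    (\<integral>\<^sup>+s\<in>{a..b}. (\<integral>\<^sup>+\<omega>. ennreal ((norm (\<Sum>i\<in>?I. indicat_real {?u i<..?v i} s *\<^sub>R ?x i \<omega>))\<^sup>2) \<partial>P) \<partial>lborel)"
    by (intro elementary_family_isometry \<eta> ab(2)) auto
  moreover have "(\<Sum>i\<in>?I. elementary_integral (?u i) (?v i) (?x i) \<omega>) =
      simple_integral W k \<tau> \<xi> \<omega> - simple_integral W k' \<tau>' \<xi>' \<omega>" for \<omega>
    by (simp add: sum.Plus elementary_integral_def simple_integral_def minus sum_negf)
  moreover have "(\<Sum>i\<in>?I. indicat_real {?u i<..?v i} s *\<^sub>R ?x i \<omega>) =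
      simple_process k \<tau> \<xi> s \<omega> - simple_process k' \<tau>' \<xi>' s \<omega>" for s \<omega>
    by (simp only: sum.Plus finite_lessThan comp_def sum.case simple_process_def scaleR_minus_right
        sum_negf diff_conv_add_uminus)
  ultimately show ?thesis by simp
qed

end

section \<open>Approximation by simple integrands\<close>

lemma (in sigma_finite_measure) nn_integral_iterated_restrict:
  fixes A :: "real set"
  assumes A: "A \<in> sets borel" and f: "f \<in> borel_measurable (restrict_space borel A \<Otimes>\<^sub>M M)"
  shows "(\<integral>\<^sup>+s\<in>A. (\<integral>\<^sup>+\<omega>. f (s, \<omega>) \<partial>M) \<partial>lborel) = (\<integral>\<^sup>+p. f p \<partial>(restrict_space lborel A \<Otimes>\<^sub>M M))"
proof -
  have "sets (restrict_space lborel A \<Otimes>\<^sub>M M) = sets (restrict_space borel A \<Otimes>\<^sub>M M)"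
    by (intro sets_pair_measure_cong sets_restrict_space_cong) auto
  then have "f \<in> borel_measurable (restrict_space lborel A \<Otimes>\<^sub>M M)"
    using f measurable_cong_sets by blast
  from nn_integral_fst[OF this] show ?thesis
    using A by (simp add: nn_integral_restrict_space)
qed

lemma measurable_restrict_process:
  fixes Z :: "real \<Rightarrow> 'a \<Rightarrow> 'b::topological_space"
  assumes "(\<lambda>(t, \<omega>). Z t \<omega>) \<in> borel_measurable (restrict_space borel B \<Otimes>\<^sub>M M)" "A \<subseteq> B"
  shows "(\<lambda>(t, \<omega>). Z t \<omega>) \<in> borel_measurable (restrict_space borel A \<Otimes>\<^sub>M M)"
proof -
  have "(\<lambda>p. (fst p, snd p)) \<in> restrict_space borel A \<Otimes>\<^sub>M M \<rightarrow>\<^sub>M restrict_space borel B \<Otimes>\<^sub>M M"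
  proof (intro measurable_Pair measurable_snd measurable_restrict_space2)
    show "fst \<in> borel_measurable (restrict_space borel A \<Otimes>\<^sub>M M)"
      by (rule measurable_compose[OF measurable_fst measurable_restrict_space1[OF measurable_ident, simplified id_def]])
    show "fst \<in> space (restrict_space borel A \<Otimes>\<^sub>M M) \<rightarrow> B"
      using assms(2) by (auto simp: space_pair_measure space_restrict_space)
  qed
  from measurable_compose[OF this assms(1)] show ?thesis by (simp add: case_prod_beta)
qed

lemma measurable_process_section:
  fixes Z :: "real \<Rightarrow> 'a \<Rightarrow> 'b::topological_space"
  assumes "(\<lambda>(t, \<omega>). Z t \<omega>) \<in> borel_measurable (restrict_space borel A \<Otimes>\<^sub>M M)" "\<omega> \<in> space M"
  shows "(\<lambda>t. Z t \<omega>) \<in> borel_measurable (restrict_space borel A)"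
  using measurable_compose[OF measurable_Pair2'[OF assms(2)] assms(1)] by simp

text \<open>Clamping the time before evaluation gives measurability on the whole line, where the
  process can be translated.\<close>

lemma measurable_process_extend:
  fixes Z :: "real \<Rightarrow> 'a \<Rightarrow> 'b::real_normed_vector"
  assumes Z: "(\<lambda>(t, \<omega>). Z t \<omega>) \<in> borel_measurable (restrict_space borel {a..b} \<Otimes>\<^sub>M M)"
  shows "(\<lambda>p. indicator {a..b} (fst p) *\<^sub>R Z (fst p) (snd p)) \<in> borel_measurable (borel \<Otimes>\<^sub>M M)"
proof (cases "a \<le> b")
  case True
  have "(\<lambda>p. (max a (min b (fst p)), snd p)) \<in> borel \<Otimes>\<^sub>M M \<rightarrow>\<^sub>M restrict_space borel {a..b} \<Otimes>\<^sub>M M"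
    using True by (intro measurable_Pair measurable_snd measurable_restrict_space2) auto
  from measurable_compose[OF this Z]
  have [measurable]: "(\<lambda>p. Z (max a (min b (fst p))) (snd p)) \<in> borel_measurable (borel \<Otimes>\<^sub>M M)"
    by simp
  have "(\<lambda>p. indicator {a..b} (fst p) *\<^sub>R Z (fst p) (snd p)) =
      (\<lambda>p. if fst p \<in> {a..b} then Z (max a (min b (fst p))) (snd p) else 0)"
    by (auto simp: fun_eq_iff indicator_def)
  moreover have "(\<lambda>p. if fst p \<in> {a..b} then Z (max a (min b (fst p))) (snd p) else 0) \<in> borel_measurable (borel \<Otimes>\<^sub>M M)"
    by measurable
  ultimately show ?thesis by simp
qed simp

text \<open>Passing to one integral over the product space makes the mean-square lemmas applicable
  to processes.\<close>

lemma (in sigma_finite_measure) iterated_norm_sq: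
  fixes f :: "real \<Rightarrow> 'a \<Rightarrow> 'b::{real_normed_vector, second_countable_topology}"
  assumes f: "case_prod f \<in> borel_measurable (restrict_space borel {a..b} \<Otimes>\<^sub>M M)"
  shows "case_prod f \<in> borel_measurable (restrict_space lborel {a..b} \<Otimes>\<^sub>M M)"
    and "(\<integral>\<^sup>+s\<in>{a..b}. (\<integral>\<^sup>+\<omega>. ennreal ((norm (f s \<omega>))\<^sup>2) \<partial>M) \<partial>lborel) =
      (\<integral>\<^sup>+p. ennreal ((norm (case_prod f p))\<^sup>2) \<partial>(restrict_space lborel {a..b} \<Otimes>\<^sub>M M))"
proof -
  have "sets (restrict_space lborel {a..b} \<Otimes>\<^sub>M M) = sets (restrict_space borel {a..b} \<Otimes>\<^sub>M M)"
    by (intro sets_pair_measure_cong sets_restrict_space_cong) auto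
  then show "case_prod f \<in> borel_measurable (restrict_space lborel {a..b} \<Otimes>\<^sub>M M)"
    using f measurable_cong_sets by blast
  show "(\<integral>\<^sup>+s\<in>{a..b}. (\<integral>\<^sup>+\<omega>. ennreal ((norm (f s \<omega>))\<^sup>2) \<partial>M) \<partial>lborel) =
      (\<integral>\<^sup>+p. ennreal ((norm (case_prod f p))\<^sup>2) \<partial>(restrict_space lborel {a..b} \<Otimes>\<^sub>M M))"
    using nn_integral_iterated_restrict[of "{a..b}" "\<lambda>p. ennreal ((norm (case_prod f p))\<^sup>2)"] f by simp
qed

lemma measurable_process_diff:
  fixes f g :: "real \<Rightarrow> 'a \<Rightarrow> 'b::{real_normed_vector, second_countable_topology}"
  assumes "case_prod f \<in> borel_measurable N" "case_prod g \<in> borel_measurable N"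
  shows "case_prod (\<lambda>s \<omega>. f s \<omega> - g s \<omega>) \<in> borel_measurable N"
  using borel_measurable_diff[OF assms] by (simp add: case_prod_beta)

lemma L2_adapted_joint:
  assumes "Z \<in> L2_adapted P F T" "0 \<le> a" "b \<le> T"
  shows "case_prod Z \<in> borel_measurable (restrict_space borel {a..b} \<Otimes>\<^sub>M P)"
  by (rule measurable_restrict_process[where B="{0..T}"])
    (use assms in \<open>auto simp: L2_adapted_def adapted_process_def\<close>)

text \<open>The mesh is shifted by \<open>r\<close>; \<open>mesh a d r i\<close> is its \<open>i\<close>-th node, and the node with index 0 lies to
  the left of \<open>a\<close>, where the extended process vanishes.\<close>

definition mesh :: "real \<Rightarrow> real \<Rightarrow> real \<Rightarrow> nat \<Rightarrow> real" where
  "mesh a d r i = a + (real i - 1) * d + r"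

lemma mesh_Suc: "mesh a d r (Suc i) = mesh a d r i + d"
  by (simp add: mesh_def algebra_simps)

lemma mesh_mono: "0 \<le> d \<Longrightarrow> i \<le> j \<Longrightarrow> mesh a d r i \<le> mesh a d r j"
  by (auto simp: mesh_def intro!: mult_right_mono)

lemma mesh_interval_exists:
  assumes "mesh a d r 0 < t" "t \<le> mesh a d r (Suc N)"
  obtains i where "i \<le> N" "mesh a d r i < t" "t \<le> mesh a d r (Suc i)"
proof -
  define n where "n = (LEAST n. t \<le> mesh a d r n)"
  have n: "t \<le> mesh a d r n" unfolding n_def by (rule LeastI[of _ "Suc N"]) (rule assms)
  have le: "n \<le> Suc N" unfolding n_def by (rule Least_le) (rule assms)
  obtain i where i: "n = Suc i" using n assms(1) by (cases n) auto
  have "\<not> t \<le> mesh a d r i" using not_less_Least[of i "\<lambda>n. t \<le> mesh a d r n"] i by (simp add: n_def)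
  then show ?thesis using that[of i] i n le by auto
qed

context brownian
begin

text \<open>The partition \<open>\<tau>\<close> is clamped to \<open>{a..b}\<close>, but values are
  sampled from the extended process at the unclamped nodes: a node left of \<open>a\<close> gives 0,
  which is known at time \<open>a\<close>. Because of the shift, the \<open>N\<close> steps that
  fill \<open>{a..b}\<close> need one interval more.\<close>

lemma shifted_mesh_integrand:
  fixes X :: "real \<Rightarrow> 'a \<Rightarrow> real^'d^'m"
  assumes ab: "0 \<le> a" "a < b" "b \<le> T"
    and adapted: "\<And>t. t \<in> {0..T} \<Longrightarrow> X t \<in> borel_measurable (F t)"
    and bounded: "\<And>t \<omega>. t \<in> {0..T} \<Longrightarrow> \<omega> \<in> space P \<Longrightarrow> norm (X t \<omega>) \<le> C"
    and d: "0 < d" "real N * d = b - a" and r: "0 \<le> r" "r < d"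
  defines "Y \<equiv> \<lambda>t \<omega>. indicator {a..b} t *\<^sub>R X t \<omega>"
  defines "\<tau> \<equiv> \<lambda>i. max a (min b (mesh a d r i))" and "\<xi> \<equiv> \<lambda>i. Y (mesh a d r i)"
  shows "simple_integrand P F a b (Suc N) \<tau> \<xi>"
    and "\<And>t. t \<in> {a..b} \<Longrightarrow> \<exists>i\<le>N. mesh a d r i < t \<and> t \<le> mesh a d r i + d \<and>
      (\<forall>\<omega>. simple_process (Suc N) \<tau> \<xi> t \<omega> = Y (mesh a d r i) \<omega>)"
proof -
  let ?u = "mesh a d r"
  have u0: "?u 0 < a" using r by (simp add: mesh_def)
  have u1: "a \<le> ?u (Suc i)" for i using d r by (simp add: mesh_def)
  have uN: "b \<le> ?u (Suc N)" using d r by (simp add: mesh_def)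
  have mono: "?u i \<le> ?u j" if "i \<le> j" for i j using mesh_mono[of d i j a r] that d by simp
  show "simple_integrand P F a b (Suc N) \<tau> \<xi>"
    unfolding simple_integrand_def
  proof (intro conjI allI impI)
    show "\<tau> 0 = a" using u0 by (simp add: \<tau>_def)
    show "\<tau> (Suc N) = b" using uN ab by (simp add: \<tau>_def)
    fix i
    show "\<tau> i \<le> \<tau> (Suc i)" using mono[of i "Suc i"] by (auto simp: \<tau>_def)
    show "\<xi> i \<in> borel_measurable (F (\<tau> i))"
    proof (cases "?u i \<in> {a..b}")
      case True
      then have "X (?u i) \<in> borel_measurable (F (?u i))" "\<tau> i = ?u i"
        using ab by (auto simp: \<tau>_def intro: adapted)
      then show ?thesis using True by (simp add: \<xi>_def Y_def)
    next
      case False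
      then have "\<xi> i = (\<lambda>\<omega>. 0)" by (auto simp: \<xi>_def Y_def)
      then show ?thesis by simp
    qed
    show "\<exists>C. \<forall>\<omega>\<in>space P. norm (\<xi> i \<omega>) \<le> C"
    proof (intro exI ballI)
      fix \<omega> assume "\<omega> \<in> space P"
      then show "norm (\<xi> i \<omega>) \<le> max 0 C"
        using bounded[of "?u i" \<omega>] ab by (auto simp: \<xi>_def Y_def indicator_def)
    qed
  qed
  fix t assume t: "t \<in> {a..b}"
  obtain i where i: "i \<le> N" "?u i < t" "t \<le> ?u (Suc i)"
    using mesh_interval_exists[of a d r t N] u0 uN t by auto
  have "simple_process (Suc N) \<tau> \<xi> t \<omega> = Y (?u i) \<omega>" for \<omega>
  proof -
    have "simple_process (Suc N) \<tau> \<xi> t \<omega> = (\<Sum>j<Suc N. if j = i then Y (?u i) \<omega> else 0)"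
      unfolding simple_process_def
    proof (rule sum.cong[OF refl])
      fix j assume "j \<in> {..<Suc N}"
      show "indicator {\<tau> j<..\<tau> (Suc j)} t *\<^sub>R \<xi> j \<omega> = (if j = i then Y (?u i) \<omega> else 0)"
      proof (cases "j = i")
        case True
        show ?thesis
        \<comment> \<open>The first clamped interval excludes its left end \<open>a\<close>. The
          mesh interval containing \<open>a\<close> starts further left, so the sampled value is 0
          and both sides agree.\<close>
        proof (cases "t = a")
          case True
          then have "i = 0" using i(2) u1[of "i - 1"] by (cases i) auto
          then have "Y (?u i) \<omega> = 0" using u0 by (simp add: Y_def)
          then show ?thesis using \<open>j = i\<close> by (simp add: \<xi>_def)
        next
          case False
          then have "t \<in> {\<tau> i<..\<tau> (Suc i)}" using t i by (auto simp: \<tau>_def)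
          then show ?thesis using \<open>j = i\<close> by (simp add: \<xi>_def)
        qed
      next
        case False
        have "t \<notin> {\<tau> j<..\<tau> (Suc j)}"
        proof
          assume "t \<in> {\<tau> j<..\<tau> (Suc j)}"
          then have "?u j < t" "t \<le> ?u (Suc j)" using t by (auto simp: \<tau>_def min_def max_def split: if_splits)
          then have "\<not> Suc j \<le> i" "\<not> Suc i \<le> j"
            using i mono[of "Suc j" i] mono[of "Suc i" j] by linarith+
          then show False using False by simp
        qed
        then show ?thesis using False by simp
      qed
    qed
    also have "\<dots> = Y (?u i) \<omega>" using i(1) by simp
    finally show ?thesis .
  qed
  then show "\<exists>i\<le>N. ?u i < t \<and> t \<le> ?u i + d \<and> (\<forall>\<omega>. simple_process (Suc N) \<tau> \<xi> t \<omega> = Y (?u i) \<omega>)"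
    using i by (auto simp: mesh_Suc intro!: exI[of _ i])
qed

end

text \<open>For a bounded process the square is at most \<open>2 * C\<close> times the norm, so
  continuity of translations in L1, applied path by path, suffices; boundedness and the compact time
  window give the domination for the outer integral.\<close>

lemma (in finite_measure) translation_mean_square_small:
  fixes Y :: "real \<Rightarrow> 'a \<Rightarrow> 'b::euclidean_space"
  assumes meas [measurable]: "(\<lambda>p. Y (fst p) (snd p)) \<in> borel_measurable (borel \<Otimes>\<^sub>M M)"
    and bounded: "\<And>t \<omega>. \<omega> \<in> space M \<Longrightarrow> norm (Y t \<omega>) \<le> C"
    and supp: "\<And>t \<omega>. t \<notin> {a..b} \<Longrightarrow> Y t \<omega> = 0"
    and "a \<le> b" "0 \<le> C" "0 < e"
  obtains d where "0 < d"
    "\<And>h. 0 < h \<Longrightarrow> h \<le> d \<Longrightarrow>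
      (\<integral>\<^sup>+\<omega>. (\<integral>\<^sup>+t. ennreal ((norm (Y (t + h) \<omega> - Y t \<omega>))\<^sup>2) \<partial>lborel) \<partial>M) \<le> ennreal e"
proof -
  let ?G = "\<lambda>h. \<integral>\<^sup>+\<omega>. (\<integral>\<^sup>+t. ennreal ((norm (Y (t + h) \<omega> - Y t \<omega>))\<^sup>2) \<partial>lborel) \<partial>M"
  have Y_meas [measurable]: "(\<lambda>p. Y (snd p + h) (fst p)) \<in> borel_measurable (M \<Otimes>\<^sub>M lborel)" for h
    using measurable_compose[of "\<lambda>p. (snd p + h, fst p)" "M \<Otimes>\<^sub>M lborel" "borel \<Otimes>\<^sub>M M", OF _ meas] by simp
  note Y_meas0 [measurable] = Y_meas[of 0, simplified]
  have "\<exists>d>0. \<forall>h. 0 < h \<longrightarrow> h \<le> d \<longrightarrow> ?G h \<le> ennreal e"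
  proof (rule ccontr)
    assume contra: "\<not> ?thesis"
    \<comment> \<open>If the claim failed, there would be steps \<open>h n\<close> tending to 0 with
      large errors; dominated convergence applies to such a sequence.\<close>
    have ex: "\<forall>n. \<exists>h. 0 < h \<and> h \<le> 1 / real (Suc n) \<and> ennreal e < ?G h"
    proof
      fix n
      have "0 < 1 / real (Suc n)" by simp
      then show "\<exists>h. 0 < h \<and> h \<le> 1 / real (Suc n) \<and> ennreal e < ?G h"
        using contra unfolding not_less[symmetric] by blast
    qed
    from choice[OF ex] obtain h
      where "\<forall>n. 0 < h n \<and> h n \<le> 1 / real (Suc n) \<and> ennreal e < ?G (h n)" ..
    then have h: "\<And>n. 0 < h n" "\<And>n. h n \<le> 1 / real (Suc n)" "\<And>n. ennreal e < ?G (h n)"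
      by blast+
    have lim: "(\<lambda>n. 1 / real (Suc n)) \<longlonglongrightarrow> 0" by (intro LIMSEQ_Suc lim_1_over_n)
    have h0: "h \<longlonglongrightarrow> 0"
      by (rule tendsto_sandwich[OF _ _ tendsto_const lim]) (intro always_eventually allI less_imp_le[OF h(1)] h(2))+
    have h1: "h n \<le> 1" for n using h(2)[of n] by (rule order.trans) simp
    let ?q = "\<lambda>n \<omega>. \<integral>\<^sup>+t. ennreal (norm (Y (t + h n) \<omega> - Y t \<omega>)) \<partial>lborel"
    \<comment> \<open>As \<open>h n \<le> 1\<close>, the translated process vanishes outside the
      fixed window \<open>{a - 1..b + 1}\<close>.\<close>
    have bound: "ennreal (norm (Y (t + h n) \<omega> - Y t \<omega>)) \<le> ennreal (2 * C) * indicator {a - 1..b + 1} t"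
      if "\<omega> \<in> space M" for t n \<omega>
    proof (cases "t \<in> {a - 1..b + 1}")
      case True
      have "norm (Y (t + h n) \<omega> - Y t \<omega>) \<le> C + C"
        using norm_triangle_ineq4[of "Y (t + h n) \<omega>" "Y t \<omega>"] bounded[OF that, of t] bounded[OF that, of "t + h n"]
        by linarith
      then show ?thesis using True by (auto intro!: ennreal_leI)
    next
      case False
      then have "t \<notin> {a..b}" "t + h n \<notin> {a..b}" using h1[of n] h(1)[of n] by auto
      then show ?thesis using supp by simp
    qed
    have "(\<lambda>n. \<integral>\<^sup>+\<omega>. ?q n \<omega> \<partial>M) \<longlonglongrightarrow> (\<integral>\<^sup>+\<omega>. 0 \<partial>M)"
    proof (rule nn_integral_dominated_convergence[where w="\<lambda>_. ennreal (2 * C) * ennreal (b - a + 2)"])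
      show "AE \<omega> in M. ?q n \<omega> \<le> ennreal (2 * C) * ennreal (b - a + 2)" for n
      proof (intro AE_I2)
        fix \<omega> assume \<omega>: "\<omega> \<in> space M"
        have "?q n \<omega> \<le> (\<integral>\<^sup>+t. ennreal (2 * C) * indicator {a - 1..b + 1} t \<partial>lborel)"
          by (intro nn_integral_mono bound \<omega>)
        also have "\<dots> = ennreal (2 * C) * ennreal (b - a + 2)"
          using \<open>a \<le> b\<close> by (simp add: nn_integral_cmult_indicator add.commute)
        finally show "?q n \<omega> \<le> ennreal (2 * C) * ennreal (b - a + 2)" .
      qed
      show "(\<integral>\<^sup>+\<omega>. ennreal (2 * C) * ennreal (b - a + 2) \<partial>M) < \<infinity>"
        using emeasure_finite[of "space M"] by (simp add: less_top[symmetric] ennreal_mult_eq_top_iff)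
      show "AE \<omega> in M. (\<lambda>n. ?q n \<omega>) \<longlonglongrightarrow> 0"
      proof (intro AE_I2)
        fix \<omega> assume \<omega>: "\<omega> \<in> space M"
        have [measurable]: "(\<lambda>t. Y t \<omega>) \<in> borel_measurable borel"
          using measurable_compose[OF measurable_Pair2'[OF \<omega>] meas] by simp
        have "integrable lborel (\<lambda>t. Y t \<omega>)"
        proof (rule Bochner_Integration.integrable_bound)
          show "integrable lborel (\<lambda>t. C * indicat_real {a..b} t)"
            by (intro integrable_mult_right integrable_real_indicator) (auto simp: emeasure_lborel_Icc_eq)
          show "AE t in lborel. norm (Y t \<omega>) \<le> norm (C * indicat_real {a..b} t)"
            using bounded[OF \<omega>] supp \<open>0 \<le> C\<close> by (auto simp: indicator_def)
        qed simp
        note int = this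
        have "(\<lambda>n. ennreal (\<integral>t. norm (Y (t + h n) \<omega> - Y t \<omega>) \<partial>lborel)) \<longlonglongrightarrow> ennreal 0"
          by (intro tendsto_ennrealI translation_L1_tendsto int h0)
        moreover have "?q n \<omega> = ennreal (\<integral>t. norm (Y (t + h n) \<omega> - Y t \<omega>) \<partial>lborel)" for n
          using int integral_translation(1)[of "\<lambda>t. Y t \<omega>" "h n"]
          by (intro nn_integral_eq_integral) auto
        ultimately show "(\<lambda>n. ?q n \<omega>) \<longlonglongrightarrow> 0" by simp
      qed
    qed measurable
    from ennreal_tendsto_cmult[OF _ this, of "ennreal (2 * C)"]
    have "(\<lambda>n. ennreal (2 * C) * (\<integral>\<^sup>+\<omega>. ?q n \<omega> \<partial>M)) \<longlonglongrightarrow> 0" by simp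
    then have "\<forall>\<^sub>F n in sequentially. ennreal (2 * C) * (\<integral>\<^sup>+\<omega>. ?q n \<omega> \<partial>M) < ennreal e"
      using \<open>0 < e\<close> by (intro order_tendstoD(2)[of _ 0]) auto
    then obtain n where n: "ennreal (2 * C) * (\<integral>\<^sup>+\<omega>. ?q n \<omega> \<partial>M) < ennreal e"
      by (auto simp: eventually_sequentially)
    have "?G (h n) \<le> (\<integral>\<^sup>+\<omega>. (\<integral>\<^sup>+t. ennreal (2 * C) * ennreal (norm (Y (t + h n) \<omega> - Y t \<omega>)) \<partial>lborel) \<partial>M)"
    proof (intro nn_integral_mono)
      fix \<omega> t assume \<omega>: "\<omega> \<in> space M"
      have "norm (Y (t + h n) \<omega> - Y t \<omega>) \<le> 2 * C"
        using norm_triangle_ineq4[of "Y (t + h n) \<omega>" "Y t \<omega>"] bounded[OF \<omega>, of t] bounded[OF \<omega>, of "t + h n"]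
        by linarith
      then have "(norm (Y (t + h n) \<omega> - Y t \<omega>))\<^sup>2 \<le> 2 * C * norm (Y (t + h n) \<omega> - Y t \<omega>)"
        unfolding power2_eq_square by (intro mult_right_mono) auto
      then show "ennreal ((norm (Y (t + h n) \<omega> - Y t \<omega>))\<^sup>2) \<le> ennreal (2 * C) * ennreal (norm (Y (t + h n) \<omega> - Y t \<omega>))"
        using \<open>0 \<le> C\<close> by (subst ennreal_mult[symmetric]) (auto intro: ennreal_leI)
    qed
    also have "\<dots> = (\<integral>\<^sup>+\<omega>. ennreal (2 * C) * ?q n \<omega> \<partial>M)"
    proof (rule nn_integral_cong)
      fix \<omega> assume \<omega>: "\<omega> \<in> space M"
      have [measurable]: "(\<lambda>t. Y t \<omega>) \<in> borel_measurable borel"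
        using measurable_compose[OF measurable_Pair2'[OF \<omega>] meas] by simp
      show "(\<integral>\<^sup>+t. ennreal (2 * C) * ennreal (norm (Y (t + h n) \<omega> - Y t \<omega>)) \<partial>lborel) = ennreal (2 * C) * ?q n \<omega>"
        by (intro nn_integral_cmult) measurable
    qed
    also have "\<dots> = ennreal (2 * C) * (\<integral>\<^sup>+\<omega>. ?q n \<omega> \<partial>M)"
      by (intro nn_integral_cmult) measurable
    finally have "ennreal e < ennreal e" using h(3)[of n] n by (meson order.strict_trans1 order.strict_trans)
    then show False by simp
  qed
  then show ?thesis using that by blast
qed

text \<open>As the shift \<open>r\<close> runs through \<open>{0..<d}\<close>, the nodes run once
  through disjoint intervals. After an exchange of integrals, the total error over all shifts is
  therefore at most the integral of the translation errors over steps \<open>h\<close> up to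
  \<open>d\<close>, which is at most \<open>e * d\<close>. Some shift does not exceed the
  average.\<close>

lemma mesh_average:
  fixes K :: "real \<Rightarrow> real \<Rightarrow> ennreal"
  assumes K [measurable]: "(\<lambda>p. K (fst p) (snd p)) \<in> borel_measurable (borel \<Otimes>\<^sub>M borel)"
    and le: "\<And>h. 0 < h \<Longrightarrow> h \<le> d \<Longrightarrow> (\<integral>\<^sup>+u. K u (u + h) \<partial>lborel) \<le> ennreal e"
    and "0 < d" "0 \<le> e" "e < e'"
  shows "\<exists>r\<in>{0..<d}. (\<Sum>i\<le>N. \<integral>\<^sup>+t\<in>{mesh a d r i<..mesh a d r i + d}. K (mesh a d r i) t \<partial>lborel) < ennreal e'"
proof (rule ccontr)
  assume contra: "\<not> ?thesis"
  \<comment> \<open>The error of the mesh interval that starts at \<open>u\<close>, written in the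
    step \<open>h = t - u\<close>.\<close>
  define H where "H u = (\<integral>\<^sup>+h. K u (u + h) * indicator {0<..d} h \<partial>lborel)" for u
  have K2 [measurable]: "(\<lambda>p. K (fst p) (fst p + snd p)) \<in> borel_measurable (lborel \<Otimes>\<^sub>M lborel)"
    using measurable_compose[of "\<lambda>p. (fst p, fst p + snd p)" "lborel \<Otimes>\<^sub>M lborel" "borel \<Otimes>\<^sub>M borel", OF _ K] by simp
  have H [measurable]: "H \<in> borel_measurable borel"
    unfolding H_def measurable_lborel1[symmetric] using K2
    by (intro lborel.borel_measurable_nn_integral) (simp add: case_prod_beta)
  have shift: "(\<integral>\<^sup>+t\<in>{u<..u + d}. K u t \<partial>lborel) = H u" for u
  proof -
    have [measurable]: "K u \<in> borel_measurable borel"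
      using measurable_compose[OF measurable_Pair1'[of u borel borel] K] by simp
    show ?thesis
      unfolding H_def by (subst nn_integral_real_affine[where c=1 and t=u])
        (auto intro!: nn_integral_cong split: split_indicator)
  qed
  let ?c = "\<lambda>i. a + (real i - 1) * d"
  \<comment> \<open>If every shift failed, the integral over \<open>r\<close> would be at least
    \<open>e' * d\<close>.\<close>
  have "ennreal (e' * d) = (\<integral>\<^sup>+r. ennreal e' * indicator {0..<d} r \<partial>lborel)"
    using \<open>0 < d\<close> \<open>0 \<le> e\<close> \<open>e < e'\<close> by (simp add: nn_integral_cmult_indicator ennreal_mult)
  also have "\<dots> \<le> (\<integral>\<^sup>+r. (\<Sum>i\<le>N. H (?c i + r) * indicator {0..<d} r) \<partial>lborel)"
  proof (intro nn_integral_mono)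
    fix r
    show "ennreal e' * indicator {0..<d} r \<le> (\<Sum>i\<le>N. H (?c i + r) * indicator {0..<d} r)"
    proof (cases "r \<in> {0..<d}")
      case True
      then have "ennreal e' \<le> (\<Sum>i\<le>N. H (?c i + r))"
        using contra unfolding shift mesh_def by (simp add: not_less)
      then show ?thesis using True by simp
    qed simp
  qed
  also have "\<dots> = (\<Sum>i\<le>N. \<integral>\<^sup>+r. H (?c i + r) * indicator {0..<d} r \<partial>lborel)"
    by (intro nn_integral_sum) measurable
  also have "\<dots> = (\<Sum>i\<le>N. \<integral>\<^sup>+u. H u * indicator {?c i..<?c i + d} u \<partial>lborel)"
  proof (intro sum.cong refl)
    fix i
    show "(\<integral>\<^sup>+r. H (?c i + r) * indicator {0..<d} r \<partial>lborel) = (\<integral>\<^sup>+u. H u * indicator {?c i..<?c i + d} u \<partial>lborel)"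
      by (subst (2) nn_integral_real_affine[where c=1 and t="?c i"])
        (auto intro!: nn_integral_cong split: split_indicator)
  qed
  also have "\<dots> = (\<integral>\<^sup>+u. (\<Sum>i\<le>N. H u * indicator {?c i..<?c i + d} u) \<partial>lborel)"
    by (intro nn_integral_sum[symmetric]) measurable
  also have "\<dots> \<le> (\<integral>\<^sup>+u. H u \<partial>lborel)"
  proof (intro nn_integral_mono)
    fix u
    have disj: "disjoint_family_on (\<lambda>i. {?c i..<?c i + d}) {..N}"
    proof (unfold disjoint_family_on_def, intro ballI impI)
      fix i j :: nat assume "i \<noteq> j"
      have "?c i + d \<le> ?c j" if "i < j" for i j :: nat
      proof -
        have "(real i - 1 + 1) * d \<le> (real j - 1) * d"
          using that \<open>0 < d\<close> by (intro mult_right_mono) auto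
        then show ?thesis by (simp add: algebra_simps)
      qed
      from this[of i j] this[of j i] show "{?c i..<?c i + d} \<inter> {?c j..<?c j + d} = {}"
        using \<open>i \<noteq> j\<close> by (cases "i < j") (auto simp: not_less)
    qed
    have "(\<Sum>i\<le>N. H u * indicator {?c i..<?c i + d} u) = H u * (\<Sum>i\<le>N. indicator {?c i..<?c i + d} u)"
      by (simp add: sum_distrib_left)
    also have "(\<Sum>i\<le>N. indicator {?c i..<?c i + d} u) = (indicator (\<Union>i\<le>N. {?c i..<?c i + d}) u :: ennreal)"
      by (rule indicator_UN_disjoint[OF _ disj, symmetric]) simp
    also have "H u * \<dots> \<le> H u * 1"
      by (intro mult_left_mono) (auto split: split_indicator)
    finally show "(\<Sum>i\<le>N. H u * indicator {?c i..<?c i + d} u) \<le> H u" by simp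
  qed
  \<comment> \<open>For a fixed step \<open>h\<close> the inner integral is now the translation
    error that the hypothesis bounds.\<close>
  also have "\<dots> = (\<integral>\<^sup>+h. (\<integral>\<^sup>+u. K u (u + h) * indicator {0<..d} h \<partial>lborel) \<partial>lborel)"
    unfolding H_def by (rule lborel_pair.Fubini'[symmetric]) measurable
  also have "\<dots> \<le> (\<integral>\<^sup>+h. ennreal e * indicator {0<..d} h \<partial>lborel)"
    using le by (intro nn_integral_mono) (auto split: split_indicator)
  also have "\<dots> = ennreal (e * d)"
    using \<open>0 < d\<close> \<open>0 \<le> e\<close> by (simp add: nn_integral_cmult_indicator ennreal_mult)
  finally show False
    using \<open>0 < d\<close> \<open>0 \<le> e\<close> \<open>e < e'\<close> by (simp add: mult_le_cancel_right)
qed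

context brownian
begin

text \<open>Sampling uses the process only at the nodes, where adaptedness gives the measurability
  that a simple integrand demands. The error at time \<open>s\<close> is the kernel \<open>K\<close>
  between the node and \<open>s\<close>, so averaging over the shift applies.\<close>

lemma bounded_simple_approx:
  fixes X :: "real \<Rightarrow> 'a \<Rightarrow> real^'d^'m"
  assumes ab: "0 \<le> a" "a < b" "b \<le> T"
    and X: "adapted_process P F T X"
    and bounded: "\<And>t \<omega>. t \<in> {0..T} \<Longrightarrow> \<omega> \<in> space P \<Longrightarrow> norm (X t \<omega>) \<le> C"
    and "0 < e"
  shows "\<exists>k \<tau> \<xi>. simple_integrand P F a b k \<tau> \<xi> \<and>
    (\<integral>\<^sup>+s\<in>{a..b}. (\<integral>\<^sup>+\<omega>. ennreal ((norm (X s \<omega> - simple_process k \<tau> \<xi> s \<omega>))\<^sup>2) \<partial>P) \<partial>lborel) < ennreal e"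
proof -
  define Y where "Y t \<omega> = indicator {a..b} t *\<^sub>R X t \<omega>" for t \<omega>
  have adapted: "\<And>t. t \<in> {0..T} \<Longrightarrow> X t \<in> borel_measurable (F t)"
    using X by (simp add: adapted_process_def)
  have joint: "(\<lambda>(t, \<omega>). X t \<omega>) \<in> borel_measurable (restrict_space borel {a..b} \<Otimes>\<^sub>M P)"
    by (rule measurable_restrict_process[where B="{0..T}"]) (use X ab in \<open>auto simp: adapted_process_def\<close>)
  have Y [measurable]: "(\<lambda>p. Y (fst p) (snd p)) \<in> borel_measurable (borel \<Otimes>\<^sub>M P)"
    unfolding Y_def by (rule measurable_process_extend[OF joint])
  have Y_bounded: "norm (Y t \<omega>) \<le> max 0 C" if "\<omega> \<in> space P" for t \<omega>
    using bounded[OF _ that, of t] ab by (auto simp: Y_def indicator_def)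
  obtain d where d: "0 < d" "\<And>h. 0 < h \<Longrightarrow> h \<le> d \<Longrightarrow>
      (\<integral>\<^sup>+\<omega>. (\<integral>\<^sup>+t. ennreal ((norm (Y (t + h) \<omega> - Y t \<omega>))\<^sup>2) \<partial>lborel) \<partial>P) \<le> ennreal (e / 2)"
    using translation_mean_square_small[OF Y Y_bounded, of a b "e / 2"] ab \<open>0 < e\<close>
    by (auto simp: Y_def)
  define K where "K u t = (\<integral>\<^sup>+\<omega>. ennreal ((norm (Y t \<omega> - Y u \<omega>))\<^sup>2) \<partial>P)" for u t
  have Y1 [measurable]: "(\<lambda>p. Y (fst (fst p)) (snd p)) \<in> borel_measurable ((borel \<Otimes>\<^sub>M borel) \<Otimes>\<^sub>M P)"
    using measurable_compose[of "\<lambda>p. (fst (fst p), snd p)" "(borel \<Otimes>\<^sub>M borel) \<Otimes>\<^sub>M P" "borel \<Otimes>\<^sub>M P", OF _ Y] by simp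
  have Y2 [measurable]: "(\<lambda>p. Y (snd (fst p)) (snd p)) \<in> borel_measurable ((borel \<Otimes>\<^sub>M borel) \<Otimes>\<^sub>M P)"
    using measurable_compose[of "\<lambda>p. (snd (fst p), snd p)" "(borel \<Otimes>\<^sub>M borel) \<Otimes>\<^sub>M P" "borel \<Otimes>\<^sub>M P", OF _ Y] by simp
  have K: "(\<lambda>p. K (fst p) (snd p)) \<in> borel_measurable (borel \<Otimes>\<^sub>M borel)"
    unfolding K_def by (intro borel_measurable_nn_integral) (simp add: case_prod_beta)
  \<comment> \<open>Enough steps to bring the mesh size below \<open>d\<close>; then
    \<open>d'\<close> is taken to divide \<open>b - a\<close> exactly.\<close>
  define N where "N = nat \<lceil>(b - a) / d\<rceil>"
  have "0 < (b - a) / d" using ab d(1) by simp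
  then have N: "0 < N" "(b - a) / d \<le> real N" unfolding N_def by linarith+
  define d' where "d' = (b - a) / real N"
  have d': "0 < d'" "real N * d' = b - a" "d' \<le> d"
    using N ab d(1) by (auto simp: d'_def field_simps)
  have K_le: "(\<integral>\<^sup>+u. K u (u + h) \<partial>lborel) \<le> ennreal (e / 2)" if "0 < h" "h \<le> d'" for h
  proof -
    have Yh: "(\<lambda>p. Y (fst p + h) (snd p)) \<in> borel_measurable (lborel \<Otimes>\<^sub>M P)"
      using measurable_compose[of "\<lambda>p. (fst p + h, snd p)" "lborel \<Otimes>\<^sub>M P" "borel \<Otimes>\<^sub>M P", OF _ Y] by simp
    have Y0: "(\<lambda>p. Y (fst p) (snd p)) \<in> borel_measurable (lborel \<Otimes>\<^sub>M P)"
      using measurable_compose[of "\<lambda>p. (fst p, snd p)" "lborel \<Otimes>\<^sub>M P" "borel \<Otimes>\<^sub>M P", OF _ Y] by simp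
    interpret pair_sigma_finite lborel P ..
    have "(\<integral>\<^sup>+u. K u (u + h) \<partial>lborel) = (\<integral>\<^sup>+\<omega>. (\<integral>\<^sup>+u. ennreal ((norm (Y (u + h) \<omega> - Y u \<omega>))\<^sup>2) \<partial>lborel) \<partial>P)"
      unfolding K_def using Yh Y0 by (intro Fubini'[symmetric]) (simp add: case_prod_beta)
    also have "\<dots> \<le> ennreal (e / 2)"
      using d(2)[OF that(1)] that(2) d'(3) by simp
    finally show ?thesis .
  qed
  \<comment> \<open>The translation error was bounded by \<open>e / 2\<close>, which leaves the
    strict gap that averaging requires.\<close>
  obtain r where r: "0 \<le> r" "r < d'"
    "(\<Sum>i\<le>N. \<integral>\<^sup>+t\<in>{mesh a d' r i<..mesh a d' r i + d'}. K (mesh a d' r i) t \<partial>lborel) < ennreal e"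
    using mesh_average[OF K K_le d'(1), where a=a and N=N and e'=e] \<open>0 < e\<close> by auto
  define \<tau> where "\<tau> i = max a (min b (mesh a d' r i))" for i
  define \<xi> where "\<xi> i = Y (mesh a d' r i)" for i
  have simple: "simple_integrand P F a b (Suc N) \<tau> \<xi>"
    unfolding \<tau>_def \<xi>_def Y_def
    by (rule shifted_mesh_integrand(1)[where C=C]) (use ab adapted bounded d' r in auto)
  have node: "\<exists>i\<le>N. mesh a d' r i < t \<and> t \<le> mesh a d' r i + d' \<and>
      (\<forall>\<omega>. simple_process (Suc N) \<tau> \<xi> t \<omega> = Y (mesh a d' r i) \<omega>)" if "t \<in> {a..b}" for t
    unfolding \<tau>_def \<xi>_def Y_def
    by (rule shifted_mesh_integrand(2)[where C=C]) (use ab adapted bounded d' r that in auto)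
  have K_meas [measurable]: "K u \<in> borel_measurable borel" for u
    using measurable_compose[OF measurable_Pair1'[of u borel borel] K] by simp
  have "(\<integral>\<^sup>+s\<in>{a..b}. (\<integral>\<^sup>+\<omega>. ennreal ((norm (X s \<omega> - simple_process (Suc N) \<tau> \<xi> s \<omega>))\<^sup>2) \<partial>P) \<partial>lborel)
      \<le> (\<integral>\<^sup>+s. (\<Sum>i\<le>N. K (mesh a d' r i) s * indicator {mesh a d' r i<..mesh a d' r i + d'} s) \<partial>lborel)"
  proof (intro nn_integral_mono)
    fix s
    show "(\<integral>\<^sup>+\<omega>. ennreal ((norm (X s \<omega> - simple_process (Suc N) \<tau> \<xi> s \<omega>))\<^sup>2) \<partial>P) * indicator {a..b} s
      \<le> (\<Sum>i\<le>N. K (mesh a d' r i) s * indicator {mesh a d' r i<..mesh a d' r i + d'} s)"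
    proof (cases "s \<in> {a..b}")
      case True
      obtain i where i: "i \<le> N" "mesh a d' r i < s" "s \<le> mesh a d' r i + d'"
          "\<And>\<omega>. simple_process (Suc N) \<tau> \<xi> s \<omega> = Y (mesh a d' r i) \<omega>"
        using node[OF True] by blast
      have "(\<integral>\<^sup>+\<omega>. ennreal ((norm (X s \<omega> - simple_process (Suc N) \<tau> \<xi> s \<omega>))\<^sup>2) \<partial>P) * indicator {a..b} s
          = K (mesh a d' r i) s * indicator {mesh a d' r i<..mesh a d' r i + d'} s"
        using True i by (simp add: K_def Y_def)
      also have "\<dots> \<le> (\<Sum>i\<le>N. K (mesh a d' r i) s * indicator {mesh a d' r i<..mesh a d' r i + d'} s)"
        by (rule member_le_sum[where f="\<lambda>i. K (mesh a d' r i) s * indicator {mesh a d' r i<..mesh a d' r i + d'} s"])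
          (use i in auto)
      finally show ?thesis .
    qed simp
  qed
  also have "\<dots> = (\<Sum>i\<le>N. \<integral>\<^sup>+t\<in>{mesh a d' r i<..mesh a d' r i + d'}. K (mesh a d' r i) t \<partial>lborel)"
    by (intro nn_integral_sum) measurable
  also note r(3)
  finally show ?thesis using simple by blast
qed

lemma measurable_simple_process:
  fixes \<xi> :: "nat \<Rightarrow> 'a \<Rightarrow> real^'d^'m"
  assumes S: "simple_integrand P F a b k \<tau> \<xi>" and ab: "0 \<le> a" "b \<le> T"
  shows "(\<lambda>(s, \<omega>). simple_process k \<tau> \<xi> s \<omega>) \<in> borel_measurable (restrict_space borel A \<Otimes>\<^sub>M P)"
proof -
  have [measurable]: "fst \<in> borel_measurable (restrict_space borel A \<Otimes>\<^sub>M P)"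
    by (rule measurable_compose[OF measurable_fst measurable_restrict_space1[OF measurable_ident, simplified id_def]])
  have "\<xi> i \<in> borel_measurable P" if "i < k" for i
    using simple_integrand_elementary(1)[OF S ab that]
    by (auto simp: elementary_def intro: measurable_F_P[of "\<tau> i"])
  then have "(\<lambda>p. \<xi> i (snd p)) \<in> borel_measurable (restrict_space borel A \<Otimes>\<^sub>M P)" if "i < k" for i
    using that by (intro measurable_compose[OF measurable_snd])
  then show ?thesis
    unfolding simple_process_def case_prod_beta
    by (intro borel_measurable_sum borel_measurable_scaleR) auto
qed

text \<open>Truncation reduces the claim to bounded processes; its error vanishes by dominated
  convergence, with the square of \<open>X\<close> as majorant.\<close>

lemma simple_approx:
  fixes X :: "real \<Rightarrow> 'a \<Rightarrow> real^'d^'m"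
  assumes ab: "0 \<le> a" "a \<le> b" "b \<le> T" and X: "X \<in> L2_adapted P F T" and "0 < e"
  shows "\<exists>k \<tau> \<xi>. simple_integrand P F a b k \<tau> \<xi> \<and>
    (\<integral>\<^sup>+s\<in>{a..b}. (\<integral>\<^sup>+\<omega>. ennreal ((norm (X s \<omega> - simple_process k \<tau> \<xi> s \<omega>))\<^sup>2) \<partial>P) \<partial>lborel) < ennreal e"
proof (cases "a = b")
  case True
  \<comment> \<open>On an interval of length zero the empty partition works, because a single time
    is a null set.\<close>
  have "AE s in lborel. s \<noteq> a" by (rule AE_lborel_singleton)
  then have "(\<integral>\<^sup>+s\<in>{a..b}. (\<integral>\<^sup>+\<omega>. ennreal ((norm (X s \<omega> - simple_process 0 (\<lambda>_. a) undefined s \<omega>))\<^sup>2) \<partial>P) \<partial>lborel)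
      = (\<integral>\<^sup>+s. 0 \<partial>(lborel :: real measure))"
    using True by (intro nn_integral_cong_AE) (auto elim!: eventually_mono simp: indicator_def)
  moreover have "simple_integrand P F a b 0 (\<lambda>_. a) undefined"
    using True by (simp add: simple_integrand_def)
  ultimately show ?thesis using \<open>0 < e\<close> by (intro exI[of _ 0] exI[of _ "\<lambda>_. a"] exI[of _ undefined]) auto
next
  case False
  then have "a < b" using ab by simp
  let ?Q = "restrict_space lborel {a..b} \<Otimes>\<^sub>M P"
  have adapted: "adapted_process P F T X" using X by (simp add: L2_adapted_def)
  note joint = L2_adapted_joint[OF X ab(1,3)]
  \<comment> \<open>Large values are sent to 0 by a fixed Borel map. This keeps adaptedness and
    joint measurability and leaves an error dominated by \<open>X\<close>.\<close>
  define Z where "Z n t \<omega> = (if norm (X t \<omega>) \<le> real n then X t \<omega> else 0)" for n t \<omega>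
  have Z_adapted: "adapted_process P F T (Z n)" for n
  proof -
    have "(\<lambda>x. if norm x \<le> real n then x else 0 :: real^'d^'m) \<in> borel_measurable borel" by measurable
    then show ?thesis
      using adapted unfolding adapted_process_def Z_def case_prod_beta
      by (auto intro: measurable_compose)
  qed
  have Z_joint: "case_prod (Z n) \<in> borel_measurable (restrict_space borel {a..b} \<Otimes>\<^sub>M P)" for n
    by (rule measurable_restrict_process[where B="{0..T}"]) (use Z_adapted[of n] ab in \<open>auto simp: adapted_process_def\<close>)
  note [measurable] = iterated_norm_sq(1)[OF joint] iterated_norm_sq(1)[OF Z_joint]
  have "(\<integral>\<^sup>+p. ennreal ((norm (case_prod X p))\<^sup>2) \<partial>?Q) \<le>
      (\<integral>\<^sup>+t\<in>{0..T}. (\<integral>\<^sup>+\<omega>. ennreal ((norm (X t \<omega>))\<^sup>2) \<partial>P) \<partial>lborel)"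
    unfolding iterated_norm_sq(2)[OF joint, symmetric] using ab by (intro nn_integral_mono) (auto split: split_indicator)
  also have "\<dots> < \<infinity>" using X by (simp add: L2_adapted_def)
  finally have fin: "(\<integral>\<^sup>+p. ennreal ((norm (case_prod X p))\<^sup>2) \<partial>?Q) < \<infinity>" .
  have "(\<lambda>n. \<integral>\<^sup>+p. ennreal ((norm (case_prod X p - case_prod (Z n) p))\<^sup>2) \<partial>?Q) \<longlonglongrightarrow> (\<integral>\<^sup>+p. 0 \<partial>?Q)"
  proof (rule nn_integral_dominated_convergence[OF _ _ _ _ fin])
    show "AE p in ?Q. ennreal ((norm (case_prod X p - case_prod (Z n) p))\<^sup>2) \<le> ennreal ((norm (case_prod X p))\<^sup>2)" for n
      by (auto simp: Z_def split: prod.splits)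
    show "AE p in ?Q. (\<lambda>n. ennreal ((norm (case_prod X p - case_prod (Z n) p))\<^sup>2)) \<longlonglongrightarrow> 0"
    proof (intro AE_I2)
      fix p
      obtain n0 where n0: "norm (case_prod X p) \<le> real n0" using real_arch_simple by blast
      have "\<forall>\<^sub>F n in sequentially. ennreal ((norm (case_prod X p - case_prod (Z n) p))\<^sup>2) = 0"
        using eventually_ge_at_top[of n0]
      proof eventually_elim
        case (elim n)
        then have "real n0 \<le> real n" by simp
        then show ?case using n0
          by (cases p) (simp add: Z_def)
      qed
      then show "(\<lambda>n. ennreal ((norm (case_prod X p - case_prod (Z n) p))\<^sup>2)) \<longlonglongrightarrow> 0"
        by (rule tendsto_eventually)
    qed
  qed measurable
  \<comment> \<open>Two errors of \<open>e / 8\<close>, each doubled by the weighted inequality, add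
    up to \<open>e / 2\<close>.\<close>
  then have "\<forall>\<^sub>F n in sequentially. (\<integral>\<^sup>+p. ennreal ((norm (case_prod X p - case_prod (Z n) p))\<^sup>2) \<partial>?Q) < ennreal (e / 8)"
    using \<open>0 < e\<close> by (intro order_tendstoD(2)[of _ 0]) auto
  then obtain n where n: "(\<integral>\<^sup>+p. ennreal ((norm (case_prod X p - case_prod (Z n) p))\<^sup>2) \<partial>?Q) < ennreal (e / 8)"
    by (auto simp: eventually_sequentially)
  have "norm (Z n t \<omega>) \<le> real n" for t \<omega> by (simp add: Z_def)
  then obtain k \<tau> \<xi> where S: "simple_integrand P F a b k \<tau> \<xi>"
    and approx: "(\<integral>\<^sup>+s\<in>{a..b}. (\<integral>\<^sup>+\<omega>. ennreal ((norm (Z n s \<omega> - simple_process k \<tau> \<xi> s \<omega>))\<^sup>2) \<partial>P) \<partial>lborel) < ennreal (e / 8)"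
    using bounded_simple_approx[OF ab(1) \<open>a < b\<close> ab(3) Z_adapted, of n "real n" "e / 8"] \<open>0 < e\<close> by auto
  let ?S = "simple_process k \<tau> \<xi>"
  have S_joint: "case_prod ?S \<in> borel_measurable (restrict_space borel {a..b} \<Otimes>\<^sub>M P)"
    by (rule measurable_simple_process[OF S ab(1,3)])
  note [measurable] = iterated_norm_sq(1)[OF S_joint]
  have ZS: "(\<integral>\<^sup>+p. ennreal ((norm (case_prod ?S p - case_prod (Z n) p))\<^sup>2) \<partial>?Q) < ennreal (e / 8)"
  proof -
    from iterated_norm_sq(2)[OF measurable_process_diff[OF S_joint Z_joint[of n]]] approx
    show ?thesis by (simp add: case_prod_beta norm_minus_commute)
  qed
  have "(\<integral>\<^sup>+s\<in>{a..b}. (\<integral>\<^sup>+\<omega>. ennreal ((norm (X s \<omega> - ?S s \<omega>))\<^sup>2) \<partial>P) \<partial>lborel) =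
      (\<integral>\<^sup>+p. ennreal ((norm (case_prod X p - case_prod ?S p))\<^sup>2) \<partial>?Q)"
    using iterated_norm_sq(2)[OF measurable_process_diff[OF joint S_joint]] by (simp add: case_prod_beta)
  also have "\<dots> = (\<integral>\<^sup>+p. ennreal ((norm ((case_prod X p - case_prod (Z n) p) - (case_prod ?S p - case_prod (Z n) p)))\<^sup>2) \<partial>?Q)"
    by simp
  also have "\<dots> \<le> 2 * (\<integral>\<^sup>+p. ennreal ((norm (case_prod X p - case_prod (Z n) p))\<^sup>2) \<partial>?Q) +
      2 * (\<integral>\<^sup>+p. ennreal ((norm (case_prod ?S p - case_prod (Z n) p))\<^sup>2) \<partial>?Q)"
    by (rule nn_integral_norm_sq_diff_le) measurable
  also have "\<dots> \<le> 2 * ennreal (e / 8) + 2 * ennreal (e / 8)"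
    using n ZS by (intro add_mono mult_left_mono) simp_all
  also have "\<dots> = ennreal (e / 2)"
  proof -
    have "2 * ennreal (e / 8) = ennreal (2 * (e / 8))"
      by (subst ennreal_mult') simp_all
    then show ?thesis
      using \<open>0 < e\<close> by (simp only: ennreal_plus[symmetric] less_imp_le divide_nonneg_nonneg mult_nonneg_nonneg zero_le_numeral) simp
  qed
  also have "\<dots> < ennreal e"
    using \<open>0 < e\<close> by (simp add: ennreal_less_iff)
  finally show ?thesis using S by blast
qed

end

section \<open>The Ito integral\<close>

text \<open>Equality of the predicates is more than equality of integrals up to null sets:
  \<open>ito_integral\<close> is picked from the predicate by \<open>SOME\<close>, hence is
  literally the same function for both integrands.\<close>

lemma has_ito_integral_cong:
  assumes "\<And>s. s \<in> {a..b} \<Longrightarrow> AE \<omega> in P. Z s \<omega> = Z' s \<omega>"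
  shows "has_ito_integral P F W a b Z = has_ito_integral P F W a b Z'"
proof -
  have "(\<integral>\<^sup>+s\<in>{a..b}. (\<integral>\<^sup>+\<omega>. ennreal ((norm (Z s \<omega> - S s \<omega>))\<^sup>2) \<partial>P) \<partial>lborel) =
      (\<integral>\<^sup>+s\<in>{a..b}. (\<integral>\<^sup>+\<omega>. ennreal ((norm (Z' s \<omega> - S s \<omega>))\<^sup>2) \<partial>P) \<partial>lborel)" for S
  proof (intro nn_integral_cong)
    fix s
    show "(\<integral>\<^sup>+\<omega>. ennreal ((norm (Z s \<omega> - S s \<omega>))\<^sup>2) \<partial>P) * indicator {a..b} s =
        (\<integral>\<^sup>+\<omega>. ennreal ((norm (Z' s \<omega> - S s \<omega>))\<^sup>2) \<partial>P) * indicator {a..b} s"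
    proof (cases "s \<in> {a..b}")
      case True
      have "(\<integral>\<^sup>+\<omega>. ennreal ((norm (Z s \<omega> - S s \<omega>))\<^sup>2) \<partial>P) = (\<integral>\<^sup>+\<omega>. ennreal ((norm (Z' s \<omega> - S s \<omega>))\<^sup>2) \<partial>P)"
        using assms[OF True] by (intro nn_integral_cong_AE) auto
      then show ?thesis by simp
    qed simp
  qed
  then show ?thesis unfolding has_ito_integral_def fun_eq_iff by simp
qed

context brownian
begin

lemma simple_integral_measurable:
  fixes \<xi> :: "nat \<Rightarrow> 'a \<Rightarrow> real^'d^'m"
  assumes S: "simple_integrand P F a b k \<tau> \<xi>" and ab: "0 \<le> a" "b \<le> T"
  shows "simple_integral W k \<tau> \<xi> \<in> borel_measurable P"
proof -
  have "(\<lambda>\<omega>. \<Sum>i<k. elementary_integral (\<tau> i) (\<tau> (Suc i)) (\<xi> i) \<omega>) \<in> borel_measurable P"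
    using simple_integrand_elementary(1)[OF S ab]
    by (intro borel_measurable_sum elementary_integral_measurable_P) auto
  then show ?thesis
    by (simp add: simple_integral_def[abs_def] elementary_integral_def)
qed

text \<open>The isometry with \<open>\<eta> = 0\<close> turns the Cauchy property of the
  approximating processes into that of their integrals, and completeness of L2 provides the
  limit.\<close>

lemma has_ito_integral_exists:
  fixes Z :: "real \<Rightarrow> 'a \<Rightarrow> real^'d^'m"
  assumes Z: "Z \<in> L2_adapted P F T" and ab: "0 \<le> a" "a \<le> b" "b \<le> T"
  shows "\<exists>I. has_ito_integral P F W a b Z I"
proof -
  let ?Q = "restrict_space lborel {a..b} \<Otimes>\<^sub>M P"
  \<comment> \<open>The errors decay at the rate that \<open>L2_limit_exists\<close> asks
    for.\<close>
  have "\<forall>n. \<exists>k \<tau> \<xi>. simple_integrand P F a b k \<tau> \<xi> \<and>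
    (\<integral>\<^sup>+s\<in>{a..b}. (\<integral>\<^sup>+\<omega>. ennreal ((norm (Z s \<omega> - simple_process k \<tau> \<xi> s \<omega>))\<^sup>2) \<partial>P) \<partial>lborel) < ennreal ((1/4)^n)"
    by (intro allI simple_approx[OF ab Z]) simp
  then obtain k \<tau> \<xi> where S: "\<And>n::nat. simple_integrand P F a b (k n) (\<tau> n) (\<xi> n)"
    and less: "\<And>n. (\<integral>\<^sup>+s\<in>{a..b}. (\<integral>\<^sup>+\<omega>. ennreal ((norm (Z s \<omega> - simple_process (k n) (\<tau> n) (\<xi> n) s \<omega>))\<^sup>2) \<partial>P) \<partial>lborel)
      < ennreal ((1/4)^n)"
    unfolding choice_iff by blast
  let ?S = "\<lambda>n. simple_process (k n) (\<tau> n) (\<xi> n)" and ?J = "\<lambda>n. simple_integral W (k n) (\<tau> n) (\<xi> n)"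
  note Z_joint = L2_adapted_joint[OF Z ab(1,3)]
  note S_joint = measurable_simple_process[OF S ab(1,3)]
  have Q: "case_prod (\<lambda>s \<omega>. Z s \<omega> - ?S n s \<omega>) \<in> borel_measurable ?Q"
    "(\<integral>\<^sup>+p. ennreal ((norm (case_prod (\<lambda>s \<omega>. Z s \<omega> - ?S n s \<omega>) p))\<^sup>2) \<partial>?Q) \<le> ennreal ((1/4)^n)" for n
    using iterated_norm_sq[OF measurable_process_diff[OF Z_joint S_joint]] less[of n] by simp_all
  have "(\<integral>\<^sup>+\<omega>. ennreal ((norm (?J m \<omega> - ?J n \<omega>))\<^sup>2) \<partial>P) \<le> ennreal (2 * ((1/4)^m + (1/4)^n))" for m n
  proof -
    have "(\<integral>\<^sup>+\<omega>. ennreal ((norm (?J m \<omega> - ?J n \<omega>))\<^sup>2) \<partial>P) =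
        (\<integral>\<^sup>+s\<in>{a..b}. (\<integral>\<^sup>+\<omega>. ennreal ((norm (?S m s \<omega> - ?S n s \<omega>))\<^sup>2) \<partial>P) \<partial>lborel)"
      using simple_isometry[OF S[of m] S[of n] ab(1) _ ab(3), of "\<lambda>_. 0"] ab by simp
    also have "\<dots> = (\<integral>\<^sup>+p. ennreal ((norm (case_prod (\<lambda>s \<omega>. Z s \<omega> - ?S n s \<omega>) p -
        case_prod (\<lambda>s \<omega>. Z s \<omega> - ?S m s \<omega>) p))\<^sup>2) \<partial>?Q)"
      using iterated_norm_sq(2)[OF measurable_process_diff[OF S_joint S_joint]]
      by (simp add: case_prod_beta)
    also have "\<dots> \<le> 2 * (\<integral>\<^sup>+p. ennreal ((norm (case_prod (\<lambda>s \<omega>. Z s \<omega> - ?S n s \<omega>) p))\<^sup>2) \<partial>?Q) +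
        2 * (\<integral>\<^sup>+p. ennreal ((norm (case_prod (\<lambda>s \<omega>. Z s \<omega> - ?S m s \<omega>) p))\<^sup>2) \<partial>?Q)"
      by (rule nn_integral_norm_sq_diff_le[OF Q(1) Q(1)])
    also have "\<dots> \<le> 2 * ennreal ((1/4)^n) + 2 * ennreal ((1/4)^m)"
      by (intro add_mono mult_left_mono Q(2)) auto
    also have "\<dots> = ennreal (2 * ((1/4)^m + (1/4)^n))"
      by (simp add: ennreal_mult' ennreal_plus distrib_left add.commute)
    finally show ?thesis .
  qed
  then obtain I where I: "I \<in> borel_measurable P"
    "(\<lambda>n. \<integral>\<^sup>+\<omega>. ennreal ((norm (I \<omega> - ?J n \<omega>))\<^sup>2) \<partial>P) \<longlonglongrightarrow> 0"
    using L2_limit_exists[of ?J P 2] simple_integral_measurable[OF S ab(1,3)] by auto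
  have "(\<lambda>n. (1/4::real)^n) \<longlonglongrightarrow> 0"
    by (intro LIMSEQ_realpow_zero) auto
  then have "(\<lambda>n. ennreal ((1/4)^n)) \<longlonglongrightarrow> ennreal 0"
    by (rule tendsto_ennrealI)
  then have lim: "(\<lambda>n. ennreal ((1/4)^n)) \<longlonglongrightarrow> 0" by simp
  have "(\<lambda>n. \<integral>\<^sup>+s\<in>{a..b}. (\<integral>\<^sup>+\<omega>. ennreal ((norm (Z s \<omega> - ?S n s \<omega>))\<^sup>2) \<partial>P) \<partial>lborel) \<longlonglongrightarrow> 0"
    by (rule tendsto_sandwich[OF _ _ tendsto_const lim])
      (intro always_eventually allI zero_le order.strict_implies_order[OF less])+
  then show ?thesis
    unfolding has_ito_integral_def using I S by blast
qed

text \<open>Existence is what gives the choice by \<open>SOME\<close> its meaning.\<close>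

lemma ito_integral_has_ito_integral:
  fixes Z :: "real \<Rightarrow> 'a \<Rightarrow> real^'d^'m"
  assumes "Z \<in> L2_adapted P F T" "0 \<le> a" "a \<le> b" "b \<le> T"
  shows "has_ito_integral P F W a b Z (ito_integral P F W a b Z)"
  unfolding ito_integral_def by (rule someI_ex[OF has_ito_integral_exists[OF assms]])

text \<open>The simple isometry holds along unrelated approximating sequences of \<open>Z\<close>
  and \<open>Z'\<close>, and both sides converge. With \<open>\<eta> = 0\<close> this is the usual
  isometry, needed for uniqueness; a general \<open>\<eta>\<close> adds the orthogonality behind the
  loss.\<close>

lemma has_ito_integral_isometry:
  fixes Z Z' :: "real \<Rightarrow> 'a \<Rightarrow> real^'d^'m" and \<eta> :: "'a \<Rightarrow> real^'m"
  assumes I: "has_ito_integral P F W a b Z I" and I': "has_ito_integral P F W a b Z' I'"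
    and Z: "Z \<in> L2_adapted P F T" and Z': "Z' \<in> L2_adapted P F T"
    and ab: "0 \<le> a" "a \<le> b" "b \<le> T"
    and \<eta>: "\<eta> \<in> borel_measurable (F a)" "(\<integral>\<^sup>+\<omega>. ennreal ((norm (\<eta> \<omega>))\<^sup>2) \<partial>P) < \<infinity>"
  shows "(\<integral>\<^sup>+\<omega>. ennreal ((norm (\<eta> \<omega> + (I \<omega> - I' \<omega>)))\<^sup>2) \<partial>P) =
    (\<integral>\<^sup>+\<omega>. ennreal ((norm (\<eta> \<omega>))\<^sup>2) \<partial>P) +
    (\<integral>\<^sup>+s\<in>{a..b}. (\<integral>\<^sup>+\<omega>. ennreal ((norm (Z s \<omega> - Z' s \<omega>))\<^sup>2) \<partial>P) \<partial>lborel)"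
proof -
  let ?Q = "restrict_space lborel {a..b} \<Otimes>\<^sub>M P"
  have aT: "a \<le> T" using ab by simp
  obtain k \<tau> \<xi> where S: "\<And>n::nat. simple_integrand P F a b (k n) (\<tau> n) (\<xi> n)"
    and SZ: "(\<lambda>n. \<integral>\<^sup>+s\<in>{a..b}. (\<integral>\<^sup>+\<omega>. ennreal ((norm (Z s \<omega> - simple_process (k n) (\<tau> n) (\<xi> n) s \<omega>))\<^sup>2) \<partial>P) \<partial>lborel) \<longlonglongrightarrow> 0"
    and SI: "(\<lambda>n. \<integral>\<^sup>+\<omega>. ennreal ((norm (I \<omega> - simple_integral W (k n) (\<tau> n) (\<xi> n) \<omega>))\<^sup>2) \<partial>P) \<longlonglongrightarrow> 0"
    using I unfolding has_ito_integral_def by blast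
  obtain k' \<tau>' \<xi>' where S': "\<And>n::nat. simple_integrand P F a b (k' n) (\<tau>' n) (\<xi>' n)"
    and SZ': "(\<lambda>n. \<integral>\<^sup>+s\<in>{a..b}. (\<integral>\<^sup>+\<omega>. ennreal ((norm (Z' s \<omega> - simple_process (k' n) (\<tau>' n) (\<xi>' n) s \<omega>))\<^sup>2) \<partial>P) \<partial>lborel) \<longlonglongrightarrow> 0"
    and SI': "(\<lambda>n. \<integral>\<^sup>+\<omega>. ennreal ((norm (I' \<omega> - simple_integral W (k' n) (\<tau>' n) (\<xi>' n) \<omega>))\<^sup>2) \<partial>P) \<longlonglongrightarrow> 0"
    using I' unfolding has_ito_integral_def by blast
  let ?S = "\<lambda>n. simple_process (k n) (\<tau> n) (\<xi> n)" and ?J = "\<lambda>n. simple_integral W (k n) (\<tau> n) (\<xi> n)"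
  let ?S' = "\<lambda>n. simple_process (k' n) (\<tau>' n) (\<xi>' n)" and ?J' = "\<lambda>n. simple_integral W (k' n) (\<tau>' n) (\<xi>' n)"
  have [measurable]: "I \<in> borel_measurable P" "I' \<in> borel_measurable P" "\<eta> \<in> borel_measurable P"
    using I I' measurable_F_P[OF aT \<eta>(1)] by (auto simp: has_ito_integral_def)
  note [measurable] = simple_integral_measurable[OF S ab(1,3)] simple_integral_measurable[OF S' ab(1,3)]
  have twice: "(\<lambda>n. 2 * u n + 2 * v n) \<longlonglongrightarrow> 0" if "u \<longlonglongrightarrow> 0" "v \<longlonglongrightarrow> 0" for u v :: "nat \<Rightarrow> ennreal"
    using tendsto_add[OF ennreal_tendsto_cmult[OF _ that(1), of 2] ennreal_tendsto_cmult[OF _ that(2), of 2]] by simp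
  have "(\<lambda>n. \<integral>\<^sup>+\<omega>. ennreal ((norm (\<eta> \<omega> + (?J n \<omega> - ?J' n \<omega>)))\<^sup>2) \<partial>P) \<longlonglongrightarrow>
      (\<integral>\<^sup>+\<omega>. ennreal ((norm (\<eta> \<omega> + (I \<omega> - I' \<omega>)))\<^sup>2) \<partial>P)"
  proof (rule nn_integral_norm_sq_tendsto)
    show "(\<lambda>n. \<integral>\<^sup>+\<omega>. ennreal ((norm (\<eta> \<omega> + (I \<omega> - I' \<omega>) - (\<eta> \<omega> + (?J n \<omega> - ?J' n \<omega>))))\<^sup>2) \<partial>P) \<longlonglongrightarrow> 0"
    proof (rule tendsto_sandwich[OF _ _ tendsto_const twice[OF SI SI']]; intro always_eventually allI zero_le)
      fix n
      have "\<eta> \<omega> + (I \<omega> - I' \<omega>) - (\<eta> \<omega> + (?J n \<omega> - ?J' n \<omega>)) = (I \<omega> - ?J n \<omega>) - (I' \<omega> - ?J' n \<omega>)" for \<omega>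
        by simp
      moreover have "(\<integral>\<^sup>+\<omega>. ennreal ((norm ((I \<omega> - ?J n \<omega>) - (I' \<omega> - ?J' n \<omega>)))\<^sup>2) \<partial>P) \<le>
          2 * (\<integral>\<^sup>+\<omega>. ennreal ((norm (I \<omega> - ?J n \<omega>))\<^sup>2) \<partial>P) + 2 * (\<integral>\<^sup>+\<omega>. ennreal ((norm (I' \<omega> - ?J' n \<omega>))\<^sup>2) \<partial>P)"
        by (rule nn_integral_norm_sq_diff_le) measurable
      ultimately show "(\<integral>\<^sup>+\<omega>. ennreal ((norm (\<eta> \<omega> + (I \<omega> - I' \<omega>) - (\<eta> \<omega> + (?J n \<omega> - ?J' n \<omega>))))\<^sup>2) \<partial>P) \<le>
          2 * (\<integral>\<^sup>+\<omega>. ennreal ((norm (I \<omega> - ?J n \<omega>))\<^sup>2) \<partial>P) + 2 * (\<integral>\<^sup>+\<omega>. ennreal ((norm (I' \<omega> - ?J' n \<omega>))\<^sup>2) \<partial>P)"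
        by (simp only:)
    qed
  qed measurable
  moreover have "(\<lambda>n. \<integral>\<^sup>+\<omega>. ennreal ((norm (\<eta> \<omega> + (?J n \<omega> - ?J' n \<omega>)))\<^sup>2) \<partial>P) \<longlonglongrightarrow>
      (\<integral>\<^sup>+\<omega>. ennreal ((norm (\<eta> \<omega>))\<^sup>2) \<partial>P) +
      (\<integral>\<^sup>+s\<in>{a..b}. (\<integral>\<^sup>+\<omega>. ennreal ((norm (Z s \<omega> - Z' s \<omega>))\<^sup>2) \<partial>P) \<partial>lborel)"
    unfolding simple_isometry[OF S S' ab(1) aT ab(3) \<eta>]
  proof (intro tendsto_add tendsto_const)
    note jZ = L2_adapted_joint[OF Z ab(1,3)] and jZ' = L2_adapted_joint[OF Z' ab(1,3)]
      and jS = measurable_simple_process[OF S ab(1,3)] and jS' = measurable_simple_process[OF S' ab(1,3)]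
    note d = iterated_norm_sq[OF measurable_process_diff[OF jZ jZ']]
      and dS = iterated_norm_sq[OF measurable_process_diff[OF jS jS']]
      and e = iterated_norm_sq[OF measurable_process_diff[OF jZ jS]]
      and e' = iterated_norm_sq[OF measurable_process_diff[OF jZ' jS']]
    show "(\<lambda>n. \<integral>\<^sup>+s\<in>{a..b}. (\<integral>\<^sup>+\<omega>. ennreal ((norm (?S n s \<omega> - ?S' n s \<omega>))\<^sup>2) \<partial>P) \<partial>lborel) \<longlonglongrightarrow>
        (\<integral>\<^sup>+s\<in>{a..b}. (\<integral>\<^sup>+\<omega>. ennreal ((norm (Z s \<omega> - Z' s \<omega>))\<^sup>2) \<partial>P) \<partial>lborel)"
      unfolding d(2) dS(2)
    proof (rule nn_integral_norm_sq_tendsto[OF d(1) dS(1)])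
      let ?e = "\<lambda>n p. case_prod (\<lambda>s \<omega>. Z s \<omega> - ?S n s \<omega>) p" and ?e' = "\<lambda>n p. case_prod (\<lambda>s \<omega>. Z' s \<omega> - ?S' n s \<omega>) p"
      show "(\<lambda>n. \<integral>\<^sup>+p. ennreal ((norm (case_prod (\<lambda>s \<omega>. Z s \<omega> - Z' s \<omega>) p - case_prod (\<lambda>s \<omega>. ?S n s \<omega> - ?S' n s \<omega>) p))\<^sup>2) \<partial>?Q) \<longlonglongrightarrow> 0"
      proof (rule tendsto_sandwich[OF _ _ tendsto_const twice[OF SZ SZ']]; intro always_eventually allI zero_le)
        fix n
        have "case_prod (\<lambda>s \<omega>. Z s \<omega> - Z' s \<omega>) p - case_prod (\<lambda>s \<omega>. ?S n s \<omega> - ?S' n s \<omega>) p = ?e n p - ?e' n p" for p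
          by (simp add: case_prod_beta)
        moreover have "(\<integral>\<^sup>+p. ennreal ((norm (?e n p - ?e' n p))\<^sup>2) \<partial>?Q) \<le>
            2 * (\<integral>\<^sup>+p. ennreal ((norm (?e n p))\<^sup>2) \<partial>?Q) + 2 * (\<integral>\<^sup>+p. ennreal ((norm (?e' n p))\<^sup>2) \<partial>?Q)"
          by (rule nn_integral_norm_sq_diff_le[OF e(1) e'(1)])
        ultimately show "(\<integral>\<^sup>+p. ennreal ((norm (case_prod (\<lambda>s \<omega>. Z s \<omega> - Z' s \<omega>) p - case_prod (\<lambda>s \<omega>. ?S n s \<omega> - ?S' n s \<omega>) p))\<^sup>2) \<partial>?Q) \<le>
            2 * (\<integral>\<^sup>+s\<in>{a..b}. (\<integral>\<^sup>+\<omega>. ennreal ((norm (Z s \<omega> - ?S n s \<omega>))\<^sup>2) \<partial>P) \<partial>lborel) +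
            2 * (\<integral>\<^sup>+s\<in>{a..b}. (\<integral>\<^sup>+\<omega>. ennreal ((norm (Z' s \<omega> - ?S' n s \<omega>))\<^sup>2) \<partial>P) \<partial>lborel)"
          unfolding e(2) e'(2) by (simp only:)
      qed
    qed
  qed
  ultimately show ?thesis by (rule LIMSEQ_unique)
qed

end

section \<open>Uniqueness of the forward component\<close>

text \<open>The countably many grid times share one null set, and continuous paths are determined by
  their values there.\<close>

lemma continuous_processes_indistinguishable:
  fixes X X' :: "real \<Rightarrow> 'a \<Rightarrow> 'b::metric_space"
  assumes "0 \<le> T"
    and cont: "\<And>\<omega>. \<omega> \<in> space M \<Longrightarrow> continuous_on {0..T} (\<lambda>t. X t \<omega>)"
      "\<And>\<omega>. \<omega> \<in> space M \<Longrightarrow> continuous_on {0..T} (\<lambda>t. X' t \<omega>)"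
    and eq: "\<And>t. t \<in> {0..T} \<Longrightarrow> AE \<omega> in M. X t \<omega> = X' t \<omega>"
  shows "AE \<omega> in M. \<forall>t\<in>{0..T}. X t \<omega> = X' t \<omega>"
proof -
  let ?g = "\<lambda>n i. max 0 (min T (real_of_int i / real (Suc n)))"
  have g: "?g n i \<in> {0..T}" for n i using \<open>0 \<le> T\<close> by auto
  have "AE \<omega> in M. \<forall>n i. X (?g n i) \<omega> = X' (?g n i) \<omega>"
    using eq[OF g] by (simp add: AE_all_countable)
  with AE_space show ?thesis
  proof eventually_elim
    case (elim \<omega>)
    show ?case
    proof
      fix t assume t: "t \<in> {0..T}"
      have "(\<lambda>n. X (?g n \<lfloor>real (Suc n) * t\<rfloor>) \<omega>) \<longlonglongrightarrow> X t \<omega>"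
        by (rule continuous_on_tendsto_compose[OF cont(1)[OF elim(1)] grid_tendsto[OF t] t])
          (intro always_eventually allI g)
      moreover have "(\<lambda>n. X' (?g n \<lfloor>real (Suc n) * t\<rfloor>) \<omega>) \<longlonglongrightarrow> X' t \<omega>"
        by (rule continuous_on_tendsto_compose[OF cont(2)[OF elim(1)] grid_tendsto[OF t] t])
          (intro always_eventually allI g)
      ultimately show "X t \<omega> = X' t \<omega>"
        using elim(2) by (simp add: LIMSEQ_unique)
    qed
  qed
qed

text \<open>Measurability in the outcome and in time is stated separately: the former lets integrals
  over \<open>M\<close> be added and scaled, the latter lets constants be moved out of the time
  integrals of the Gronwall estimate.\<close>

lemma (in sigma_finite_measure) norm_sq_set_Fubini:
  fixes f :: "real \<Rightarrow> 'a \<Rightarrow> 'b::{real_normed_vector, second_countable_topology}"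
  assumes f: "case_prod f \<in> borel_measurable (restrict_space borel {a..b} \<Otimes>\<^sub>M M)"
  shows "(\<lambda>\<omega>. \<integral>\<^sup>+s\<in>{a..b}. ennreal ((norm (f s \<omega>))\<^sup>2) \<partial>lborel) \<in> borel_measurable M"
    and "(\<integral>\<^sup>+\<omega>. (\<integral>\<^sup>+s\<in>{a..b}. ennreal ((norm (f s \<omega>))\<^sup>2) \<partial>lborel) \<partial>M) =
      (\<integral>\<^sup>+s\<in>{a..b}. (\<integral>\<^sup>+\<omega>. ennreal ((norm (f s \<omega>))\<^sup>2) \<partial>M) \<partial>lborel)"
    and "(\<lambda>s. (\<integral>\<^sup>+\<omega>. ennreal ((norm (f s \<omega>))\<^sup>2) \<partial>M) * indicator {a..b} s) \<in> borel_measurable borel"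
proof -
  let ?h = "\<lambda>p. ennreal ((norm (indicat_real {a..b} (fst p) *\<^sub>R f (fst p) (snd p)))\<^sup>2)"
  have "(\<lambda>p. indicat_real {a..b} (fst p) *\<^sub>R f (fst p) (snd p)) \<in> borel_measurable (borel \<Otimes>\<^sub>M M)"
    by (rule measurable_process_extend[OF f])
  from measurable_compose[of "\<lambda>p. (fst p, snd p)" "lborel \<Otimes>\<^sub>M M", OF _ this]
  have [measurable]: "(\<lambda>p. indicat_real {a..b} (fst p) *\<^sub>R f (fst p) (snd p)) \<in> borel_measurable (lborel \<Otimes>\<^sub>M M)"
    by simp
  have h: "?h \<in> borel_measurable (lborel \<Otimes>\<^sub>M M)" by measurable
  have h': "(\<lambda>p. ?h (snd p, fst p)) \<in> borel_measurable (M \<Otimes>\<^sub>M lborel)"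
    using measurable_compose[OF _ h, of "\<lambda>p. (snd p, fst p)" "M \<Otimes>\<^sub>M lborel"] by simp
  have eq: "ennreal ((norm (f s \<omega>))\<^sup>2) * indicator {a..b} s = ?h (s, \<omega>)" for s \<omega>
    by (auto split: split_indicator)
  have ind: "(\<integral>\<^sup>+\<omega>. ?h (s, \<omega>) \<partial>M) = (\<integral>\<^sup>+\<omega>. ennreal ((norm (f s \<omega>))\<^sup>2) \<partial>M) * indicator {a..b} s" for s
    by (auto split: split_indicator)
  have "(\<lambda>s. \<integral>\<^sup>+\<omega>. ?h (s, \<omega>) \<partial>M) \<in> borel_measurable lborel"
    by (rule borel_measurable_nn_integral_fst[OF h])
  then show "(\<lambda>s. (\<integral>\<^sup>+\<omega>. ennreal ((norm (f s \<omega>))\<^sup>2) \<partial>M) * indicator {a..b} s) \<in> borel_measurable borel"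
    unfolding ind by simp
  interpret pair_sigma_finite lborel M ..
  show "(\<lambda>\<omega>. \<integral>\<^sup>+s\<in>{a..b}. ennreal ((norm (f s \<omega>))\<^sup>2) \<partial>lborel) \<in> borel_measurable M"
    unfolding eq using h' by (intro lborel.borel_measurable_nn_integral) (simp add: case_prod_beta)
  have "(\<integral>\<^sup>+\<omega>. (\<integral>\<^sup>+s. ?h (s, \<omega>) \<partial>lborel) \<partial>M) = (\<integral>\<^sup>+s. (\<integral>\<^sup>+\<omega>. ?h (s, \<omega>) \<partial>M) \<partial>lborel)"
    using h by (intro Fubini') (simp add: case_prod_beta)
  also have "\<dots> = (\<integral>\<^sup>+s\<in>{a..b}. (\<integral>\<^sup>+\<omega>. ennreal ((norm (f s \<omega>))\<^sup>2) \<partial>M) \<partial>lborel)"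
    unfolding ind ..
  finally show "(\<integral>\<^sup>+\<omega>. (\<integral>\<^sup>+s\<in>{a..b}. ennreal ((norm (f s \<omega>))\<^sup>2) \<partial>lborel) \<partial>M) =
      (\<integral>\<^sup>+s\<in>{a..b}. (\<integral>\<^sup>+\<omega>. ennreal ((norm (f s \<omega>))\<^sup>2) \<partial>M) \<partial>lborel)"
    unfolding eq .
qed

lemma norm_sq_set_integral_le:
  fixes f :: "real \<Rightarrow> 'b::{banach, second_countable_topology}"
  assumes "0 \<le> t" and f: "set_integrable lborel {0..t} f"
  shows "ennreal ((norm (LINT s:{0..t}|lborel. f s))\<^sup>2) \<le>
    ennreal t * (\<integral>\<^sup>+s\<in>{0..t}. ennreal ((norm (f s))\<^sup>2) \<partial>lborel)"
proof -
  let ?f = "\<lambda>s. indicat_real {0..t} s *\<^sub>R f s"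
  have int: "integrable lborel ?f" using f by (simp add: set_integrable_def)
  have [measurable]: "?f \<in> borel_measurable lborel" using int by auto
  have "ennreal (norm (LINT s:{0..t}|lborel. f s)) \<le> (\<integral>\<^sup>+s. ennreal (norm (?f s)) \<partial>lborel)"
    unfolding set_lebesgue_integral_def by (rule integral_norm_bound_ennreal[OF int])
  \<comment> \<open>The indicator is split off as a factor of its own: in the Cauchy-Schwarz
    inequality its square integrates to \<open>t\<close>.\<close>
  also have "\<dots> = (\<integral>\<^sup>+s. indicator {0..t} s * ennreal (norm (?f s)) \<partial>lborel)"
    by (intro nn_integral_cong) (auto split: split_indicator)
  finally have "(ennreal (norm (LINT s:{0..t}|lborel. f s)))\<^sup>2 \<le>
      (\<integral>\<^sup>+s. indicator {0..t} s * ennreal (norm (?f s)) \<partial>lborel)\<^sup>2"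
    by (rule power_mono) simp
  also have "\<dots> \<le> (\<integral>\<^sup>+s. (indicator {0..t} s)\<^sup>2 \<partial>lborel) * (\<integral>\<^sup>+s. (ennreal (norm (?f s)))\<^sup>2 \<partial>lborel)"
    by (rule Cauchy_Schwarz_nn_integral) measurable
  also have "(\<integral>\<^sup>+s. (indicator {0..t} s)\<^sup>2 \<partial>lborel) = (\<integral>\<^sup>+s. indicator {0..t} s \<partial>lborel)"
    by (intro nn_integral_cong) (auto split: split_indicator)
  also have "\<dots> = ennreal t" using \<open>0 \<le> t\<close> by simp
  also have "(\<integral>\<^sup>+s. (ennreal (norm (?f s)))\<^sup>2 \<partial>lborel) = (\<integral>\<^sup>+s\<in>{0..t}. ennreal ((norm (f s))\<^sup>2) \<partial>lborel)"
    by (intro nn_integral_cong) (auto simp: ennreal_power split: split_indicator)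
  finally show ?thesis by (simp add: ennreal_power)
qed

text \<open>A bounded interval has finite measure, so \<open>x \<le> x\<^sup>2 + 1\<close> makes the
  square plus an indicator an integrable majorant.\<close>

lemma set_integrable_of_square:
  fixes f :: "real \<Rightarrow> 'b::{banach, second_countable_topology}"
  assumes f: "f \<in> borel_measurable (restrict_space borel {a..b})"
    and fin: "(\<integral>\<^sup>+s\<in>{a..b}. ennreal ((norm (f s))\<^sup>2) \<partial>lborel) < \<infinity>"
  shows "set_integrable lborel {a..b} f"
proof -
  let ?f = "\<lambda>s. indicat_real {a..b} s *\<^sub>R f s"
  have meas [measurable]: "?f \<in> borel_measurable borel"
    using f by (simp add: borel_measurable_restrict_space_iff)
  have "integrable lborel (\<lambda>s. (norm (?f s))\<^sup>2 + indicat_real {a..b} s)"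
  proof (rule Bochner_Integration.integrable_add)
    show "integrable lborel (\<lambda>s. (norm (?f s))\<^sup>2)"
    proof (rule integrableI_bounded)
      have "(\<integral>\<^sup>+s. ennreal (norm ((norm (?f s))\<^sup>2)) \<partial>lborel) = (\<integral>\<^sup>+s\<in>{a..b}. ennreal ((norm (f s))\<^sup>2) \<partial>lborel)"
        by (intro nn_integral_cong) (auto split: split_indicator)
      then show "(\<integral>\<^sup>+s. ennreal (norm ((norm (?f s))\<^sup>2)) \<partial>lborel) < \<infinity>" using fin by simp
    qed measurable
    show "integrable lborel (indicat_real {a..b})"
      by (rule integrable_real_indicator) (auto simp: emeasure_lborel_Icc_eq)
  qed
  then show ?thesis
    unfolding set_integrable_def
  proof (rule Bochner_Integration.integrable_bound)
    show "AE s in lborel. norm (?f s) \<le> norm ((norm (?f s))\<^sup>2 + indicat_real {a..b} s)"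
    proof (intro AE_I2)
      fix s
      have "norm (f s) \<le> (norm (f s))\<^sup>2 + 1"
        using sum_squares_bound[of 1 "norm (f s)"] norm_ge_zero[of "f s"]
        unfolding mult_1_right power_one by linarith
      then show "norm (?f s) \<le> norm ((norm (?f s))\<^sup>2 + indicat_real {a..b} s)"
        by (auto split: split_indicator)
    qed
  qed simp
qed

context brownian
begin

section \<open>Square-integrable integrands built from random fields\<close>

lemma L2_continuous_bound:
  assumes X: "X \<in> L2_continuous P F T"
  obtains K where "K < \<infinity>" "\<And>t. t \<in> {0..T} \<Longrightarrow> (\<integral>\<^sup>+\<omega>. ennreal ((norm (X t \<omega>))\<^sup>2) \<partial>P) \<le> K"
proof
  show "(\<integral>\<^sup>+\<omega>. (SUP t\<in>{0..T}. ennreal ((norm (X t \<omega>))\<^sup>2)) \<partial>P) < \<infinity>"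
    using X by (simp add: L2_continuous_def)
  fix t assume "t \<in> {0..T}"
  then show "(\<integral>\<^sup>+\<omega>. ennreal ((norm (X t \<omega>))\<^sup>2) \<partial>P) \<le> (\<integral>\<^sup>+\<omega>. (SUP t\<in>{0..T}. ennreal ((norm (X t \<omega>))\<^sup>2)) \<partial>P)"
    by (intro nn_integral_mono SUP_upper)
qed

text \<open>Joint measurability comes from continuity of the paths, and the time integral is bounded
  by \<open>T\<close> times the expected supremum.\<close>

lemma L2_continuous_L2_adapted:
  fixes X :: "real \<Rightarrow> 'a \<Rightarrow> 'b::euclidean_space"
  assumes X: "X \<in> L2_continuous P F T" and "0 \<le> T"
  shows "X \<in> L2_adapted P F T"
proof -
  have F: "X t \<in> borel_measurable (F t)" if "t \<in> {0..T}" for t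
    using X that by (auto simp: L2_continuous_def)
  have "(\<lambda>(t, \<omega>). X t \<omega>) \<in> borel_measurable (restrict_space borel {0..T} \<Otimes>\<^sub>M P)"
  proof (rule borel_measurable_continuous_process[OF \<open>0 \<le> T\<close>])
    fix t assume t: "t \<in> {0..T}"
    then show "X t \<in> borel_measurable P" using measurable_F_P[OF _ F[OF t]] by simp
  qed (use X in \<open>auto simp: L2_continuous_def\<close>)
  moreover have "(\<integral>\<^sup>+t\<in>{0..T}. (\<integral>\<^sup>+\<omega>. ennreal ((norm (X t \<omega>))\<^sup>2) \<partial>P) \<partial>lborel) < \<infinity>"
  proof -
    obtain K where K: "K < \<infinity>" "\<And>t. t \<in> {0..T} \<Longrightarrow> (\<integral>\<^sup>+\<omega>. ennreal ((norm (X t \<omega>))\<^sup>2) \<partial>P) \<le> K"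
      using L2_continuous_bound[OF X] by blast
    have "(\<integral>\<^sup>+t\<in>{0..T}. (\<integral>\<^sup>+\<omega>. ennreal ((norm (X t \<omega>))\<^sup>2) \<partial>P) \<partial>lborel) \<le> (\<integral>\<^sup>+t. K * indicator {0..T} t \<partial>lborel)"
      using K(2) by (intro nn_integral_mono) (auto split: split_indicator)
    also have "\<dots> = K * ennreal T" using \<open>0 \<le> T\<close> by (simp add: nn_integral_cmult_indicator)
    also have "\<dots> < \<infinity>" using K(1) by (simp add: ennreal_mult_less_top)
    finally show ?thesis .
  qed
  ultimately show ?thesis using F by (auto simp: L2_adapted_def adapted_process_def)
qed

lemma L2_adapted_Pair:
  fixes X :: "real \<Rightarrow> 'a \<Rightarrow> 'b::euclidean_space" and Y :: "real \<Rightarrow> 'a \<Rightarrow> 'c::euclidean_space"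
  assumes X: "X \<in> L2_adapted P F T" and Y: "Y \<in> L2_adapted P F T"
  shows "(\<lambda>t \<omega>. (X t \<omega>, Y t \<omega>)) \<in> L2_adapted P F T"
proof -
  have joint: "case_prod X \<in> borel_measurable (restrict_space borel {0..T} \<Otimes>\<^sub>M P)"
    "case_prod Y \<in> borel_measurable (restrict_space borel {0..T} \<Otimes>\<^sub>M P)"
    using L2_adapted_joint[OF X, of 0 T] L2_adapted_joint[OF Y, of 0 T] by auto
  have XY: "case_prod (\<lambda>t \<omega>. (X t \<omega>, Y t \<omega>)) \<in> borel_measurable (restrict_space borel {0..T} \<Otimes>\<^sub>M P)"
    using borel_measurable_Pair[OF joint] by (simp add: case_prod_beta)
  note iX = iterated_norm_sq[OF joint(1)] and iY = iterated_norm_sq[OF joint(2)] and iXY = iterated_norm_sq[OF XY]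
  have "(\<integral>\<^sup>+t\<in>{0..T}. (\<integral>\<^sup>+\<omega>. ennreal ((norm (X t \<omega>, Y t \<omega>))\<^sup>2) \<partial>P) \<partial>lborel) =
    (\<integral>\<^sup>+t\<in>{0..T}. (\<integral>\<^sup>+\<omega>. ennreal ((norm (X t \<omega>))\<^sup>2) \<partial>P) \<partial>lborel) +
    (\<integral>\<^sup>+t\<in>{0..T}. (\<integral>\<^sup>+\<omega>. ennreal ((norm (Y t \<omega>))\<^sup>2) \<partial>P) \<partial>lborel)"
    unfolding iX(2) iY(2) iXY(2) using iX(1) iY(1)
    by (subst nn_integral_add[symmetric])
      (auto intro!: nn_integral_cong simp: norm_Pair case_prod_beta ennreal_plus[symmetric] simp del: ennreal_plus)
  also have "\<dots> < \<infinity>" using X Y by (simp add: L2_adapted_def less_top[symmetric])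
  finally have fin: "(\<integral>\<^sup>+t\<in>{0..T}. (\<integral>\<^sup>+\<omega>. ennreal ((norm (X t \<omega>, Y t \<omega>))\<^sup>2) \<partial>P) \<partial>lborel) < \<infinity>" .
  have "(\<lambda>\<omega>. (X t \<omega>, Y t \<omega>)) \<in> borel_measurable (F t)" if "t \<in> {0..T}" for t
    using X Y that by (intro borel_measurable_Pair) (simp_all add: L2_adapted_def adapted_process_def)
  with fin XY show ?thesis unfolding L2_adapted_def adapted_process_def by blast
qed

text \<open>The version \<open>h\<close> vanishes on one null set \<open>N\<close> outside of which
  the fields are Lipschitz for all \<open>t\<close> at once. Augmentation puts \<open>N\<close> into
  every \<open>F t\<close>, so the change preserves adaptedness; linear growth of Lipschitz
  functions gives square integrability.\<close>

lemma random_field_composition: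
  fixes f :: "real \<Rightarrow> 'a \<Rightarrow> 'c::euclidean_space \<Rightarrow> 'b::euclidean_space"
  assumes f: "f \<in> L2_adapted_Lipschitz P F T" and U: "U \<in> L2_adapted P F T"
  obtains h where "h \<in> L2_adapted P F T" "AE \<omega> in P. \<forall>t\<in>{0..T}. h t \<omega> = f t \<omega> (U t \<omega>)"
proof -
  obtain L where "AE \<omega> in P. \<forall>t\<in>{0..T}. L-lipschitz_on UNIV (f t \<omega>)"
    using f by (auto simp: L2_adapted_Lipschitz_def)
  then obtain N where N: "{\<omega>\<in>space P. \<not> (\<forall>t\<in>{0..T}. L-lipschitz_on UNIV (f t \<omega>))} \<subseteq> N"
    and null: "emeasure P N = 0" "N \<in> sets P"
    by (rule AE_E)
  then have N_null: "N \<in> null_sets P" by auto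
  have lip: "L-lipschitz_on UNIV (f t \<omega>)" if "\<omega> \<in> space P" "\<omega> \<notin> N" "t \<in> {0..T}" for t \<omega>
    using that N by blast
  define fN where "fN t \<omega> \<theta> = (if \<omega> \<in> N then 0 else f t \<omega> \<theta>)" for t \<omega> \<theta>
  define h where "h t \<omega> = fN t \<omega> (U t \<omega>)" for t \<omega>
  have cont: "continuous_on UNIV (fN t \<omega>)" if "\<omega> \<in> space P" "t \<in> {0..T}" for t \<omega>
    using lipschitz_on_continuous_on[OF lip[OF that(1) _ that(2)]] by (cases "\<omega> \<in> N") (auto simp: fN_def[abs_def])
  have fad: "adapted_process P F T (\<lambda>t \<omega>. f t \<omega> \<theta>)" for \<theta>
    using f by (auto simp: L2_adapted_Lipschitz_def)
  have Uad: "adapted_process P F T U" using U by (simp add: L2_adapted_def)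
  have h_F: "h t \<in> borel_measurable (F t)" if t: "t \<in> {0..T}" for t
    unfolding h_def[abs_def]
  proof (rule borel_measurable_random_field[where f="fN t"])
    fix \<theta>
    have [measurable]: "N \<in> sets (F t)" by (rule null_sets_in_F[OF N_null])
    have [measurable]: "(\<lambda>\<omega>. f t \<omega> \<theta>) \<in> borel_measurable (F t)"
      using fad t by (auto simp: adapted_process_def)
    show "(\<lambda>\<omega>. fN t \<omega> \<theta>) \<in> borel_measurable (F t)" unfolding fN_def by measurable
  qed (use cont t Uad in \<open>auto simp: adapted_process_def\<close>)
  have h_joint: "case_prod h \<in> borel_measurable (restrict_space borel {0..T} \<Otimes>\<^sub>M P)"
  proof -
    have "(\<lambda>p. fN (fst p) (snd p) (U (fst p) (snd p))) \<in> borel_measurable (restrict_space borel {0..T} \<Otimes>\<^sub>M P)"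
    proof (rule borel_measurable_random_field[where f="\<lambda>p. fN (fst p) (snd p)" and U="\<lambda>p. U (fst p) (snd p)"])
      fix \<theta>
      note [measurable] = null(2)
      have [measurable]: "(\<lambda>p. f (fst p) (snd p) \<theta>) \<in> borel_measurable (restrict_space borel {0..T} \<Otimes>\<^sub>M P)"
        using fad[of \<theta>] by (simp add: adapted_process_def case_prod_beta')
      show "(\<lambda>p. fN (fst p) (snd p) \<theta>) \<in> borel_measurable (restrict_space borel {0..T} \<Otimes>\<^sub>M P)"
        unfolding fN_def by measurable
    next
      fix p assume "p \<in> space (restrict_space borel {0..T} \<Otimes>\<^sub>M P)"
      then show "continuous_on UNIV (fN (fst p) (snd p))"
        by (intro cont) (auto simp: space_pair_measure space_restrict_space)
    next
      show "(\<lambda>p. U (fst p) (snd p)) \<in> borel_measurable (restrict_space borel {0..T} \<Otimes>\<^sub>M P)"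
        using Uad by (simp add: adapted_process_def case_prod_beta')
    qed
    then show ?thesis by (simp add: h_def case_prod_beta')
  qed
  have f0: "(\<lambda>t \<omega>. f t \<omega> 0) \<in> L2_adapted P F T" using f by (simp add: L2_adapted_Lipschitz_def)
  let ?Q = "restrict_space lborel {0..T} \<Otimes>\<^sub>M P"
  note i0 = iterated_norm_sq[OF L2_adapted_joint[OF f0, of 0 T]] and iU = iterated_norm_sq[OF L2_adapted_joint[OF U, of 0 T]]
    and ih = iterated_norm_sq[OF h_joint]
  have "(\<integral>\<^sup>+t\<in>{0..T}. (\<integral>\<^sup>+\<omega>. ennreal ((norm (h t \<omega>))\<^sup>2) \<partial>P) \<partial>lborel) \<le>
    (\<integral>\<^sup>+p. ennreal 2 * ennreal ((norm (case_prod (\<lambda>t \<omega>. f t \<omega> 0) p))\<^sup>2) + ennreal (2 * L\<^sup>2) * ennreal ((norm (case_prod U p))\<^sup>2) \<partial>?Q)"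
    unfolding ih(2)
  proof (rule nn_integral_mono)
    fix p assume "p \<in> space ?Q"
    then obtain t \<omega> where p: "p = (t, \<omega>)" "t \<in> {0..T}" "\<omega> \<in> space P"
      by (auto simp: space_pair_measure space_restrict_space)
    \<comment> \<open>Linear growth measured from the argument 0, squared by the weighted inequality
      with \<open>c = 1\<close>.\<close>
    have "(norm (h t \<omega>))\<^sup>2 \<le> 2 * (norm (f t \<omega> 0))\<^sup>2 + 2 * L\<^sup>2 * (norm (U t \<omega>))\<^sup>2"
    proof (cases "\<omega> \<in> N")
      case True
      then show ?thesis by (simp add: h_def fN_def)
    next
      case False
      have "norm (f t \<omega> (U t \<omega>) - f t \<omega> 0) \<le> L * norm (U t \<omega>)"
        using lipschitz_onD[OF lip[OF p(3) False p(2)], of "U t \<omega>" 0] by (simp add: dist_norm)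
      then have "(norm (f t \<omega> (U t \<omega>) - f t \<omega> 0))\<^sup>2 \<le> (L * norm (U t \<omega>))\<^sup>2"
        by (rule power_mono) simp
      then show ?thesis
        using norm_sq_le_weighted[of 1 "f t \<omega> (U t \<omega>)" "f t \<omega> 0"] False
        by (simp add: h_def fN_def power_mult_distrib)
    qed
    then show "ennreal ((norm (case_prod h p))\<^sup>2) \<le>
        ennreal 2 * ennreal ((norm (case_prod (\<lambda>t \<omega>. f t \<omega> 0) p))\<^sup>2) + ennreal (2 * L\<^sup>2) * ennreal ((norm (case_prod U p))\<^sup>2)"
      unfolding p(1) prod.case
      by (subst (1 2) ennreal_mult[symmetric]; (simp del: ennreal_plus add: ennreal_plus[symmetric] ennreal_leI)?)
  qed
  also have "\<dots> = ennreal 2 * (\<integral>\<^sup>+p. ennreal ((norm (case_prod (\<lambda>t \<omega>. f t \<omega> 0) p))\<^sup>2) \<partial>?Q) +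
      ennreal (2 * L\<^sup>2) * (\<integral>\<^sup>+p. ennreal ((norm (case_prod U p))\<^sup>2) \<partial>?Q)"
  proof -
    note [measurable] = i0(1) iU(1)
    show ?thesis by (subst nn_integral_add; (subst nn_integral_cmult)?; measurable?)
        (simp add: nn_integral_cmult)
  qed
  also have "\<dots> < \<infinity>"
  proof -
    have "(\<integral>\<^sup>+p. ennreal ((norm (case_prod (\<lambda>t \<omega>. f t \<omega> 0) p))\<^sup>2) \<partial>?Q) < \<infinity>"
      "(\<integral>\<^sup>+p. ennreal ((norm (case_prod U p))\<^sup>2) \<partial>?Q) < \<infinity>"
      using f0 U i0(2) iU(2) by (simp_all only: L2_adapted_def mem_Collect_eq order_refl simp_thms)
    then show ?thesis by (simp add: ennreal_mult_less_top)
  qed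
  finally have "h \<in> L2_adapted P F T"
    using h_F h_joint by (auto simp: L2_adapted_def adapted_process_def)
  moreover have "AE \<omega> in P. \<forall>t\<in>{0..T}. h t \<omega> = f t \<omega> (U t \<omega>)"
    using AE_not_in[OF N_null] by eventually_elim (simp add: h_def fN_def)
  ultimately show ?thesis using that by blast
qed

lemma trial_argument:
  fixes X :: "real \<Rightarrow> 'a \<Rightarrow> real^'n" and y :: "real \<Rightarrow> 'a \<Rightarrow> real^'m" and z :: "real \<Rightarrow> 'a \<Rightarrow> real^'k^'m"
  assumes "0 \<le> T" "X \<in> L2_continuous P F T" "(y, z) \<in> trial_space P F T"
  shows "(\<lambda>t \<omega>. (X t \<omega>, y t \<omega>, z t \<omega>)) \<in> L2_adapted P F T"
  using assms by (intro L2_adapted_Pair) (auto simp: trial_space_def intro: L2_continuous_L2_adapted)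

text \<open>By Fubini the expected time integral of the square is finite, so it is finite on almost
  every path.\<close>

lemma L2_adapted_set_integrable:
  fixes B :: "real \<Rightarrow> 'a \<Rightarrow> 'b::euclidean_space"
  assumes B: "B \<in> L2_adapted P F T" and t: "t \<in> {0..T}"
  shows "AE \<omega> in P. set_integrable lborel {0..t} (\<lambda>s. B s \<omega>)"
proof -
  have joint: "case_prod B \<in> borel_measurable (restrict_space borel {0..t} \<Otimes>\<^sub>M P)"
    using L2_adapted_joint[OF B, of 0 t] t by simp
  have "(\<integral>\<^sup>+\<omega>. (\<integral>\<^sup>+s\<in>{0..t}. ennreal ((norm (B s \<omega>))\<^sup>2) \<partial>lborel) \<partial>P) \<le>
      (\<integral>\<^sup>+s\<in>{0..T}. (\<integral>\<^sup>+\<omega>. ennreal ((norm (B s \<omega>))\<^sup>2) \<partial>P) \<partial>lborel)"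
    unfolding norm_sq_set_Fubini(2)[OF joint] using t
    by (intro nn_integral_mono) (auto split: split_indicator)
  also have "\<dots> < \<infinity>" using B by (simp add: L2_adapted_def)
  finally have "AE \<omega> in P. (\<integral>\<^sup>+s\<in>{0..t}. ennreal ((norm (B s \<omega>))\<^sup>2) \<partial>lborel) \<noteq> \<infinity>"
    using norm_sq_set_Fubini(1)[OF joint] by (intro nn_integral_PInf_AE) auto
  with AE_space show ?thesis
  proof eventually_elim
    case (elim \<omega>)
    show ?case
      using measurable_process_section[OF joint elim(1)] elim(2)
      by (intro set_integrable_of_square) (simp_all add: less_top)
  qed
qed

text \<open>Both arguments share \<open>y\<close> and \<open>z\<close>, so their distance is that of
  the forward components alone.\<close>

lemma Lipschitz_forward:
  fixes f :: "real \<Rightarrow> 'a \<Rightarrow> (real^'n) \<times> (real^'m) \<times> (real^'k^'m) \<Rightarrow> 'b::euclidean_space"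
  assumes f: "f \<in> L2_adapted_Lipschitz P F T"
    and h: "AE \<omega> in P. \<forall>t\<in>{0..T}. h t \<omega> = f t \<omega> (X t \<omega>, y t \<omega>, z t \<omega>)"
    and h': "AE \<omega> in P. \<forall>t\<in>{0..T}. h' t \<omega> = f t \<omega> (X' t \<omega>, y t \<omega>, z t \<omega>)"
    and X: "\<And>t. t \<in> {0..T} \<Longrightarrow> X t \<in> borel_measurable P"
    and X': "\<And>t. t \<in> {0..T} \<Longrightarrow> X' t \<in> borel_measurable P"
  obtains L where "0 \<le> L" "\<And>t. t \<in> {0..T} \<Longrightarrow>
    (\<integral>\<^sup>+\<omega>. ennreal ((norm (h t \<omega> - h' t \<omega>))\<^sup>2) \<partial>P) \<le> ennreal L * (\<integral>\<^sup>+\<omega>. ennreal ((norm (X t \<omega> - X' t \<omega>))\<^sup>2) \<partial>P)"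
proof -
  obtain L where L: "AE \<omega> in P. \<forall>t\<in>{0..T}. L-lipschitz_on UNIV (f t \<omega>)"
    using f by (auto simp: L2_adapted_Lipschitz_def)
  show ?thesis
  proof (rule that[of "L\<^sup>2"])
    fix t assume t: "t \<in> {0..T}"
    have "AE \<omega> in P. ennreal ((norm (h t \<omega> - h' t \<omega>))\<^sup>2) \<le> ennreal (L\<^sup>2) * ennreal ((norm (X t \<omega> - X' t \<omega>))\<^sup>2)"
      using L h h'
    proof eventually_elim
      case (elim \<omega>)
      have "norm (h t \<omega> - h' t \<omega>) \<le> L * norm (X t \<omega> - X' t \<omega>)"
        using elim t lipschitz_onD[of L UNIV "f t \<omega>" "(X t \<omega>, y t \<omega>, z t \<omega>)" "(X' t \<omega>, y t \<omega>, z t \<omega>)"]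
        by (simp add: dist_norm norm_Pair)
      then have "(norm (h t \<omega> - h' t \<omega>))\<^sup>2 \<le> (L * norm (X t \<omega> - X' t \<omega>))\<^sup>2"
        by (rule power_mono) simp
      then show ?case
        by (subst ennreal_mult[symmetric]) (auto simp: power_mult_distrib intro!: ennreal_leI)
    qed
    then have "(\<integral>\<^sup>+\<omega>. ennreal ((norm (h t \<omega> - h' t \<omega>))\<^sup>2) \<partial>P) \<le>
        (\<integral>\<^sup>+\<omega>. ennreal (L\<^sup>2) * ennreal ((norm (X t \<omega> - X' t \<omega>))\<^sup>2) \<partial>P)"
      by (rule nn_integral_mono_AE)
    also have "\<dots> \<le> ennreal (L\<^sup>2) * (\<integral>\<^sup>+\<omega>. ennreal ((norm (X t \<omega> - X' t \<omega>))\<^sup>2) \<partial>P)"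
      using X[OF t] X'[OF t] by (subst nn_integral_cmult) auto
    finally show "(\<integral>\<^sup>+\<omega>. ennreal ((norm (h t \<omega> - h' t \<omega>))\<^sup>2) \<partial>P) \<le>
        ennreal (L\<^sup>2) * (\<integral>\<^sup>+\<omega>. ennreal ((norm (X t \<omega> - X' t \<omega>))\<^sup>2) \<partial>P)" .
  qed simp
qed

text \<open>The mean-square distance of two solutions satisfies a Gronwall inequality: the drift
  enters through Cauchy-Schwarz in time, the diffusion through the isometry. Continuity of paths
  then gives one null set for all times.\<close>

lemma forward_unique:
  fixes b :: "real \<Rightarrow> 'a \<Rightarrow> (real^'n) \<times> (real^'m) \<times> (real^'d^'m) \<Rightarrow> real^'n"
    and \<sigma> :: "real \<Rightarrow> 'a \<Rightarrow> (real^'n) \<times> (real^'m) \<times> (real^'d^'m) \<Rightarrow> real^'d^'n"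
  assumes "0 < T" and b: "b \<in> L2_adapted_Lipschitz P F T" and \<sigma>: "\<sigma> \<in> L2_adapted_Lipschitz P F T"
    and yz: "(y, z) \<in> trial_space P F T"
    and sol: "solves_forward P F W T x0 b \<sigma> y z X" and sol': "solves_forward P F W T x0 b \<sigma> y z X'"
  shows "AE \<omega> in P. \<forall>t\<in>{0..T}. X t \<omega> = X' t \<omega>"
proof -
  have X: "X \<in> L2_continuous P F T" and X': "X' \<in> L2_continuous P F T"
    using sol sol' by (auto simp: solves_forward_def)
  have T0: "0 \<le> T" using \<open>0 < T\<close> by simp
  note arg = trial_argument[OF T0 X yz] and arg' = trial_argument[OF T0 X' yz]
  obtain B where B: "B \<in> L2_adapted P F T" "AE \<omega> in P. \<forall>t\<in>{0..T}. B t \<omega> = b t \<omega> (X t \<omega>, y t \<omega>, z t \<omega>)"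
    using random_field_composition[OF b arg] by blast
  obtain B' where B': "B' \<in> L2_adapted P F T" "AE \<omega> in P. \<forall>t\<in>{0..T}. B' t \<omega> = b t \<omega> (X' t \<omega>, y t \<omega>, z t \<omega>)"
    using random_field_composition[OF b arg'] by blast
  obtain S where S: "S \<in> L2_adapted P F T" "AE \<omega> in P. \<forall>t\<in>{0..T}. S t \<omega> = \<sigma> t \<omega> (X t \<omega>, y t \<omega>, z t \<omega>)"
    using random_field_composition[OF \<sigma> arg] by blast
  obtain S' where S': "S' \<in> L2_adapted P F T" "AE \<omega> in P. \<forall>t\<in>{0..T}. S' t \<omega> = \<sigma> t \<omega> (X' t \<omega>, y t \<omega>, z t \<omega>)"
    using random_field_composition[OF \<sigma> arg'] by blast
  have X_P: "X t \<in> borel_measurable P" "X' t \<in> borel_measurable P" if "t \<in> {0..T}" for t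
    using X X' that by (auto simp: L2_continuous_def intro: measurable_F_P[of t])
  obtain Lb where Lb: "0 \<le> Lb" "\<And>t. t \<in> {0..T} \<Longrightarrow>
    (\<integral>\<^sup>+\<omega>. ennreal ((norm (B t \<omega> - B' t \<omega>))\<^sup>2) \<partial>P) \<le> ennreal Lb * (\<integral>\<^sup>+\<omega>. ennreal ((norm (X t \<omega> - X' t \<omega>))\<^sup>2) \<partial>P)"
    using Lipschitz_forward[OF b B(2) B'(2) X_P] by blast
  obtain Ls where Ls: "0 \<le> Ls" "\<And>t. t \<in> {0..T} \<Longrightarrow>
    (\<integral>\<^sup>+\<omega>. ennreal ((norm (S t \<omega> - S' t \<omega>))\<^sup>2) \<partial>P) \<le> ennreal Ls * (\<integral>\<^sup>+\<omega>. ennreal ((norm (X t \<omega> - X' t \<omega>))\<^sup>2) \<partial>P)"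
    using Lipschitz_forward[OF \<sigma> S(2) S'(2) X_P] by blast
  define \<phi> where "\<phi> t = (\<integral>\<^sup>+\<omega>. ennreal ((norm (X t \<omega> - X' t \<omega>))\<^sup>2) \<partial>P)" for t
  \<comment> \<open>\<open>2 * T * Lb\<close> comes from the drift and \<open>2 * Ls\<close> from
    the diffusion; the summand 1 makes \<open>C\<close> positive even if both Lipschitz constants
    vanish.\<close>
  define C where "C = 2 * T * Lb + 2 * Ls + 1"
  have "0 < C" using \<open>0 < T\<close> Lb(1) Ls(1) by (simp add: C_def add_nonneg_pos)
  have growth: "\<phi> t \<le> ennreal C * (\<integral>\<^sup>+s\<in>{0..t}. \<phi> s \<partial>lborel)" if t: "t \<in> {0..T}" for t
  proof -
    have t0: "(0::real) \<le> 0" "0 \<le> t" "t \<le> T" using t by auto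
    let ?I = "ito_integral P F W 0 t S" and ?I' = "ito_integral P F W 0 t S'"
    \<comment> \<open>The difference of the drift terms, expressed by the other terms of the two
      equations so that its measurability is immediate.\<close>
    let ?E = "\<lambda>\<omega>. X t \<omega> - X' t \<omega> - (?I \<omega> - ?I' \<omega>)"
    have ito: "ito_integral P F W 0 t (\<lambda>s \<omega>. \<sigma> s \<omega> (X s \<omega>, y s \<omega>, z s \<omega>)) = ?I"
      "ito_integral P F W 0 t (\<lambda>s \<omega>. \<sigma> s \<omega> (X' s \<omega>, y s \<omega>, z s \<omega>)) = ?I'"
    proof -
      have "AE \<omega> in P. \<sigma> s \<omega> (X s \<omega>, y s \<omega>, z s \<omega>) = S s \<omega>" if "s \<in> {0..t}" for s
        using S(2) by eventually_elim (use that t in auto)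
      then show "ito_integral P F W 0 t (\<lambda>s \<omega>. \<sigma> s \<omega> (X s \<omega>, y s \<omega>, z s \<omega>)) = ?I"
        unfolding ito_integral_def by (subst has_ito_integral_cong) auto
      have "AE \<omega> in P. \<sigma> s \<omega> (X' s \<omega>, y s \<omega>, z s \<omega>) = S' s \<omega>" if "s \<in> {0..t}" for s
        using S'(2) by eventually_elim (use that t in auto)
      then show "ito_integral P F W 0 t (\<lambda>s \<omega>. \<sigma> s \<omega> (X' s \<omega>, y s \<omega>, z s \<omega>)) = ?I'"
        unfolding ito_integral_def by (subst has_ito_integral_cong) auto
    qed
    note hS = ito_integral_has_ito_integral[OF S(1) t0] and hS' = ito_integral_has_ito_integral[OF S'(1) t0]
    have I_meas [measurable]: "?I \<in> borel_measurable P" "?I' \<in> borel_measurable P"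
      using hS hS' by (auto simp: has_ito_integral_def)
    note [measurable] = X_P[OF t]
    have eqX: "AE \<omega> in P. X t \<omega> = x0 + (LINT s:{0..t}|lborel. b s \<omega> (X s \<omega>, y s \<omega>, z s \<omega>)) + ?I \<omega>"
      using sol t unfolding solves_forward_def ito(1)[symmetric] by blast
    have eqX': "AE \<omega> in P. X' t \<omega> = x0 + (LINT s:{0..t}|lborel. b s \<omega> (X' s \<omega>, y s \<omega>, z s \<omega>)) + ?I' \<omega>"
      using sol' t unfolding solves_forward_def ito(2)[symmetric] by blast
    have "AE \<omega> in P. ennreal ((norm (?E \<omega>))\<^sup>2) \<le>
        ennreal T * (\<integral>\<^sup>+s\<in>{0..t}. ennreal ((norm (B s \<omega> - B' s \<omega>))\<^sup>2) \<partial>lborel)"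
      using eqX eqX' B(2) B'(2) L2_adapted_set_integrable[OF B(1) t] L2_adapted_set_integrable[OF B'(1) t]
    proof eventually_elim
      case (elim \<omega>)
      have "(LINT s:{0..t}|lborel. b s \<omega> (X s \<omega>, y s \<omega>, z s \<omega>)) = (LINT s:{0..t}|lborel. B s \<omega>)"
        "(LINT s:{0..t}|lborel. b s \<omega> (X' s \<omega>, y s \<omega>, z s \<omega>)) = (LINT s:{0..t}|lborel. B' s \<omega>)"
        using elim(3,4) t by (auto intro!: set_lebesgue_integral_cong)
      then have "?E \<omega> = (LINT s:{0..t}|lborel. B s \<omega> - B' s \<omega>)"
        using elim(1,2) set_integral_diff(2)[OF elim(5,6)] by simp
      then have "ennreal ((norm (?E \<omega>))\<^sup>2) \<le>
          ennreal t * (\<integral>\<^sup>+s\<in>{0..t}. ennreal ((norm (B s \<omega> - B' s \<omega>))\<^sup>2) \<partial>lborel)"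
        using norm_sq_set_integral_le[OF t0(2) set_integral_diff(1)[OF elim(5,6)]] by simp
      also have "\<dots> \<le> ennreal T * (\<integral>\<^sup>+s\<in>{0..t}. ennreal ((norm (B s \<omega> - B' s \<omega>))\<^sup>2) \<partial>lborel)"
        using t by (intro mult_right_mono ennreal_leI) auto
      finally show ?case .
    qed
    then have "(\<integral>\<^sup>+\<omega>. ennreal ((norm (?E \<omega>))\<^sup>2) \<partial>P) \<le>
        (\<integral>\<^sup>+\<omega>. ennreal T * (\<integral>\<^sup>+s\<in>{0..t}. ennreal ((norm (B s \<omega> - B' s \<omega>))\<^sup>2) \<partial>lborel) \<partial>P)"
      by (rule nn_integral_mono_AE)
    also have "\<dots> = ennreal T * (\<integral>\<^sup>+s\<in>{0..t}. (\<integral>\<^sup>+\<omega>. ennreal ((norm (B s \<omega> - B' s \<omega>))\<^sup>2) \<partial>P) \<partial>lborel)"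
    proof -
      note joint = measurable_process_diff[OF L2_adapted_joint[OF B(1) t0(1,3)] L2_adapted_joint[OF B'(1) t0(1,3)]]
      show ?thesis
        unfolding norm_sq_set_Fubini(2)[OF joint, symmetric]
        by (rule nn_integral_cmult[OF norm_sq_set_Fubini(1)[OF joint]])
    qed
    also have "\<dots> \<le> ennreal T * (\<integral>\<^sup>+s\<in>{0..t}. ennreal Lb * \<phi> s \<partial>lborel)"
      using Lb(2) t unfolding \<phi>_def by (intro mult_left_mono nn_integral_mono) (auto split: split_indicator)
    finally have 1: "(\<integral>\<^sup>+\<omega>. ennreal ((norm (?E \<omega>))\<^sup>2) \<partial>P) \<le> ennreal T * (\<integral>\<^sup>+s\<in>{0..t}. ennreal Lb * \<phi> s \<partial>lborel)" .
    have "(\<integral>\<^sup>+\<omega>. ennreal ((norm (?I \<omega> - ?I' \<omega>))\<^sup>2) \<partial>P) =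
        (\<integral>\<^sup>+s\<in>{0..t}. (\<integral>\<^sup>+\<omega>. ennreal ((norm (S s \<omega> - S' s \<omega>))\<^sup>2) \<partial>P) \<partial>lborel)"
      using has_ito_integral_isometry[OF hS hS' S(1) S'(1) t0, of "\<lambda>_. 0"] by simp
    also have "\<dots> \<le> (\<integral>\<^sup>+s\<in>{0..t}. ennreal Ls * \<phi> s \<partial>lborel)"
      using Ls(2) t unfolding \<phi>_def by (intro nn_integral_mono) (auto split: split_indicator)
    finally have 2: "(\<integral>\<^sup>+\<omega>. ennreal ((norm (?I \<omega> - ?I' \<omega>))\<^sup>2) \<partial>P) \<le> (\<integral>\<^sup>+s\<in>{0..t}. ennreal Ls * \<phi> s \<partial>lborel)" .
    have \<phi>_meas: "(\<lambda>s. \<phi> s * indicator {0..t} s) \<in> borel_measurable borel"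
      unfolding \<phi>_def
      by (intro norm_sq_set_Fubini(3) measurable_process_diff
          L2_adapted_joint[OF L2_continuous_L2_adapted[OF X T0] t0(1,3)]
          L2_adapted_joint[OF L2_continuous_L2_adapted[OF X' T0] t0(1,3)])
    have cmult: "(\<integral>\<^sup>+s\<in>{0..t}. ennreal c * \<phi> s \<partial>lborel) = ennreal c * (\<integral>\<^sup>+s\<in>{0..t}. \<phi> s \<partial>lborel)" for c
      using \<phi>_meas by (subst nn_integral_cmult[symmetric]) (auto simp: mult.assoc)
    have "\<phi> t = (\<integral>\<^sup>+\<omega>. ennreal ((norm (?E \<omega> - (?I' \<omega> - ?I \<omega>)))\<^sup>2) \<partial>P)"
      by (simp add: \<phi>_def algebra_simps)
    also have "\<dots> \<le> 2 * (\<integral>\<^sup>+\<omega>. ennreal ((norm (?E \<omega>))\<^sup>2) \<partial>P) + 2 * (\<integral>\<^sup>+\<omega>. ennreal ((norm (?I' \<omega> - ?I \<omega>))\<^sup>2) \<partial>P)"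
      by (rule nn_integral_norm_sq_diff_le) measurable
    also have "\<dots> \<le> 2 * (ennreal T * (\<integral>\<^sup>+s\<in>{0..t}. ennreal Lb * \<phi> s \<partial>lborel)) + 2 * (\<integral>\<^sup>+s\<in>{0..t}. ennreal Ls * \<phi> s \<partial>lborel)"
      using 1 2 by (intro add_mono mult_left_mono) (auto simp: norm_minus_commute)
    also have "\<dots> = (2 * (ennreal T * ennreal Lb) + 2 * ennreal Ls) * (\<integral>\<^sup>+s\<in>{0..t}. \<phi> s \<partial>lborel)"
      unfolding cmult by (simp add: distrib_right mult.assoc)
    also have "\<dots> \<le> ennreal C * (\<integral>\<^sup>+s\<in>{0..t}. \<phi> s \<partial>lborel)"
    proof (rule mult_right_mono)
      have "2 * (ennreal T * ennreal Lb) + 2 * ennreal Ls = ennreal (2 * (T * Lb) + 2 * Ls)"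
        using T0 Lb(1) Ls(1) by (simp add: ennreal_mult ennreal_plus)
      also have "\<dots> \<le> ennreal C" by (intro ennreal_leI) (simp add: C_def)
      finally show "2 * (ennreal T * ennreal Lb) + 2 * ennreal Ls \<le> ennreal C" .
    qed simp
    finally show ?thesis .
  qed
  obtain K where K: "K < \<infinity>" "\<And>t. t \<in> {0..T} \<Longrightarrow> (\<integral>\<^sup>+\<omega>. ennreal ((norm (X t \<omega>))\<^sup>2) \<partial>P) \<le> K"
    using L2_continuous_bound[OF X] by blast
  obtain K' where K': "K' < \<infinity>" "\<And>t. t \<in> {0..T} \<Longrightarrow> (\<integral>\<^sup>+\<omega>. ennreal ((norm (X' t \<omega>))\<^sup>2) \<partial>P) \<le> K'"
    using L2_continuous_bound[OF X'] by blast
  \<comment> \<open>The integral inequality alone would admit an infinite distance; square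
    integrability of both solutions rules it out.\<close>
  have bound: "\<phi> t \<le> 2 * K + 2 * K'" if t: "t \<in> {0..T}" for t
  proof -
    have "\<phi> t \<le> 2 * (\<integral>\<^sup>+\<omega>. ennreal ((norm (X t \<omega>))\<^sup>2) \<partial>P) + 2 * (\<integral>\<^sup>+\<omega>. ennreal ((norm (X' t \<omega>))\<^sup>2) \<partial>P)"
      unfolding \<phi>_def by (rule nn_integral_norm_sq_diff_le[OF X_P[OF t]])
    also have "\<dots> \<le> 2 * K + 2 * K'"
      by (intro add_mono mult_left_mono K(2) K'(2) t) auto
    finally show ?thesis .
  qed
  have "2 * K + 2 * K' < top" using K(1) K'(1) by (simp add: ennreal_mult_less_top)
  have zero: "\<phi> t = 0" if "t \<in> {0..T}" for t
    using Gronwall_zero[OF \<open>0 < C\<close> \<open>2 * K + 2 * K' < top\<close> bound growth that] .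
  show ?thesis
  proof (rule continuous_processes_indistinguishable[OF T0])
    fix t assume t: "t \<in> {0..T}"
    note [measurable] = X_P[OF t]
    have "AE \<omega> in P. ennreal ((norm (X t \<omega> - X' t \<omega>))\<^sup>2) = 0"
      using zero[OF t] unfolding \<phi>_def by (subst nn_integral_0_iff_AE[symmetric]) auto
    then show "AE \<omega> in P. X t \<omega> = X' t \<omega>" by eventually_elim simp
  qed (use X X' in \<open>auto simp: L2_continuous_def\<close>)
qed

end

section \<open>The identity between loss and distance, time by time\<close>

theorem proposition5:
  fixes P :: "'a measure"
    and W :: "real \<Rightarrow> 'a \<Rightarrow> real^'d"
    and T :: real
    and \<mu> :: "real measure"
    and F :: "real \<Rightarrow> 'a measure"
    and x0 :: "real^'n"
    and b :: "real \<Rightarrow> 'a \<Rightarrow> (real^'n) \<times> (real^'m) \<times> (real^'d^'m) \<Rightarrow> real^'n"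
    and \<sigma> :: "real \<Rightarrow> 'a \<Rightarrow> (real^'n) \<times> (real^'m) \<times> (real^'d^'m) \<Rightarrow> real^'d^'n"
    and f :: "real \<Rightarrow> 'a \<Rightarrow> (real^'n) \<times> (real^'m) \<times> (real^'d^'m) \<Rightarrow> real^'m"
    and g :: "'a \<Rightarrow> real^'n \<Rightarrow> real^'m"
  assumes "0 < T"
    and "prob_space P" and "complete_measure P"
    and "brownian_motion P T W"
    and "F = brownian_filtration P W"
    and "sets \<mu> = sets (restrict_space borel {0..T})" and "sigma_finite_measure \<mu>"
    and "b \<in> L2_adapted_Lipschitz P F T"
    and "\<sigma> \<in> L2_adapted_Lipschitz P F T"
    and "f \<in> L2_adapted_Lipschitz P F T"
    and "g \<in> L2_terminal_Lipschitz P (F T)"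
  shows "\<forall>y z. (y, z) \<in> trial_space P F T \<longrightarrow>
    (\<forall>X Y Z. solves_forward P F W T x0 b \<sigma> y z X \<and> solves_backward P F W T f g y z X Y Z \<longrightarrow>
      BML P F W T x0 b \<sigma> f g y z \<mu> = trial_dist P T \<mu> (y, z) (Y, Z))"
proof (intro allI impI)
  fix y z X Y Z
  assume yz: "(y, z) \<in> trial_space P F T"
    and sol: "solves_forward P F W T x0 b \<sigma> y z X \<and> solves_backward P F W T f g y z X Y Z"
  note F = \<open>F = brownian_filtration P W\<close>
  interpret prob_space P by fact
  interpret brownian P W T by unfold_locales fact
  have forward: "solves_forward P F W T x0 b \<sigma> y z X" and backward: "solves_backward P F W T f g y z X Y Z"
    using sol by auto
  have y: "y \<in> L2_continuous P F T" and z: "z \<in> L2_adapted P F T"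
    using yz by (auto simp: trial_space_def)
  have Y: "Y \<in> L2_continuous P F T" and Z: "Z \<in> L2_adapted P F T"
    using backward by (auto simp: solves_backward_def trial_space_def)
  \<comment> \<open>The forward solution chosen inside the loss; the given \<open>X\<close>
    guarantees that the choice is not vacuous.\<close>
  define X0 where "X0 = (SOME X. solves_forward P F W T x0 b \<sigma> y z X)"
  have "solves_forward P F W T x0 b \<sigma> y z X0"
    unfolding X0_def by (rule someI[of "solves_forward P F W T x0 b \<sigma> y z", OF forward])
  then have X0: "AE \<omega> in P. \<forall>t\<in>{0..T}. X0 t \<omega> = X t \<omega>"
    using forward_unique[OF \<open>0 < T\<close>, of b \<sigma> y z x0 X0 X] yz forward
      \<open>b \<in> L2_adapted_Lipschitz P F T\<close> \<open>\<sigma> \<in> L2_adapted_Lipschitz P F T\<close>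
    unfolding F by blast
  \<comment> \<open>The measure lives on \<open>{0..T}\<close>, so equality of the integrands at
    these times is enough.\<close>
  have "space \<mu> = space (restrict_space borel {0..T})"
    by (rule sets_eq_imp_space_eq) fact
  then have space: "space \<mu> = {0..T}" by (simp add: space_restrict_space)
  have "(\<integral>\<^sup>+\<omega>. ennreal ((norm (y t \<omega> - (g \<omega> (X0 T \<omega>) + (LINT s:{t..T}|lborel. f s \<omega> (X0 s \<omega>, y s \<omega>, z s \<omega>))
          - ito_integral P F W t T z \<omega>)))\<^sup>2) \<partial>P) =
      (\<integral>\<^sup>+\<omega>. (ennreal ((norm (y t \<omega> - Y t \<omega>))\<^sup>2)
       + (\<integral>\<^sup>+s\<in>{t..T}. ennreal ((norm (z s \<omega> - Z s \<omega>))\<^sup>2) \<partial>lborel)) \<partial>P)" (is "?lhs = ?rhs")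
    if t: "t \<in> {0..T}" for t
  proof -
    have t': "0 \<le> t" "t \<le> T" "T \<le> T" using t by auto
    let ?Iz = "ito_integral P F W t T z" and ?IZ = "ito_integral P F W t T Z"
    have yt: "y t \<in> borel_measurable (F t)" and Yt: "Y t \<in> borel_measurable (F t)"
      using y Y t by (auto simp: L2_continuous_def)
    have yP [measurable]: "y t \<in> borel_measurable P" and YP [measurable]: "Y t \<in> borel_measurable P"
      using yt Yt measurable_F_P[OF t'(2)] unfolding F by auto
    \<comment> \<open>Measurability at time \<open>t\<close>, and not merely in \<open>P\<close>, is
      what makes this difference orthogonal to the integrals from \<open>t\<close> to
      \<open>T\<close>.\<close>
    have yY: "(\<lambda>\<omega>. y t \<omega> - Y t \<omega>) \<in> borel_measurable (F t)"
      using yt Yt by (rule borel_measurable_diff)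
    have yY_fin: "(\<integral>\<^sup>+\<omega>. ennreal ((norm (y t \<omega> - Y t \<omega>))\<^sup>2) \<partial>P) < \<infinity>"
    proof -
      obtain K where K: "K < \<infinity>" "\<And>t. t \<in> {0..T} \<Longrightarrow> (\<integral>\<^sup>+\<omega>. ennreal ((norm (y t \<omega>))\<^sup>2) \<partial>P) \<le> K"
        using L2_continuous_bound[OF y[unfolded F]] by blast
      obtain K' where K': "K' < \<infinity>" "\<And>t. t \<in> {0..T} \<Longrightarrow> (\<integral>\<^sup>+\<omega>. ennreal ((norm (Y t \<omega>))\<^sup>2) \<partial>P) \<le> K'"
        using L2_continuous_bound[OF Y[unfolded F]] by blast
      have "(\<integral>\<^sup>+\<omega>. ennreal ((norm (y t \<omega> - Y t \<omega>))\<^sup>2) \<partial>P) \<le>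
          2 * (\<integral>\<^sup>+\<omega>. ennreal ((norm (y t \<omega>))\<^sup>2) \<partial>P) + 2 * (\<integral>\<^sup>+\<omega>. ennreal ((norm (Y t \<omega>))\<^sup>2) \<partial>P)"
        by (rule nn_integral_norm_sq_diff_le[OF yP YP])
      also have "\<dots> \<le> 2 * K + 2 * K'"
        by (intro add_mono mult_left_mono K(2) K'(2) t) auto
      also have "\<dots> < \<infinity>" using K(1) K'(1) by (simp add: ennreal_mult_less_top)
      finally show ?thesis .
    qed
    have "AE \<omega> in P. Y t \<omega> = g \<omega> (X T \<omega>) + (LINT s:{t..T}|lborel. f s \<omega> (X s \<omega>, y s \<omega>, z s \<omega>)) - ?IZ \<omega>"
      using backward t unfolding solves_backward_def by blast
    \<comment> \<open>The residual and the equation for \<open>Y\<close> contain the same terminal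
      value and the same driver at the trial pair. These cancel, and only the two Ito integrals
      remain.\<close>
    with X0 have eq: "AE \<omega> in P. y t \<omega> - (g \<omega> (X0 T \<omega>) + (LINT s:{t..T}|lborel. f s \<omega> (X0 s \<omega>, y s \<omega>, z s \<omega>)) - ?Iz \<omega>)
        = y t \<omega> - Y t \<omega> + (?Iz \<omega> - ?IZ \<omega>)"
    proof eventually_elim
      case (elim \<omega>)
      have "(LINT s:{t..T}|lborel. f s \<omega> (X0 s \<omega>, y s \<omega>, z s \<omega>)) = (LINT s:{t..T}|lborel. f s \<omega> (X s \<omega>, y s \<omega>, z s \<omega>))"
        using elim(1) t by (auto intro!: set_lebesgue_integral_cong)
      moreover have "X0 T \<omega> = X T \<omega>" using elim(1) t by auto
      ultimately show ?case using elim(2) by (simp add: algebra_simps)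
    qed
    have "?lhs = (\<integral>\<^sup>+\<omega>. ennreal ((norm (y t \<omega> - Y t \<omega> + (?Iz \<omega> - ?IZ \<omega>)))\<^sup>2) \<partial>P)"
      by (rule nn_integral_cong_AE, rule eventually_mono[OF eq]) (simp only:)
    also have "\<dots> = (\<integral>\<^sup>+\<omega>. ennreal ((norm (y t \<omega> - Y t \<omega>))\<^sup>2) \<partial>P) +
        (\<integral>\<^sup>+s\<in>{t..T}. (\<integral>\<^sup>+\<omega>. ennreal ((norm (z s \<omega> - Z s \<omega>))\<^sup>2) \<partial>P) \<partial>lborel)"
      using has_ito_integral_isometry[OF ito_integral_has_ito_integral ito_integral_has_ito_integral _ _ t',
          of z Z "\<lambda>\<omega>. y t \<omega> - Y t \<omega>"] z Z t' yY yY_fin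
      unfolding F by blast
    \<comment> \<open>The isometry integrates over outcomes first and the distance over time first;
      Fubini exchanges the two.\<close>
    also have "\<dots> = ?rhs"
    proof -
      note joint = measurable_process_diff[OF L2_adapted_joint[OF z t'(1,3)] L2_adapted_joint[OF Z t'(1,3)]]
      show ?thesis
        unfolding norm_sq_set_Fubini(2)[OF joint, symmetric]
        by (rule nn_integral_add[symmetric, OF _ norm_sq_set_Fubini(1)[OF joint]]) measurable
    qed
    finally show ?thesis .
  qed
  then show "BML P F W T x0 b \<sigma> f g y z \<mu> = trial_dist P T \<mu> (y, z) (Y, Z)"
    unfolding BML_def trial_dist_def Let_def X0_def[symmetric] prod.case
    by (rule nn_integral_cong) (simp only: space)
qed

end
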